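(* Let $d\ge2$, $\mathcal{C}>0$, and let $X$ be a $p_n$-ERW in direction $\ell\in\mathbb{S}^{d-1}$ on $\mathbb{Z}^d$ with $p_n=\mathcal{C}n^{-1/2}\wedge1$. For $n\ge1$ and $t\ge0$ let $$\hat B_t^n=\frac{X_{\lfloor nt\rfloor}}{n^{1/2}}+(nt-\lfloor nt\rfloor)\frac{X_{\lfloor nt\rfloor+1}-X_{\lfloor nt\rfloor}}{n^{1/2}}.$$ Then $\{\hat B^n_\cdot\}_{n\ge1}$ is tight in $C_{\mathbb{R}^d}[0,\infty)$, and for any of its limit points (in distribution) $\mathcal{Y}_\cdot$ it holds that $$\{\mathcal{Y}_t\cdot\ell\}_{t\ge0}\preceq\big\{W_t\cdot\ell+2\,\mathcal{C}\,\pi_d\,\mathbb{E}[\gamma_1\cdot\ell]\sqrt{t}\big\}_{t\ge0},$$ where $W_\cdot$ is a Brownian motion in $\mathbb{R}^d$ and $\preceq$ denotes stochastic domination.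
   Context: Definition of the $p_n$-ERW in direction $\ell$ on $\mathbb{Z}^d$. Let $d\ge 2$, let $\ell\in\mathbb{S}^{d-1}$ (the unit sphere of $\mathbb{R}^d$), let $\|\cdot\|$ be the Euclidean norm, and let $\{p_n\}_{n\ge1}\subset(0,1]$. Let $\{\xi_i\}_{i\ge1}$ and $\{\gamma_i\}_{i\ge1}$ be sequences of $\mathbb{Z}^d$-valued random vectors on a probability space $(\Omega,\mathcal{F},\mathbb{P})$, adapted to a filtration $\{\mathcal{F}_n\}_{n\ge0}$ (with $\mathcal{F}_0$ containing all null sets), such that: (i) there is a constant $K>0$ with $\sup_{n}\|\xi_n\|\le K$ and $\sup_n\|\gamma_n\|\le K$ on every realization; (ii) there is a constant $\lambda>0$ such that for all $n\ge1$, $\mathbb{E}[\xi_n\mid\mathcal{F}_{n-1}]=0$ and $\mathbb{E}[\gamma_n\cdot\ell\mid\mathcal{F}_{n-1}]\ge\lambda$; (iii) $\{\xi_i\}$ is i.i.d. with zero mean vector and finite covariance matrix, and $\mathbb{P}[\xi_i\cdot\ell'=0]<1$ for all $\ell'\in\mathbb{S}^{d-1}$; (iv) $\{\gamma_i\}$ is i.i.d., and the sequences $\{\xi_i\}$ and $\{\gamma_i\}$ are independent of each other. Let $\{U_i\}_{i\ge1}$ be i.i.d. uniform on $[0,1]$, independent of $(\{\xi_i\},\{\gamma_i\})$. Set $X_0=0$, $E_0=\emptyset$, and for $n\ge1$ let $E_n=\{\exists k<n:\ X_k=X_n\}$. The process $X=\{X_n\}_{n\ge0}$ is defined by $$X_n=\sum_{i=1}^n\Big(\mathbf{1}_{E_{i-1}}\xi_i+\mathbf{1}_{E_{i-1}^c\cap\{U_i>p_i\}}\xi_i+\mathbf{1}_{E_{i-1}^c\cap\{U_i\le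 p_i\}}\gamma_i\Big),\quad n\ge1.$$ The constant $\pi_d$ is the probability that the random walk $Y_n=\sum_{i=1}^n\xi_i$, $Y_0=0$, never returns to the origin. $a\wedge b=\min(a,b)$. $C_{\mathbb{R}^d}[0,\infty)$ is the space of continuous functions $[0,\infty)\to\mathbb{R}^d$ with the metric $\rho(f,g)=\sum_{k\ge1}2^{-k}\sup_{0\le t\le k}(\|f(t)-g(t)\|\wedge1)$. "Brownian motion" means a centered Brownian motion started at $0$, with some (not necessarily identity) covariance matrix. For real-valued continuous processes, $\{A_t\}\preceq\{B_t\}$ means stochastic domination of processes: $\mathbb{E}[F(A)]\le\mathbb{E}[F(B)]$ for every bounded measurable functional $F$ on $C_{\mathbb{R}}[0,\infty)$ that is nondecreasing for the pointwise order. *)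

theory Defs
  imports "HOL-Probability.Probability"
begin

section \<open>The path space of continuous functions on the half-line\<close>

text \<open>Paths are functions on \<open>[0,\<infinity>)\<close>, so their values at negative arguments are fixed by
  extensionality.\<close>

typedef (overloaded) 'a cpath =
  "{f :: real \<Rightarrow> 'a::real_normed_vector. continuous_on {0..} f \<and> f \<in> extensional {0..}}"
  morphisms path_at Abs_cpath
proof
  show "restrict (\<lambda>_. 0) {0..} \<in>
      {f :: real \<Rightarrow> 'a. continuous_on {0..} f \<and> f \<in> extensional {0..}}"
    by (auto intro: continuous_on_eq[of _ "\<lambda>_. 0"])
qed

text \<open>Only meaningful when \<open>f\<close> is continuous on \<open>[0,\<infinity>)\<close>.\<close>

definition cpath_of :: "(real \<Rightarrow> 'a::real_normed_vector) \<Rightarrow> 'a cpath" where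
  "cpath_of f = Abs_cpath (restrict f {0..})"

lemma path_at_cpath_of:
  assumes "continuous_on {0..} f" and "t \<ge> 0"
  shows "path_at (cpath_of f) t = f t"
proof -
  have "continuous_on {0..} (restrict f {0..})"
    using assms(1) by (rule continuous_on_eq) auto
  then show ?thesis
    using assms(2) by (simp add: cpath_of_def Abs_cpath_inverse)
qed

lemma continuous_on_path_at: "continuous_on {0..} (path_at f)"
  using path_at[of f] by simp

lemma cpath_eqI:
  assumes "\<And>t. t \<ge> 0 \<Longrightarrow> path_at f t = path_at g t"
  shows "f = g"
proof -
  have "path_at f = path_at g"
    by (rule extensionalityI[of _ "{0..}"]) (use path_at[of f] path_at[of g] assms in auto)
  then show ?thesis by (simp add: path_at_inject)
qed

definition trunc_sup :: "nat \<Rightarrow> 'a::real_normed_vector cpath \<Rightarrow> 'a cpath \<Rightarrow> real" where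
  "trunc_sup k f g = (SUP t\<in>{0..real k}. min (norm (path_at f t - path_at g t)) 1)"

lemma trunc_sup_bdd:
  "bdd_above ((\<lambda>t. min (norm (path_at f t - path_at g t)) 1) ` {0..real k})"
  by (rule bdd_aboveI[of _ 1]) auto

lemma trunc_sup_upper:
  assumes "0 \<le> t" "t \<le> real k"
  shows "min (norm (path_at f t - path_at g t)) 1 \<le> trunc_sup k f g"
  unfolding trunc_sup_def by (rule cSUP_upper[OF _ trunc_sup_bdd]) (use assms in auto)

lemma trunc_sup_least:
  assumes "\<And>t. 0 \<le> t \<Longrightarrow> t \<le> real k \<Longrightarrow> min (norm (path_at f t - path_at g t)) 1 \<le> c"
  shows "trunc_sup k f g \<le> c"
  unfolding trunc_sup_def by (rule cSUP_least) (use assms in auto)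

lemma trunc_sup_nonneg: "0 \<le> trunc_sup k f g"
  by (rule order_trans[OF _ trunc_sup_upper[of 0]]) auto

lemma trunc_sup_le_1: "trunc_sup k f g \<le> 1"
  by (rule trunc_sup_least) auto

lemma trunc_sup_triangle: "trunc_sup k f g \<le> trunc_sup k f h + trunc_sup k g h"
proof (rule trunc_sup_least)
  fix t :: real assume t: "0 \<le> t" "t \<le> real k"
  have "norm (path_at f t - path_at g t)
      \<le> norm (path_at f t - path_at h t) + norm (path_at g t - path_at h t)"
    by (metis dist_norm dist_triangle2)
  then show "min (norm (path_at f t - path_at g t)) 1 \<le> trunc_sup k f h + trunc_sup k g h"
    using trunc_sup_upper[OF t, of f h] trunc_sup_upper[OF t, of g h]
      norm_ge_zero[of "path_at f t - path_at h t"] norm_ge_zero[of "path_at g t - path_at h t"]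
    by linarith
qed

lemma summable_trunc_sup: "summable (\<lambda>k. (1/2)^(Suc k) * trunc_sup (Suc k) f g)"
proof (rule summable_comparison_test)
  show "summable (\<lambda>k. (1/2)^(Suc k) :: real)"
    by (simp add: summable_geometric summable_mult)
  show "\<exists>N. \<forall>n\<ge>N. norm ((1/2)^(Suc n) * trunc_sup (Suc n) f g) \<le> (1/2)^(Suc n)"
    by (auto simp: abs_mult trunc_sup_nonneg trunc_sup_le_1 intro!: mult_left_le)
qed

instantiation cpath :: (real_normed_vector) metric_space
begin

text \<open>The summation index is shifted by one, so that it starts at \<open>k = 1\<close>.\<close>

definition dist_cpath :: "'a cpath \<Rightarrow> 'a cpath \<Rightarrow> real" where
  "dist_cpath f g = (\<Sum>k. (1/2)^(Suc k) * trunc_sup (Suc k) f g)"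

definition uniformity_cpath :: "('a cpath \<times> 'a cpath) filter" where
  "uniformity_cpath = (INF e\<in>{0<..}. principal {(x, y). dist x y < e})"

definition open_cpath :: "'a cpath set \<Rightarrow> bool" where
  "open_cpath U \<longleftrightarrow> (\<forall>x\<in>U. eventually (\<lambda>(x', y). x' = x \<longrightarrow> y \<in> U) uniformity)"

instance
proof
  fix f g h :: "'a cpath"
  show "dist f g = 0 \<longleftrightarrow> f = g"
  proof
    assume "dist f g = 0"
    then have 0: "\<forall>k. (1/2)^(Suc k) * trunc_sup (Suc k) f g = 0"
      unfolding dist_cpath_def
      by (subst (asm) suminf_eq_zero_iff[OF summable_trunc_sup])
         (auto simp: trunc_sup_nonneg)
    show "f = g"
    proof (rule cpath_eqI)
      fix t :: real assume "t \<ge> 0"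
      moreover obtain k where "t \<le> real k" using real_arch_simple by blast
      ultimately have "min (norm (path_at f t - path_at g t)) 1 \<le> trunc_sup (Suc k) f g"
        by (intro trunc_sup_upper) auto
      also have "\<dots> = 0" using 0[rule_format, of k] by simp
      finally show "path_at f t = path_at g t" by (auto simp: min_def split: if_splits)
    qed
  next
    assume "f = g"
    have "trunc_sup k g g = 0" for k
      by (rule antisym[OF trunc_sup_least trunc_sup_nonneg]) auto
    then show "dist f g = 0" using \<open>f = g\<close> by (simp add: dist_cpath_def)
  qed
  have "dist f g \<le> (\<Sum>k. (1/2)^(Suc k) * trunc_sup (Suc k) f h
      + (1/2)^(Suc k) * trunc_sup (Suc k) g h)"
    unfolding dist_cpath_def
  proof (rule suminf_le[OF _ summable_trunc_sup summable_add[OF summable_trunc_sup summable_trunc_sup]])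
    show "(1/2)^(Suc k) * trunc_sup (Suc k) f g
        \<le> (1/2)^(Suc k) * trunc_sup (Suc k) f h + (1/2)^(Suc k) * trunc_sup (Suc k) g h" for k
      unfolding distrib_left[symmetric] by (rule mult_left_mono[OF trunc_sup_triangle]) auto
  qed
  also have "\<dots> = dist f h + dist g h"
    unfolding dist_cpath_def by (rule suminf_add[OF summable_trunc_sup summable_trunc_sup, symmetric])
  finally show "dist f g \<le> dist f h + dist g h" .
qed (rule uniformity_cpath_def open_cpath_def)+

end

section \<open>Tightness, limits in distribution and stochastic domination\<close>

text \<open>The library's \<open>tight\<close> and \<open>weak_conv_m\<close> cover laws on the real line only.\<close>

definition tight_family :: "'a::topological_space measure set \<Rightarrow> bool" where
  "tight_family L \<longleftrightarrow>
     (\<forall>\<mu>\<in>L. prob_space \<mu> \<and> sets \<mu> = sets borel) \<and>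
     (\<forall>\<epsilon>>0. \<exists>K. compact K \<and> (\<forall>\<mu>\<in>L. measure \<mu> K \<ge> 1 - \<epsilon>))"

definition weak_conv_law :: "(nat \<Rightarrow> 'a::topological_space measure) \<Rightarrow> 'a measure \<Rightarrow> bool" where
  "weak_conv_law \<mu>s \<mu> \<longleftrightarrow>
     (\<forall>f :: 'a \<Rightarrow> real. continuous_on UNIV f \<longrightarrow> bounded (range f) \<longrightarrow>
        (\<lambda>n. integral\<^sup>L (\<mu>s n) f) \<longlonglongrightarrow> integral\<^sup>L \<mu> f)"

text \<open>Subsequential limit law of a sequence indexed by \<open>n \<ge> 1\<close>.\<close>

definition limit_law :: "(nat \<Rightarrow> 'a::topological_space measure) \<Rightarrow> 'a measure \<Rightarrow> bool" where
  "limit_law \<mu>s \<nu> \<longleftrightarrow>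
     prob_space \<nu> \<and> sets \<nu> = sets borel \<and>
     (\<exists>r. strict_mono r \<and> (\<forall>k. r k \<ge> 1) \<and> weak_conv_law (\<lambda>k. \<mu>s (r k)) \<nu>)"

text \<open>The two processes may live on different probability spaces.\<close>

definition stoch_dominated ::
  "'a measure \<Rightarrow> ('a \<Rightarrow> real cpath) \<Rightarrow> 'b measure \<Rightarrow> ('b \<Rightarrow> real cpath) \<Rightarrow> bool" where
  "stoch_dominated M A N B \<longleftrightarrow>
     (\<forall>F :: real cpath \<Rightarrow> real.
        F \<in> borel_measurable borel \<longrightarrow> bounded (range F) \<longrightarrow>
        (\<forall>f g. (\<forall>t\<ge>0. path_at f t \<le> path_at g t) \<longrightarrow> F f \<le> F g) \<longrightarrow>
        (\<integral>\<omega>. F (A \<omega>) \<partial>M) \<le> (\<integral>\<omega>. F (B \<omega>) \<partial>N))"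

section \<open>Brownian motion with a general covariance matrix\<close>

definition centered_normal :: "real \<Rightarrow> real measure" where
  "centered_normal v =
     (if v = 0 then return borel 0 else density lborel (normal_density 0 (sqrt v)))"

text \<open>The covariance matrix \<open>S\<close> may be singular; a random vector is centered Gaussian with
  covariance \<open>S\<close> iff each of its linear functionals \<open>u\<close> is centered normal with variance
  \<open>u \<bullet> S u\<close>.\<close>

definition brownian_motion :: "'b measure \<Rightarrow> ('b \<Rightarrow> (real^'d) cpath) \<Rightarrow> bool" where
  "brownian_motion N W \<longleftrightarrow>
     prob_space N \<and> W \<in> N \<rightarrow>\<^sub>M borel \<and>
     (AE \<omega> in N. path_at (W \<omega>) 0 = 0) \<and>
     (\<forall>(t :: nat \<Rightarrow> real) n. 0 \<le> t 0 \<longrightarrow> strict_mono t \<longrightarrow>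
        prob_space.indep_vars N (\<lambda>_. borel)
          (\<lambda>i \<omega>. path_at (W \<omega>) (t (Suc i)) - path_at (W \<omega>) (t i)) {..<n}) \<and>
     (\<exists>S :: real^'d^'d. transpose S = S \<and> (\<forall>u. 0 \<le> u \<bullet> (S *v u)) \<and>
        (\<forall>s t u. 0 \<le> s \<longrightarrow> s < t \<longrightarrow>
           distr N borel (\<lambda>\<omega>. u \<bullet> (path_at (W \<omega>) t - path_at (W \<omega>) s))
             = centered_normal ((t - s) * (u \<bullet> (S *v u)))))"

section \<open>The excited random walk\<close>

definition revisit :: "(nat \<Rightarrow> 'a \<Rightarrow> 'b) \<Rightarrow> nat \<Rightarrow> 'a set" where
  "revisit X n = {\<omega>. \<exists>k<n. X k \<omega> = X n \<omega>}"

text \<open>Vectors of \<open>\<int>\<^sup>d\<close> are represented as real vectors with integer coordinates. All sequences are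
  used from index 1 on (index 0 for \<open>X\<close> and \<open>F\<close>). The conditional expectation of a vector is taken
  coordinatewise. Independence of \<open>U\<close> from the pair \<open>(\<xi>, \<gamma>)\<close> is stated for the generated
  \<open>\<sigma>\<close>-algebras, since \<open>indep_var\<close> requires both variables to have the same type.\<close>

locale excited_random_walk = prob_space M
  for M :: "'a measure" +
  fixes F :: "nat \<Rightarrow> 'a measure"
    and l :: "real^'d"
    and p :: "nat \<Rightarrow> real"
    and \<xi> \<gamma> :: "nat \<Rightarrow> 'a \<Rightarrow> real^'d"
    and U :: "nat \<Rightarrow> 'a \<Rightarrow> real"
    and X :: "nat \<Rightarrow> 'a \<Rightarrow> real^'d"
  assumes direction: "norm l = 1"
    and p_range: "\<And>n. n \<ge> 1 \<Longrightarrow> p n \<in> {0<..1}"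
    and lattice_\<xi>: "\<And>n \<omega> j. n \<ge> 1 \<Longrightarrow> \<omega> \<in> space M \<Longrightarrow> \<xi> n \<omega> $ j \<in> \<int>"
    and lattice_\<gamma>: "\<And>n \<omega> j. n \<ge> 1 \<Longrightarrow> \<omega> \<in> space M \<Longrightarrow> \<gamma> n \<omega> $ j \<in> \<int>"
    and filtration: "filtration (space M) F" "\<And>n. subalgebra M (F n)"
    and null_sets_F0: "null_sets M \<subseteq> sets (F 0)"
    and adapted: "\<And>n. n \<ge> 1 \<Longrightarrow> \<xi> n \<in> borel_measurable (F n)"
      "\<And>n. n \<ge> 1 \<Longrightarrow> \<gamma> n \<in> borel_measurable (F n)"
    and uniformly_bounded:
      "\<exists>K>0. \<forall>n\<ge>1. \<forall>\<omega>\<in>space M. norm (\<xi> n \<omega>) \<le> K \<and> norm (\<gamma> n \<omega>) \<le> K"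
    and cond_mean_\<xi>:
      "\<And>n j. n \<ge> 1 \<Longrightarrow> AE \<omega> in M. real_cond_exp M (F (n - 1)) (\<lambda>\<omega>. \<xi> n \<omega> $ j) \<omega> = 0"
    and cond_drift_\<gamma>:
      "\<exists>c>0. \<forall>n\<ge>1. AE \<omega> in M. real_cond_exp M (F (n - 1)) (\<lambda>\<omega>. \<gamma> n \<omega> \<bullet> l) \<omega> \<ge> c"
    and iid_\<xi>: "indep_vars (\<lambda>_. borel) \<xi> {1..}"
      "\<And>n. n \<ge> 1 \<Longrightarrow> distr M borel (\<xi> n) = distr M borel (\<xi> 1)"
    and mean_\<xi>: "\<And>n. n \<ge> 1 \<Longrightarrow> integrable M (\<xi> n)" "\<And>n. n \<ge> 1 \<Longrightarrow> expectation (\<xi> n) = 0"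
    and finite_cov_\<xi>: "\<And>n i j. n \<ge> 1 \<Longrightarrow> integrable M (\<lambda>\<omega>. \<xi> n \<omega> $ i * \<xi> n \<omega> $ j)"
    and nondegenerate_\<xi>:
      "\<And>n l'. n \<ge> 1 \<Longrightarrow> norm l' = 1 \<Longrightarrow> prob {\<omega> \<in> space M. \<xi> n \<omega> \<bullet> l' = 0} < 1"
    and iid_\<gamma>: "indep_vars (\<lambda>_. borel) \<gamma> {1..}"
      "\<And>n. n \<ge> 1 \<Longrightarrow> distr M borel (\<gamma> n) = distr M borel (\<gamma> 1)"
    and indep_\<xi>_\<gamma>:
      "indep_var (PiM {1..} (\<lambda>_. borel)) (\<lambda>\<omega>. \<lambda>i\<in>{1..}. \<xi> i \<omega>)
                 (PiM {1..} (\<lambda>_. borel)) (\<lambda>\<omega>. \<lambda>i\<in>{1..}. \<gamma> i \<omega>)"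
    and iid_uniform: "indep_vars (\<lambda>_. borel) U {1..}"
      "\<And>n. n \<ge> 1 \<Longrightarrow> distr M borel (U n) = uniform_measure lborel {0..1}"
    and indep_U:
      "indep_set
         {(\<lambda>\<omega>. \<lambda>i\<in>{1..}. U i \<omega>) -` A \<inter> space M | A. A \<in> sets (PiM {1..} (\<lambda>_. borel))}
         {(\<lambda>\<omega>. ((\<lambda>i\<in>{1..}. \<xi> i \<omega>), (\<lambda>i\<in>{1..}. \<gamma> i \<omega>))) -` A \<inter> space M | A.
            A \<in> sets (PiM {1..} (\<lambda>_. borel) \<Otimes>\<^sub>M PiM {1..} (\<lambda>_. borel))}"
    and process: "\<And>n \<omega>. \<omega> \<in> space M \<Longrightarrow>
      X n \<omega> = (\<Sum>i=1..n.
          indicator (revisit X (i - 1)) \<omega> *\<^sub>R \<xi> i \<omega>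
        + indicator (- revisit X (i - 1) \<inter> {\<omega>. U i \<omega> > p i}) \<omega> *\<^sub>R \<xi> i \<omega>
        + indicator (- revisit X (i - 1) \<inter> {\<omega>. U i \<omega> \<le> p i}) \<omega> *\<^sub>R \<gamma> i \<omega>)"

definition escape_prob :: "'a measure \<Rightarrow> (nat \<Rightarrow> 'a \<Rightarrow> real^'d) \<Rightarrow> real" where
  "escape_prob M \<xi> = measure M {\<omega> \<in> space M. \<forall>n\<ge>1. (\<Sum>i=1..n. \<xi> i \<omega>) \<noteq> 0}"

definition rescaled_path :: "(nat \<Rightarrow> 'a \<Rightarrow> real^'d) \<Rightarrow> nat \<Rightarrow> 'a \<Rightarrow> (real^'d) cpath" where
  "rescaled_path X n \<omega> = cpath_of (\<lambda>t.
     let m = nat \<lfloor>real n * t\<rfloor> in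
       X m \<omega> /\<^sub>R sqrt (real n)
       + (real n * t - real m) *\<^sub>R ((X (Suc m) \<omega> - X m \<omega>) /\<^sub>R sqrt (real n)))"

lemma continuous_on_interpolation:
  fixes a :: "nat \<Rightarrow> 'a::real_normed_vector"
  shows "continuous_on {0..}
    (\<lambda>s. let m = nat \<lfloor>s\<rfloor> in a m + (s - real m) *\<^sub>R (a (Suc m) - a m))" (is "continuous_on _ ?g")
proof -
  define h where "h N s = a 0 + (\<Sum>i<N. max 0 (min 1 (s - real i)) *\<^sub>R (a (Suc i) - a i))"
    for N :: nat and s
  have g_eq: "?g s = h N s" if "0 \<le> s" "s < real N" for s N
  proof -
    define m where "m = nat \<lfloor>s\<rfloor>"
    have m: "real m \<le> s" "s < real m + 1" "m < N"
      using that unfolding m_def by linarith+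
    let ?c = "\<lambda>i. max 0 (min 1 (s - real i)) *\<^sub>R (a (Suc i) - a i)"
    have "{..<N} = insert m ({..<m} \<union> {Suc m..<N})" using m by auto
    then have "sum ?c {..<N} = ?c m + sum ?c ({..<m} \<union> {Suc m..<N})" by simp
    also have "sum ?c ({..<m} \<union> {Suc m..<N}) = sum ?c {..<m} + sum ?c {Suc m..<N}"
      by (rule sum.union_disjoint) auto
    also have "sum ?c {Suc m..<N} = 0"
      using m by (intro sum.neutral) auto
    also have "sum ?c {..<m} = (\<Sum>i<m. a (Suc i) - a i)"
      using m by (intro sum.cong) auto
    also have "\<dots> = a m - a 0" by (rule sum_lessThan_telescope)
    also have "?c m = (s - real m) *\<^sub>R (a (Suc m) - a m)" using m by auto
    finally show ?thesis by (simp add: h_def m_def[symmetric])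
  qed
  have "continuous (at s within {0..}) ?g" if "s \<ge> 0" for s
  proof -
    obtain N where N: "s < real N" using reals_Archimedean2 by blast
    have "continuous_on UNIV (h N)" unfolding h_def by (intro continuous_intros)
    then have "isCont (h N) s" by (simp add: continuous_on_eq_continuous_at)
    then have "continuous (at s within {0..}) (h N)" by (rule continuous_at_imp_continuous_at_within)
    then show ?thesis
      by (rule continuous_transform_within[where \<delta> = "real N - s"])
        (use N that in \<open>auto simp: dist_real_def g_eq[symmetric]\<close>)
  qed
  then show ?thesis by (simp add: continuous_on_eq_continuous_within)
qed

lemma path_at_rescaled_path:
  assumes "t \<ge> 0"
  shows "path_at (rescaled_path X n \<omega>) t =
    (let m = nat \<lfloor>real n * t\<rfloor> in
       X m \<omega> /\<^sub>R sqrt (real n)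
       + (real n * t - real m) *\<^sub>R ((X (Suc m) \<omega> - X m \<omega>) /\<^sub>R sqrt (real n)))"
  unfolding rescaled_path_def
proof (rule path_at_cpath_of[OF _ assms])
  have "continuous_on {0..} (\<lambda>t. real n * t)" by (intro continuous_intros)
  moreover have "(\<lambda>t. real n * t) ` {0..} \<subseteq> {0..}" by auto
  ultimately have "continuous_on {0..} (\<lambda>t. let m = nat \<lfloor>real n * t\<rfloor> in
       X m \<omega> /\<^sub>R sqrt (real n)
       + (real n * t - real m) *\<^sub>R (X (Suc m) \<omega> /\<^sub>R sqrt (real n) - X m \<omega> /\<^sub>R sqrt (real n)))"
    by (rule continuous_on_compose2[OF
          continuous_on_interpolation[of "\<lambda>k. X k \<omega> /\<^sub>R sqrt (real n)"]])
  then   show "continuous_on {0..} (\<lambda>t. let m = nat \<lfloor>real n * t\<rfloor> in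
       X m \<omega> /\<^sub>R sqrt (real n)
       + (real n * t - real m) *\<^sub>R ((X (Suc m) \<omega> - X m \<omega>) /\<^sub>R sqrt (real n)))"
    by (simp only: scaleR_diff_right)
qed

end

theory Submission
  imports Defs "HOL-Probability.Projective_Limit"
begin

text \<open>
  The walk \<open>X\<close> is compared with the random walk \<open>Y\<close> made of the steps \<open>\<xi>\<close> alone. They differ by the
  excitations, and in the direction \<open>l\<close> the difference up to time \<open>m\<close> is a martingale of variance
  \<open>O(sqrt m)\<close>, which disappears after division by \<open>sqrt n\<close>, plus \<open>E[\<gamma> \<bullet> l]\<close> times the sum of the excitation
  probabilities over the fresh sites. Excitations are so rare that in a time window of fixed length \<open>q\<close>
  before time \<open>i\<close> the walk usually moves like \<open>Y\<close>. Then a site that is fresh for \<open>X\<close> is new for the last \<open>q\<close>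
  steps of \<open>Y\<close>, which by time reversal has the probability that \<open>Y\<close> does not return within \<open>q\<close> steps
  (\<open>fresh_le\<close>, \<open>prob_new_site\<close>). These events are independent at distance \<open>q\<close>, so the weighted sum
  concentrates (\<open>new_fluct_moment\<close>), and letting \<open>q\<close> grow gives, at each fixed time \<open>t\<close>, a drift of at most
  \<open>2 * C * \<pi>_d * E[\<gamma> \<bullet> l] * sqrt t\<close> up to an error that vanishes in mean (\<open>excess_tendsto\<close>).

  The number of excitations in a window of length \<open>k\<close> is of order \<open>sqrt k\<close>, therefore the increments of \<open>X\<close>
  satisfy the same fourth moment bound as those of \<open>Y\<close> (\<open>X_moment4\<close>). A chaining argument over dyadic levels
  turns it into a bound, uniform in \<open>n\<close>, for the distance of the rescaled path from its dyadic
  discretisation (\<open>expectation_dist_dyadic_interp\<close>). This yields tightness, since discretisations with bounded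
  nodes form compact sets (\<open>tight_from_moment4\<close>), and it yields the limit of the Gaussian discretisations,
  that is, the existence of Brownian motion (\<open>real_bm_exists\<close>). It also reduces the comparison of limit laws
  to finitely many times, where the one-dimensional central limit theorem for independent blocks suffices
  (\<open>grid_central_limit\<close>, \<open>Lipschitz_comparison\<close>).

  Weak convergence provides the comparison for increasing Lipschitz functionals only. It extends to all
  bounded increasing measurable functionals because closed increasing sets have increasing Lipschitz
  approximations of their indicators and exhaust increasing Borel sets by inner regularity
  (\<open>domination_from_Lipschitz\<close>).
\<close>

section \<open>Convergence of paths and piecewise linear paths\<close>

text \<open>Up to a small geometric tail the metric only sees a bounded time interval.\<close>

lemma dist_cpath_le:
  assumes c: "0 \<le> c"
    and le: "\<And>t. 0 \<le> t \<Longrightarrow> t \<le> real k \<Longrightarrow> norm (path_at f t - path_at g t) \<le> c"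
  shows "dist f g \<le> c + (1/2)^k"
proof -
  have geo: "(\<lambda>i. (1/2)^(Suc i) * c) sums c"
    using sums_mult2[OF power_half_series, of c] by simp
  have tail: "(\<lambda>i. if k \<le> i then (1/2)^(Suc i) else 0 :: real) sums ((1/2)^k)"
  proof -
    have "(\<lambda>i. (1/2)^k * (1/2)^(Suc i) :: real) sums ((1/2)^k * 1)"
      by (rule sums_mult[OF power_half_series])
    then have "(\<lambda>i. (if k \<le> i + k then (1/2)^(Suc (i + k)) else 0) :: real) sums ((1/2)^k)"
      by (simp add: power_add mult_ac)
    then show ?thesis
      by (subst (asm) sums_iff_shift) (simp add: sum.neutral)
  qed
  have bound: "(1/2)^(Suc i) * trunc_sup (Suc i) f g
      \<le> (1/2)^(Suc i) * c + (if k \<le> i then (1/2)^(Suc i) else 0)" for i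
  proof (cases "k \<le> i")
    case True
    have "(1/2)^(Suc i) * trunc_sup (Suc i) f g \<le> (1/2)^(Suc i)"
      by (intro mult_left_le trunc_sup_le_1) auto
    moreover have "0 \<le> (1/2)^(Suc i) * c" using c by simp
    ultimately show ?thesis using True by (simp only: if_True)
  next
    case False
    have "trunc_sup (Suc i) f g \<le> c"
      by (rule trunc_sup_least, rule order_trans[OF min.cobounded1 le]) (use False in auto)
    then show ?thesis using False by simp
  qed
  have "dist f g \<le> (\<Sum>i. (1/2)^(Suc i) * c + (if k \<le> i then (1/2)^(Suc i) else 0))"
    unfolding dist_cpath_def
    by (rule suminf_le[OF bound summable_trunc_sup]) (use sums_add[OF geo tail] sums_summable in blast)
  also have "\<dots> = c + (1/2)^k" using sums_add[OF geo tail] by (simp add: sums_iff)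
  finally show ?thesis .
qed

lemma dist_cpath_le_uniform:
  assumes le: "\<And>t. 0 \<le> t \<Longrightarrow> norm (path_at f t - path_at g t) \<le> c"
  shows "dist f g \<le> c"
proof (rule field_le_epsilon)
  fix e :: real assume "e > 0"
  then obtain k where k: "(1/2)^k < e" using real_arch_pow_inv[of e "1/2"] by auto
  have "0 \<le> c" using order_trans[OF norm_ge_zero le[of 0]] by simp
  then have "dist f g \<le> c + (1/2)^k" by (rule dist_cpath_le) (rule le)
  then show "dist f g \<le> c + e" using k by simp
qed

lemma dist_cpath_le_1: "dist f (g :: 'a::real_normed_vector cpath) \<le> 1"
proof -
  have "dist f g \<le> (\<Sum>k. (1/2)^(Suc k))"
    unfolding dist_cpath_def
    by (rule suminf_le[OF _ summable_trunc_sup])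
       (use power_half_series in \<open>auto simp: sums_iff trunc_sup_le_1\<close>)
  then show ?thesis using power_half_series by (simp add: sums_iff)
qed

lemma trunc_sup_le_dist: "trunc_sup (Suc k) f g \<le> 2^(Suc k) * dist f g"
proof -
  have "(1/2)^(Suc k) * trunc_sup (Suc k) f g \<le> dist f g"
    unfolding dist_cpath_def
    using sum_le_suminf[OF summable_trunc_sup, of "{k}"] by (simp add: trunc_sup_nonneg)
  then show ?thesis by (simp add: field_simps power_one_over)
qed

lemma norm_path_diff_le_dist:
  assumes "0 \<le> t" "t \<le> real (Suc k)"
  shows "min (norm (path_at f t - path_at g t)) 1 \<le> 2^(Suc k) * dist f g"
  using trunc_sup_upper[OF assms] trunc_sup_le_dist by (rule order_trans)

lemma tendsto_cpathI:
  assumes "\<And>k e. e > 0 \<Longrightarrow>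
    \<forall>\<^sub>F x in net. \<forall>t. 0 \<le> t \<longrightarrow> t \<le> real k \<longrightarrow> norm (path_at (F x) t - path_at f t) \<le> e"
  shows "(F \<longlongrightarrow> f) net"
proof (rule tendstoI)
  fix e :: real assume "e > 0"
  then obtain k where k: "(1/2)^k < e/2" using real_arch_pow_inv[of "e/2" "1/2"] by auto
  have "\<forall>\<^sub>F x in net. \<forall>t. 0 \<le> t \<longrightarrow> t \<le> real k \<longrightarrow> norm (path_at (F x) t - path_at f t) \<le> e/2"
    by (rule assms) (use \<open>e > 0\<close> in simp)
  then show "\<forall>\<^sub>F x in net. dist (F x) f < e"
  proof eventually_elim
    case (elim x)
    then have "dist (F x) f \<le> e/2 + (1/2)^k"
      by (intro dist_cpath_le) (use \<open>e > 0\<close> in auto)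
    then show ?case using k by linarith
  qed
qed

lemma tendsto_path_at:
  assumes "(F \<longlongrightarrow> f) net" "0 \<le> t"
  shows "((\<lambda>x. path_at (F x) t) \<longlongrightarrow> path_at f t) net"
proof (rule tendstoI)
  fix e :: real assume "e > 0"
  obtain k where k: "t \<le> real k" using real_arch_simple by blast
  have "\<forall>\<^sub>F x in net. dist (F x) f < min e 1 / 2^(Suc k)"
    by (rule tendstoD[OF assms(1)]) (use \<open>e > 0\<close> in simp)
  then show "\<forall>\<^sub>F x in net. dist (path_at (F x) t) (path_at f t) < e"
  proof eventually_elim
    case (elim x)
    then have "2^(Suc k) * dist (F x) f < min e 1" by (simp add: field_simps)
    with norm_path_diff_le_dist[of t k "F x" f] k assms(2)
    have "min (norm (path_at (F x) t - path_at f t)) 1 < min e 1" by simp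
    then show ?case by (auto simp: dist_norm min_def split: if_splits)
  qed
qed

lemma continuous_on_path_at_cpath:
  "0 \<le> t \<Longrightarrow> continuous_on A (\<lambda>f :: 'a::real_normed_vector cpath. path_at f t)"
  by (auto simp: continuous_on_def intro!: tendsto_path_at)

lemma measurable_path_at [measurable (raw)]:
  assumes "f \<in> borel_measurable M" "0 \<le> t"
  shows "(\<lambda>x. path_at (f x :: 'a::real_normed_vector cpath) t) \<in> borel_measurable M"
  using borel_measurable_continuous_onI[OF continuous_on_path_at_cpath[OF assms(2)]] assms(1)
  by (rule measurable_compose_rev)

text \<open>The interpolation of the nodes \<open>a k\<close> at the times \<open>k / h\<close>. Both the rescaled walk (\<open>h = n\<close>) and the
  discretisations of a path (\<open>h = 2^j\<close>) have this form.\<close>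

definition polyval :: "real \<Rightarrow> (nat \<Rightarrow> 'a::real_normed_vector) \<Rightarrow> real \<Rightarrow> 'a" where
  "polyval h a t = (let m = nat \<lfloor>h * t\<rfloor> in a m + (h * t - real m) *\<^sub>R (a (Suc m) - a m))"

definition polygon :: "real \<Rightarrow> (nat \<Rightarrow> 'a::real_normed_vector) \<Rightarrow> 'a cpath" where
  "polygon h a = cpath_of (polyval h a)"

lemma continuous_on_polyval:
  assumes "0 \<le> h"
  shows "continuous_on {0..} (polyval h a)"
proof -
  have "continuous_on {0..} (\<lambda>t. h * t)" by (intro continuous_intros)
  moreover have "(\<lambda>t. h * t) ` {0..} \<subseteq> {0..}" using assms by auto
  ultimately show ?thesis unfolding polyval_def
    by (rule continuous_on_compose2[OF continuous_on_interpolation[of a]])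
qed

lemma path_at_polygon: "0 \<le> h \<Longrightarrow> 0 \<le> t \<Longrightarrow> path_at (polygon h a) t = polyval h a t"
  unfolding polygon_def by (rule path_at_cpath_of[OF continuous_on_polyval])

lemma polyval_grid: "0 < h \<Longrightarrow> h * t = real k \<Longrightarrow> polyval h a t = a k"
  by (simp add: polyval_def)

text \<open>All estimates on interpolations rest on the convex combination of the two neighbouring nodes.\<close>

lemma polyval_weight:
  assumes "0 \<le> h" "0 \<le> t"
  obtains \<theta> where "0 \<le> \<theta>" "\<theta> < 1"
    "\<And>a :: nat \<Rightarrow> 'a::real_normed_vector. polyval h a t
      = (1 - \<theta>) *\<^sub>R a (nat \<lfloor>h * t\<rfloor>) + \<theta> *\<^sub>R a (Suc (nat \<lfloor>h * t\<rfloor>))"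
proof
  let ?\<theta> = "h * t - real (nat \<lfloor>h * t\<rfloor>)"
  have *: "real (nat \<lfloor>h * t\<rfloor>) = of_int \<lfloor>h * t\<rfloor>"
    using assms by (simp add: of_nat_nat)
  show "0 \<le> ?\<theta>" "?\<theta> < 1" unfolding * by linarith+
  show "polyval h a t = (1 - ?\<theta>) *\<^sub>R a (nat \<lfloor>h * t\<rfloor>) + ?\<theta> *\<^sub>R a (Suc (nat \<lfloor>h * t\<rfloor>))"
    for a :: "nat \<Rightarrow> 'a"
    unfolding polyval_def Let_def by (simp add: algebra_simps)
qed

lemma norm_polyval_diff_le:
  fixes a b :: "nat \<Rightarrow> 'a::real_normed_vector"
  assumes "0 \<le> h" "0 \<le> t"
    and le: "\<And>k. k = nat \<lfloor>h * t\<rfloor> \<or> k = Suc (nat \<lfloor>h * t\<rfloor>) \<Longrightarrow> norm (a k - b k) \<le> e"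
  shows "norm (polyval h a t - polyval h b t) \<le> e"
proof -
  obtain \<theta> where \<theta>: "0 \<le> \<theta>" "\<theta> < 1" and pv: "\<And>a :: nat \<Rightarrow> 'a. polyval h a t
      = (1 - \<theta>) *\<^sub>R a (nat \<lfloor>h * t\<rfloor>) + \<theta> *\<^sub>R a (Suc (nat \<lfloor>h * t\<rfloor>))"
    using polyval_weight[OF assms(1,2), where ?'a = 'a] by blast
  let ?m = "nat \<lfloor>h * t\<rfloor>"
  have "polyval h a t - polyval h b t
      = (1 - \<theta>) *\<^sub>R (a ?m - b ?m) + \<theta> *\<^sub>R (a (Suc ?m) - b (Suc ?m))"
    by (simp add: pv algebra_simps)
  also have "norm \<dots> \<le> (1 - \<theta>) * norm (a ?m - b ?m) + \<theta> * norm (a (Suc ?m) - b (Suc ?m))"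
    using \<theta> by (intro norm_triangle_le) simp
  also have "\<dots> \<le> (1 - \<theta>) * e + \<theta> * e"
    using \<theta> le by (intro add_mono mult_left_mono) auto
  finally show ?thesis by (simp add: algebra_simps)
qed

lemma norm_polyval_node_le:
  fixes a :: "nat \<Rightarrow> 'a::real_normed_vector"
  assumes "0 \<le> h" "0 \<le> t"
  shows "norm (polyval h a t - a (nat \<lfloor>h * t\<rfloor>)) \<le> norm (a (Suc (nat \<lfloor>h * t\<rfloor>)) - a (nat \<lfloor>h * t\<rfloor>))"
proof -
  obtain \<theta> where \<theta>: "0 \<le> \<theta>" "\<theta> < 1" and pv: "\<And>a :: nat \<Rightarrow> 'a. polyval h a t
      = (1 - \<theta>) *\<^sub>R a (nat \<lfloor>h * t\<rfloor>) + \<theta> *\<^sub>R a (Suc (nat \<lfloor>h * t\<rfloor>))"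
    using polyval_weight[OF assms(1,2), where ?'a = 'a] by blast
  have "polyval h a t - a (nat \<lfloor>h * t\<rfloor>) = \<theta> *\<^sub>R (a (Suc (nat \<lfloor>h * t\<rfloor>)) - a (nat \<lfloor>h * t\<rfloor>))"
    by (simp add: pv algebra_simps)
  then show ?thesis using \<theta> by (simp add: mult_left_le_one_le)
qed

lemma polyval_mono:
  fixes a b :: "nat \<Rightarrow> real"
  assumes "0 \<le> h" "0 \<le> t" "\<And>k. a k \<le> b k"
  shows "polyval h a t \<le> polyval h b t"
proof -
  obtain \<theta> where \<theta>: "0 \<le> \<theta>" "\<theta> < 1" and pv: "\<And>a :: nat \<Rightarrow> real. polyval h a t
      = (1 - \<theta>) *\<^sub>R a (nat \<lfloor>h * t\<rfloor>) + \<theta> *\<^sub>R a (Suc (nat \<lfloor>h * t\<rfloor>))"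
    using polyval_weight[OF assms(1,2), where ?'a = real] by blast
  show ?thesis unfolding pv using \<theta> assms(3) by (auto intro!: add_mono mult_left_mono)
qed

lemma floor_index_le: "0 \<le> h \<Longrightarrow> t \<le> real k \<Longrightarrow> nat \<lfloor>h * t\<rfloor> \<le> nat \<lfloor>h * real k\<rfloor>"
  by (intro nat_mono floor_mono mult_left_mono)

text \<open>On a bounded time interval a polygon depends on finitely many nodes, hence convergence of every
  single node is enough.\<close>

lemma tendsto_polygon:
  fixes a :: "'b \<Rightarrow> nat \<Rightarrow> 'a::real_normed_vector"
  assumes h: "0 \<le> h" and lim: "\<And>k. ((\<lambda>x. a x k) \<longlongrightarrow> b k) net"
  shows "((\<lambda>x. polygon h (a x)) \<longlongrightarrow> polygon h b) net"
proof (rule tendsto_cpathI)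
  fix k and e :: real assume "e > 0"
  define N where "N = Suc (nat \<lfloor>h * real k\<rfloor>)"
  have "\<forall>\<^sub>F x in net. \<forall>i\<in>{..N}. dist (a x i) (b i) < e"
    by (subst eventually_ball_finite_distrib) (use tendstoD[OF lim \<open>e > 0\<close>] in auto)
  then show "\<forall>\<^sub>F x in net. \<forall>t. 0 \<le> t \<longrightarrow> t \<le> real k
      \<longrightarrow> norm (path_at (polygon h (a x)) t - path_at (polygon h b) t) \<le> e"
  proof eventually_elim
    case (elim x)
    show ?case
    proof (intro allI impI)
      fix t :: real assume t: "0 \<le> t" "t \<le> real k"
      show "norm (path_at (polygon h (a x)) t - path_at (polygon h b) t) \<le> e"
        unfolding path_at_polygon[OF h t(1)]
        by (rule norm_polyval_diff_le[OF h t(1)])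
          (use elim floor_index_le[OF h t(2)] in \<open>auto simp: N_def dist_norm intro!: less_imp_le\<close>)
    qed
  qed
qed

lemma continuous_on_polygon:
  "0 \<le> h \<Longrightarrow> continuous_on A (polygon h :: (nat \<Rightarrow> 'a::real_normed_vector) \<Rightarrow> 'a cpath)"
  unfolding continuous_on_def
  by (intro ballI tendsto_polygon)
     (auto intro: continuous_on_product_coordinates[unfolded continuous_on_def, rule_format, THEN tendsto_within_subset])

text \<open>Discretisation reduces statements on paths to statements on sequences of real vectors: it depends
  on countably many values of the path and recovers the path in the limit.\<close>

definition dyadic_interp :: "nat \<Rightarrow> 'a::real_normed_vector cpath \<Rightarrow> 'a cpath" where
  "dyadic_interp j f = polygon (2^j) (\<lambda>k. path_at f (real k / 2^j))"

lemma dyadic_interp_tendsto: "(\<lambda>j. dyadic_interp j f) \<longlonglongrightarrow> f"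
proof (rule tendsto_cpathI)
  fix k and e :: real assume "e > 0"
  have "uniformly_continuous_on {0..real (Suc k)} (path_at f)"
    by (intro compact_uniformly_continuous continuous_on_subset[OF continuous_on_path_at]) auto
  then obtain d where d: "d > 0"
    "\<And>s t. s \<in> {0..real (Suc k)} \<Longrightarrow> t \<in> {0..real (Suc k)} \<Longrightarrow> dist t s < d
      \<Longrightarrow> dist (path_at f t) (path_at f s) < e"
    unfolding uniformly_continuous_on_def using \<open>e > 0\<close> by metis
  obtain J where J: "(1/2)^J < d" using real_arch_pow_inv[of d "1/2"] d(1) by auto
  show "\<forall>\<^sub>F j in sequentially. \<forall>t. 0 \<le> t \<longrightarrow> t \<le> real k
      \<longrightarrow> norm (path_at (dyadic_interp j f) t - path_at f t) \<le> e"
  proof (rule eventually_sequentiallyI[of J], intro allI impI)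
    fix j t assume j: "J \<le> j" and t: "0 \<le> t" "t \<le> real k"
    have jd: "(1/2::real)^j < d" "(1/2::real)^j \<le> 1"
      using order_le_less_trans[OF power_decreasing[OF j, of "1/2::real"] J]
      by (auto simp: power_le_one)
    have inv: "1 / 2^j = (1/2::real)^j" by (simp add: power_one_over)
    let ?m = "nat \<lfloor>2^j * t\<rfloor>"
    have m: "real ?m \<le> 2^j * t" "2^j * t < real ?m + 1" using t by (auto simp: of_nat_nat)
    have near: "0 \<le> real i / 2^j" "real i / 2^j \<le> real (Suc k)" "\<bar>real i / 2^j - t\<bar> < d"
      if "i = ?m \<or> i = Suc ?m" for i
    proof -
      have "real i = real ?m \<or> real i = real ?m + 1" using that by (elim disjE) simp_all
      then have "real i \<le> 2^j * t + 1" "2^j * t - 1 \<le> real i" using m by linarith+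
      then have "real i / 2^j \<le> t + 1/2^j" "t - 1/2^j \<le> real i / 2^j"
        using divide_right_mono[of "real i" "2^j * t + 1" "2^j"]
          divide_right_mono[of "2^j * t - 1" "real i" "2^j"]
        by (simp_all add: add_divide_distrib diff_divide_distrib)
      then show "real i / 2^j \<le> real (Suc k)" "\<bar>real i / 2^j - t\<bar> < d"
        using jd t unfolding inv by auto
    qed simp
    have "norm (polyval (2^j) (\<lambda>k. path_at f (real k / 2^j)) t - polyval (2^j) (\<lambda>_. path_at f t) t) \<le> e"
    proof (rule norm_polyval_diff_le)
      fix i assume i: "i = ?m \<or> i = Suc ?m"
      have "dist (path_at f (real i / 2^j)) (path_at f t) < e"
        by (rule d(2)) (use near[OF i] t in \<open>auto simp: dist_real_def\<close>)
      then show "norm (path_at f (real i / 2^j) - path_at f t) \<le> e" by (simp add: dist_norm)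
    qed (use t in auto)
    moreover have "polyval (2^j) (\<lambda>_. path_at f t) t = path_at f t" by (simp add: polyval_def)
    ultimately show "norm (path_at (dyadic_interp j f) t - path_at f t) \<le> e"
      unfolding dyadic_interp_def path_at_polygon[OF zero_le_power[OF zero_le_numeral] t(1)]
      by simp
  qed
qed

section \<open>The path space is Polish\<close>

instance cpath :: (banach) complete_space
proof
  fix X :: "nat \<Rightarrow> 'a cpath" assume X: "Cauchy X"
  have unif: "\<exists>N. \<forall>m\<ge>N. \<forall>n\<ge>N. \<forall>t. 0 \<le> t \<longrightarrow> t \<le> real k
      \<longrightarrow> norm (path_at (X m) t - path_at (X n) t) < e" if "e > 0" for k e
  proof -
    obtain N where N: "\<And>m n. m \<ge> N \<Longrightarrow> n \<ge> N \<Longrightarrow> dist (X m) (X n) < min e 1 / 2^(Suc k)"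
      using metric_CauchyD[OF X, of "min e 1 / 2^(Suc k)"] \<open>e > 0\<close> by auto
    have "norm (path_at (X m) t - path_at (X n) t) < e"
      if "m \<ge> N" "n \<ge> N" "0 \<le> t" "t \<le> real k" for m n t
    proof -
      have "2^(Suc k) * dist (X m) (X n) < min e 1"
        using N[OF that(1,2)] by (simp add: field_simps)
      with norm_path_diff_le_dist[of t k "X m" "X n"] that(3,4)
      have "min (norm (path_at (X m) t - path_at (X n) t)) 1 < min e 1" by simp
      then show ?thesis by (auto simp: min_def split: if_splits)
    qed
    then show ?thesis by blast
  qed
  define g where "g t = lim (\<lambda>n. path_at (X n) t)" for t
  have lim: "(\<lambda>n. path_at (X n) t) \<longlonglongrightarrow> g t" if "0 \<le> t" for t
  proof -
    obtain k where k: "t \<le> real k" using real_arch_simple by blast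
    have "Cauchy (\<lambda>n. path_at (X n) t)"
      unfolding Cauchy_def dist_norm using unif[of _ k] that k by meson
    then show ?thesis unfolding g_def by (simp add: Cauchy_convergent convergent_LIMSEQ_iff[symmetric])
  qed
  have near: "\<exists>N. \<forall>n\<ge>N. \<forall>t. 0 \<le> t \<longrightarrow> t \<le> real k \<longrightarrow> norm (path_at (X n) t - g t) \<le> e"
    if e: "e > 0" for k e
  proof -
    obtain N where N: "\<forall>m\<ge>N. \<forall>n\<ge>N. \<forall>t. 0 \<le> t \<longrightarrow> t \<le> real k
      \<longrightarrow> norm (path_at (X m) t - path_at (X n) t) < e" using unif[OF e, of k] by blast
    have "norm (path_at (X n) t - g t) \<le> e" if "n \<ge> N" "0 \<le> t" "t \<le> real k" for n t
    proof (rule tendsto_upperbound)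
      show "(\<lambda>m. norm (path_at (X n) t - path_at (X m) t)) \<longlonglongrightarrow> norm (path_at (X n) t - g t)"
        by (intro tendsto_intros lim that)
      show "\<forall>\<^sub>F m in sequentially. norm (path_at (X n) t - path_at (X m) t) \<le> e"
        using N that by (intro eventually_sequentiallyI[of N]) (auto intro: less_imp_le)
    qed simp
    then show ?thesis by blast
  qed
  have cont: "continuous_on {0..} g"
  proof -
    have cont_k: "continuous_on {0..real k} g" for k
    proof (rule uniform_limit_theorem)
      show "\<forall>\<^sub>F n in sequentially. continuous_on {0..real k} (path_at (X n))"
        by (intro always_eventually allI continuous_on_subset[OF continuous_on_path_at]) auto
      show "uniform_limit {0..real k} (\<lambda>n. path_at (X n)) g sequentially"
        unfolding uniform_limit_iff
      proof (intro allI impI)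
        fix e :: real assume "e > 0"
        then obtain N where "\<forall>n\<ge>N. \<forall>t. 0 \<le> t \<longrightarrow> t \<le> real k \<longrightarrow> norm (path_at (X n) t - g t) \<le> e/2"
          using near[of "e/2" k] by auto
        then show "\<forall>\<^sub>F n in sequentially. \<forall>t\<in>{0..real k}. dist (path_at (X n) t) (g t) < e"
          using \<open>e > 0\<close> by (intro eventually_sequentiallyI[of N]) (force simp: dist_norm)
      qed
    qed simp
    show ?thesis unfolding continuous_on_def
    proof
      fix t :: real assume t: "t \<in> {0..}"
      obtain k where k: "t < real k" using reals_Archimedean2 by blast
      have "(g \<longlongrightarrow> g t) (at t within {0..real k})"
        using cont_k[of k] t k by (auto simp: continuous_on_def)
      moreover have "at t within {0..real k} = at t within {0..}"
        by (rule at_within_nhd[of _ "{..<real k}"]) (use t k in auto)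
      ultimately show "(g \<longlongrightarrow> g t) (at t within {0..})" by simp
    qed
  qed
  have "X \<longlonglongrightarrow> cpath_of g"
  proof (rule tendsto_cpathI)
    fix k and e :: real assume "e > 0"
    then obtain N where N: "\<forall>n\<ge>N. \<forall>t. 0 \<le> t \<longrightarrow> t \<le> real k \<longrightarrow> norm (path_at (X n) t - g t) \<le> e"
      using near[of e k] by blast
    then show "\<forall>\<^sub>F n in sequentially. \<forall>t. 0 \<le> t \<longrightarrow> t \<le> real k
        \<longrightarrow> norm (path_at (X n) t - path_at (cpath_of g) t) \<le> e"
      by (intro eventually_sequentiallyI[of N]) (simp add: path_at_cpath_of[OF cont])
  qed
  then show "convergent X" by (auto simp: convergent_def)
qed

text \<open>The polygons through a countable dense set of node sequences are dense among the dyadic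
  discretisations, and hence among all paths.\<close>

instance cpath :: ("{real_normed_vector, second_countable_topology}") second_countable_topology
proof
  obtain D :: "(nat \<Rightarrow> 'a) set" where D: "countable D"
    "\<And>S. open S \<Longrightarrow> S \<noteq> {} \<Longrightarrow> \<exists>d\<in>D. d \<in> S"
    using countable_dense_setE by blast
  define E where "E = (\<Union>j::nat. polygon (2^j) ` D)"
  have dense: "\<exists>d\<in>E. dist d f < e" if e: "e > 0" for f :: "'a cpath" and e
  proof -
    obtain j where j: "dist (dyadic_interp j f) f < e/2"
      using tendstoD[OF dyadic_interp_tendsto[of f], of "e/2"] e
      by (auto simp: eventually_sequentially)
    let ?S = "polygon (2^j) -` ball (dyadic_interp j f) (e/2)"
    have "open ?S"
      by (rule open_vimage[OF open_ball continuous_on_polygon]) simp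
    moreover have "(\<lambda>k. path_at f (real k / 2^j)) \<in> ?S"
      using e by (simp add: dyadic_interp_def)
    ultimately obtain d where d: "d \<in> D" "d \<in> ?S" using D(2) by blast
    then have "dist (polygon (2^j) d) f < e"
      using j dist_triangle[of "polygon (2^j) d" f "dyadic_interp j f"]
      by (auto simp: dist_commute)
    then show ?thesis using d(1) unfolding E_def by blast
  qed
  define B where "B = (\<lambda>(d, q). ball d q) ` (E \<times> (\<rat> :: real set))"
  have "countable B"
    unfolding B_def E_def using D(1) countable_rat by (intro countable_image countable_SIGMA) auto
  moreover have "topological_basis B"
  proof (rule topological_basisI)
    show "open S" if "S \<in> B" for S using that by (auto simp: B_def)
    fix O' :: "'a cpath set" and f assume O': "open O'" "f \<in> O'"
    then obtain e where e: "e > 0" "ball f e \<subseteq> O'" by (meson openE)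
    obtain d where d: "d \<in> E" "dist d f < e/2" using dense[of "e/2" f] e by auto
    obtain q where q: "q \<in> \<rat>" "dist d f < q" "q < e/2"
      using Rats_dense_in_real[OF d(2)] by blast
    have "ball d q \<subseteq> ball f e"
    proof
      fix g assume "g \<in> ball d q"
      then show "g \<in> ball f e"
        using q d dist_triangle[of f g d] by (simp add: dist_commute)
    qed
    then show "\<exists>B'\<in>B. f \<in> B' \<and> B' \<subseteq> O'"
      using d q e unfolding B_def by (intro bexI[of _ "ball d q"]) auto
  qed
  ultimately show "\<exists>B::'a cpath set set. countable B \<and> open = generate_topology B"
    using topological_basis_imp_subbasis by blast
qed

text \<open>The Borel sets of the path space are generated by the evaluations: a map whose evaluations are
  measurable is a limit of its discretisations, and a polygon is a continuous function of its sequence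
  of nodes.\<close>

lemma measurable_cpathI:
  fixes g :: "'b \<Rightarrow> 'a::{banach, second_countable_topology} cpath"
  assumes g: "\<And>t. 0 \<le> t \<Longrightarrow> (\<lambda>x. path_at (g x) t) \<in> borel_measurable M"
  shows "g \<in> borel_measurable M"
proof (rule borel_measurable_LIMSEQ_metric)
  show "(\<lambda>j. dyadic_interp j (g x)) \<longlonglongrightarrow> g x" for x by (rule dyadic_interp_tendsto)
  fix j
  have "(\<lambda>x k. path_at (g x) (real k / 2^j)) \<in> measurable M (PiM UNIV (\<lambda>_. borel))"
    by (rule measurable_PiM_single') (use g in auto)
  then have "(\<lambda>x k. path_at (g x) (real k / 2^j)) \<in> borel_measurable M"
    using measurable_cong_sets[OF refl sets_PiM_equal_borel] by blast
  then show "(\<lambda>x. dyadic_interp j (g x)) \<in> borel_measurable M"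
    unfolding dyadic_interp_def
    by (rule measurable_compose[OF _ borel_measurable_continuous_onI[OF continuous_on_polygon]]) simp
qed

lemma measurable_polygon:
  fixes a :: "'b \<Rightarrow> nat \<Rightarrow> 'a::{banach, second_countable_topology}"
  assumes "0 \<le> h" "\<And>k. (\<lambda>x. a x k) \<in> borel_measurable M"
  shows "(\<lambda>x. polygon h (a x)) \<in> borel_measurable M"
proof (rule measurable_cpathI)
  fix t :: real assume "0 \<le> t"
  then show "(\<lambda>x. path_at (polygon h (a x)) t) \<in> borel_measurable M"
    unfolding path_at_polygon[OF assms(1) \<open>0 \<le> t\<close>] polyval_def Let_def
    using assms(2) by measurable
qed

lemma measurable_dyadic_interp [measurable (raw)]:
  fixes f :: "'b \<Rightarrow> 'a::{banach, second_countable_topology} cpath"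
  assumes "f \<in> borel_measurable M"
  shows "(\<lambda>x. dyadic_interp j (f x)) \<in> borel_measurable M"
  unfolding dyadic_interp_def by (rule measurable_polygon) (use assms in auto)

text \<open>A closed set that can be approximated uniformly by compact sets is totally bounded. Together with
  the compactness of products of balls this replaces the Arzela-Ascoli theorem.\<close>

lemma compact_approx:
  fixes K :: "'a::complete_space set"
  assumes "closed K"
    and near: "\<And>e. e > 0 \<Longrightarrow> \<exists>C. compact C \<and> (\<forall>x\<in>K. \<exists>y\<in>C. dist x y \<le> e)"
  shows "compact K"
  unfolding compact_eq_totally_bounded
proof (rule conjI[OF complete_eq_closed[THEN iffD2, OF assms(1)]], intro allI impI)
  fix e :: real assume "e > 0"
  then obtain C where C: "compact C" "\<And>x. x \<in> K \<Longrightarrow> \<exists>y\<in>C. dist x y \<le> e/2"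
    using near[of "e/2"] by auto
  then obtain k where k: "finite k" "C \<subseteq> (\<Union>x\<in>k. ball x (e/2))"
    using \<open>e > 0\<close> unfolding compact_eq_totally_bounded by (meson half_gt_zero)
  have "K \<subseteq> (\<Union>x\<in>k. ball x e)"
  proof
    fix x assume "x \<in> K"
    then obtain y where y: "y \<in> C" "dist x y \<le> e/2" using C by blast
    then obtain z where "z \<in> k" "dist z y < e/2" using k by auto
    then show "x \<in> (\<Union>x\<in>k. ball x e)"
      using y dist_triangle[of z x y] by (intro UN_I[of z]) (auto simp: dist_commute)
  qed
  then show "\<exists>k. finite k \<and> K \<subseteq> (\<Union>x\<in>k. ball x e)" using k by blast
qed

lemma compact_bounded_nodes:
  "compact {a :: nat \<Rightarrow> 'a::euclidean_space. \<forall>k. norm (a k) \<le> b k}"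
proof -
  have "compactin (product_topology (\<lambda>_. euclidean) UNIV) (PiE UNIV (\<lambda>k. cball (0::'a) (b k)))"
    by (subst compactin_PiE) auto
  moreover have "PiE UNIV (\<lambda>k. cball (0::'a) (b k)) = {a. \<forall>k. norm (a k) \<le> b k}"
    by (auto simp: PiE_def)
  ultimately show ?thesis by (simp add: euclidean_product_topology)
qed

lemma dist_dyadic_interp_continuous:
  "continuous_on A (\<lambda>f :: 'a::real_normed_vector cpath. dist f (dyadic_interp j f))"
proof (intro continuous_on_dist continuous_on_id)
  show "continuous_on A (dyadic_interp j :: 'a cpath \<Rightarrow> _)"
    unfolding dyadic_interp_def continuous_on_def
    by (intro ballI tendsto_polygon tendsto_path_at tendsto_ident_at) auto
qed

text \<open>The first condition makes the set uniformly approximable by polygons, the second confines the nodes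
  of these polygons to a compact product.\<close>

lemma compact_paths:
  "compact {f :: 'a::euclidean_space cpath.
      (\<forall>j. dist f (dyadic_interp (n j) f) \<le> a j) \<and> (\<forall>j k. norm (path_at f (real k / 2^j)) \<le> b j k)}"
    (is "compact ?K") if lim: "a \<longlonglongrightarrow> 0"
proof (rule compact_approx)
  have "?K = (\<Inter>j. {f. dist f (dyadic_interp (n j) f) \<le> a j}) \<inter>
      (\<Inter>j. \<Inter>k. {f. norm (path_at f (real k / 2^j)) \<le> b j k})"
    by auto
  also have "closed \<dots>"
    by (intro closed_Int closed_INT ballI closed_Collect_le dist_dyadic_interp_continuous
      continuous_on_norm continuous_on_path_at_cpath continuous_on_const) auto
  finally show "closed ?K" .
  fix e :: real assume "e > 0"
  then obtain j where j: "a j < e"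
    using order_tendstoD(2)[OF lim] by (auto simp: eventually_sequentially)
  let ?C = "polygon (2^(n j)) ` {c :: nat \<Rightarrow> 'a. \<forall>k. norm (c k) \<le> b (n j) k}"
  have "compact ?C"
    by (rule compact_continuous_image[OF continuous_on_polygon compact_bounded_nodes]) simp
  moreover have "\<exists>y\<in>?C. dist f y \<le> e" if "f \<in> ?K" for f
    using that j less_imp_le[OF j]
    by (intro bexI[of _ "dyadic_interp (n j) f"])
       (auto simp: dyadic_interp_def dest: spec[of _ j] intro: order_trans)
  ultimately show "\<exists>C. compact C \<and> (\<forall>x\<in>?K. \<exists>y\<in>C. dist x y \<le> e)" by blast
qed

section \<open>Stochastic domination from Lipschitz functionals\<close>

definition path_le :: "real cpath \<Rightarrow> real cpath \<Rightarrow> bool" where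
  "path_le f g \<longleftrightarrow> (\<forall>t\<ge>0. path_at f t \<le> path_at g t)"

definition upward_closed :: "real cpath set \<Rightarrow> bool" where
  "upward_closed B \<longleftrightarrow> (\<forall>f\<in>B. \<forall>g. path_le f g \<longrightarrow> g \<in> B)"

text \<open>Translating a point of \<open>B\<close> by \<open>g - f\<close> keeps it in \<open>B\<close> and preserves distances, because the metric
  only sees differences.\<close>

lemma infdist_upward_closed:
  assumes B: "upward_closed B" "B \<noteq> {}" and le: "path_le f g"
  shows "infdist g B \<le> infdist f B"
proof -
  have "infdist g B \<le> dist f b" if b: "b \<in> B" for b
  proof -
    define c where "c = cpath_of (\<lambda>t. path_at b t + (path_at g t - path_at f t))"
    have c: "path_at c t = path_at b t + (path_at g t - path_at f t)" if "0 \<le> t" for t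
      unfolding c_def by (rule path_at_cpath_of)
        (auto intro!: continuous_intros continuous_on_path_at that)
    have "path_le b c" using le by (auto simp: path_le_def c)
    then have "c \<in> B" using B(1) b by (auto simp: upward_closed_def)
    moreover have "dist g c = dist f b"
      unfolding dist_cpath_def trunc_sup_def
      by (intro suminf_cong arg_cong2[of _ _ _ _ "(*)"] refl SUP_cong) (auto simp: c)
    ultimately show ?thesis using infdist_le by metis
  qed
  then show ?thesis
    unfolding infdist_notempty[OF B(2), of f] by (intro cINF_greatest[OF B(2)])
qed

text \<open>Along a convergent sequence of upper paths the lower paths have a convergent subsequence, by
  compactness of \<open>K\<close>.\<close>

lemma closed_upward_closure:
  assumes K: "compact K"
  shows "closed {g. \<exists>f\<in>K. path_le f g}"
  unfolding closed_sequential_limits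
proof (intro allI impI, elim conjE)
  fix x g assume x: "\<forall>n. x n \<in> {g. \<exists>f\<in>K. path_le f g}" and g: "x \<longlonglongrightarrow> g"
  from x obtain y where y: "\<And>n. y n \<in> K" "\<And>n. path_le (y n) (x n)" by simp metis
  obtain f r where f: "f \<in> K" "strict_mono r" "(y \<circ> r) \<longlonglongrightarrow> f"
    using K y(1) unfolding compact_def by metis
  have "path_at f t \<le> path_at g t" if "0 \<le> t" for t
  proof (rule LIMSEQ_le)
    show "(\<lambda>n. path_at ((y \<circ> r) n) t) \<longlonglongrightarrow> path_at f t"
      by (rule tendsto_path_at[OF f(3) that])
    show "(\<lambda>n. path_at ((x \<circ> r) n) t) \<longlonglongrightarrow> path_at g t"
      by (rule tendsto_path_at[OF LIMSEQ_subseq_LIMSEQ[OF g f(2)] that])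
    show "\<exists>N. \<forall>n\<ge>N. path_at ((y \<circ> r) n) t \<le> path_at ((x \<circ> r) n) t"
      using y(2) that by (auto simp: path_le_def)
  qed
  then show "g \<in> {g. \<exists>f\<in>K. path_le f g}" using f(1) by (auto simp: path_le_def)
qed

lemma upward_closed_closure: "upward_closed {g. \<exists>f\<in>K. path_le f g}"
  unfolding upward_closed_def path_le_def by (auto, meson order_trans)

lemma infdist_bump_tendsto:
  fixes B :: "'a::metric_space set"
  assumes "closed B" "B \<noteq> {}"
  shows "(\<lambda>n. max 0 (1 - real n * infdist x B)) \<longlonglongrightarrow> indicator B x"
proof (cases "x \<in> B")
  case False
  then have pos: "infdist x B > 0"
    using in_closed_iff_infdist_zero[OF assms] infdist_nonneg[of x B] by (metis order_le_less)
  then obtain N where N: "1 < real N * infdist x B" using reals_Archimedean3 by blast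
  have "max 0 (1 - real n * infdist x B) = 0" if "n \<ge> N" for n
  proof -
    have "real N * infdist x B \<le> real n * infdist x B"
      using that pos by (intro mult_right_mono) auto
    then show ?thesis using N by (intro max_absorb1) linarith
  qed
  then show ?thesis
    using False by (intro tendsto_eventually eventually_sequentiallyI[of N]) auto
qed simp

text \<open>A bounded function is the uniform limit of averages of indicators of its superlevel sets.\<close>

lemma integral_le_from_superlevels:
  fixes \<alpha> \<beta> :: "'a measure" and G :: "'a \<Rightarrow> real"
  assumes \<alpha>: "prob_space \<alpha>" and \<beta>: "prob_space \<beta>"
    and G\<alpha>: "G \<in> borel_measurable \<alpha>" and G\<beta>: "G \<in> borel_measurable \<beta>"
    and G01: "\<And>x. 0 \<le> G x" "\<And>x. G x \<le> 1"
    and le: "\<And>c. measure \<alpha> {x \<in> space \<alpha>. G x \<ge> c} \<le> measure \<beta> {x \<in> space \<beta>. G x \<ge> c}"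
  shows "integral\<^sup>L \<alpha> G \<le> integral\<^sup>L \<beta> G"
proof (rule field_le_epsilon)
  fix e :: real assume "e > 0"
  then obtain n0 where "1 / real (Suc n0) < e" by (rule nat_approx_posE)
  then obtain n :: nat where n: "n > 0" "1 / real n < e" by blast
  define S where "S x = (\<Sum>k=1..n. if G x \<ge> real k / real n then 1 / real n else 0)" for x
  have card: "S x = real (card {k\<in>{1..n}. real k \<le> real n * G x}) / real n" for x
    unfolding S_def using n(1)
    by (simp add: sum.If_cases[symmetric] sum.inter_filter[symmetric] field_simps)
  have set_eq: "{k\<in>{1..n}. real k \<le> real n * G x} = {1..nat \<lfloor>real n * G x\<rfloor>}" for x
  proof -
    have "real n * G x \<le> real n" using G01(2)[of x] by (simp add: mult_left_le)
    then show ?thesis using G01(1)[of x] by (auto simp: le_nat_floor le_nat_iff le_floor_iff)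
  qed
  have S: "S x \<le> G x" "G x \<le> S x + 1 / real n" for x
  proof -
    define r where "r = real (nat \<lfloor>real n * G x\<rfloor>)"
    have "S x = r / real n" unfolding card set_eq r_def by simp
    moreover have "r \<le> real n * G x" "real n * G x \<le> r + 1"
      using G01(1)[of x] by (auto simp: of_nat_nat r_def)
    ultimately show "S x \<le> G x" "G x \<le> S x + 1 / real n"
      using n(1) by (auto simp: pos_divide_le_eq pos_le_divide_eq mult.commute simp flip: add_divide_distrib)
  qed
  have int: "integral\<^sup>L \<mu> S = (\<Sum>k=1..n. measure \<mu> {x\<in>space \<mu>. G x \<ge> real k / real n} / real n)"
    "integrable \<mu> S" if "prob_space \<mu>" "G \<in> borel_measurable \<mu>" for \<mu>
  proof -
    interpret prob_space \<mu> by fact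
    note that(2)[measurable]
    have *: "(if G x \<ge> c then 1 / real n else 0) = indicator {x\<in>space \<mu>. G x \<ge> c} x / real n"
      if "x \<in> space \<mu>" for x c using that by (simp add: indicator_def)
    have "integrable \<mu> (\<lambda>x. if G x \<ge> c then 1 / real n else 0)" for c
      by (rule integrable_const_bound[of _ "1 / real n"]) auto
    moreover have "(\<integral>x. (if G x \<ge> c then 1 / real n else 0) \<partial>\<mu>)
        = measure \<mu> {x\<in>space \<mu>. G x \<ge> c} / real n" for c
      by (subst Bochner_Integration.integral_cong[OF refl *]) auto
    ultimately show "integral\<^sup>L \<mu> S = (\<Sum>k=1..n. measure \<mu> {x\<in>space \<mu>. G x \<ge> real k / real n} / real n)"
      "integrable \<mu> S" unfolding S_def by simp_all
  qed
  have intG: "integrable \<mu> G" if "prob_space \<mu>" "G \<in> borel_measurable \<mu>" for \<mu>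
  proof -
    interpret prob_space \<mu> by fact
    show ?thesis by (rule integrable_const_bound[of _ 1]) (use G01 that in auto)
  qed
  interpret \<alpha>: prob_space \<alpha> by fact
  interpret \<beta>: prob_space \<beta> by fact
  have "integral\<^sup>L \<alpha> G \<le> (\<integral>x. S x + 1 / real n \<partial>\<alpha>)"
    by (intro integral_mono intG int \<alpha> G\<alpha> S Bochner_Integration.integrable_add) auto
  also have "\<dots> = integral\<^sup>L \<alpha> S + 1 / real n"
    using int(2)[OF \<alpha> G\<alpha>] by (simp add: \<alpha>.prob_space)
  also have "integral\<^sup>L \<alpha> S \<le> integral\<^sup>L \<beta> S"
    unfolding int(1)[OF \<alpha> G\<alpha>] int(1)[OF \<beta> G\<beta>]
    by (intro sum_mono divide_right_mono le) auto
  also have "integral\<^sup>L \<beta> S \<le> integral\<^sup>L \<beta> G"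
    by (intro integral_mono intG int \<beta> G\<beta> S)
  finally show "integral\<^sup>L \<alpha> G \<le> integral\<^sup>L \<beta> G + e" using n(2) by simp
qed

text \<open>By inner regularity an increasing measurable set is filled up by closed increasing sets, the upward
  closures of its compact subsets, and the indicator of a closed increasing set is the limit of the
  increasing Lipschitz functionals \<open>max 0 (1 - n * infdist f B)\<close>.\<close>

lemma domination_from_Lipschitz:
  fixes \<alpha> \<beta> :: "real cpath measure" and F :: "real cpath \<Rightarrow> real"
  assumes \<alpha>: "prob_space \<alpha>" "sets \<alpha> = sets borel" and \<beta>: "prob_space \<beta>" "sets \<beta> = sets borel"
    and lip: "\<And>f L. \<lbrakk>\<And>x y. \<bar>f x - f y\<bar> \<le> L * dist x y; \<And>x y. path_le x y \<Longrightarrow> f x \<le> f y;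
        \<And>x. 0 \<le> f x; \<And>x. f x \<le> 1\<rbrakk> \<Longrightarrow> integral\<^sup>L \<alpha> f \<le> integral\<^sup>L \<beta> (f :: _ \<Rightarrow> real)"
    and F: "F \<in> borel_measurable borel" "bounded (range F)" "\<And>x y. path_le x y \<Longrightarrow> F x \<le> F y"
  shows "integral\<^sup>L \<alpha> F \<le> integral\<^sup>L \<beta> F"
proof -
  interpret \<alpha>: prob_space \<alpha> by fact
  interpret \<beta>: prob_space \<beta> by fact
  have sp[simp]: "space \<alpha> = UNIV" "space \<beta> = UNIV"
    using \<alpha>(2) \<beta>(2) by (auto dest!: sets_eq_imp_space_eq)
  have m\<alpha>: "borel_measurable \<alpha> = borel_measurable borel" and m\<beta>: "borel_measurable \<beta> = borel_measurable borel"
    by (auto intro!: measurable_cong_sets \<alpha> \<beta>)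
  have closed_le: "measure \<alpha> B \<le> measure \<beta> B" if B: "closed B" "upward_closed B" for B
  proof (cases "B = {}")
    case False
    define f where "f n x = max 0 (1 - real n * infdist x B)" for n x
    have cont: "continuous_on UNIV (f n)" for n
      unfolding f_def by (intro continuous_intros)
    have lim: "(\<lambda>n. f n x) \<longlonglongrightarrow> indicator B x" for x
      unfolding f_def by (rule infdist_bump_tendsto[OF B(1) False])
    have conv: "(\<lambda>n. integral\<^sup>L \<mu> (f n)) \<longlonglongrightarrow> measure \<mu> B"
      if "prob_space \<mu>" "sets \<mu> = sets borel" "space \<mu> = UNIV" for \<mu>
    proof -
      interpret prob_space \<mu> by fact
      have mb: "borel_measurable \<mu> = borel_measurable borel" by (auto intro!: measurable_cong_sets that)
      have "B \<in> sets \<mu>" using that B(1) by simp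
      then have "measure \<mu> B = integral\<^sup>L \<mu> (indicator B)" using that by simp
      moreover have "(\<lambda>n. integral\<^sup>L \<mu> (f n)) \<longlonglongrightarrow> integral\<^sup>L \<mu> (indicator B)"
      proof (rule integral_dominated_convergence[where w = "\<lambda>_. 1"])
        show "(indicator B :: _ \<Rightarrow> real) \<in> borel_measurable \<mu>" using \<open>B \<in> sets \<mu>\<close> by simp
        show "f n \<in> borel_measurable \<mu>" for n
          unfolding mb by (rule borel_measurable_continuous_onI[OF cont])
        show "AE x in \<mu>. (\<lambda>n. f n x) \<longlonglongrightarrow> indicator B x" using lim by simp
      qed (auto simp: f_def infdist_nonneg)
      ultimately show ?thesis by simp
    qed
    have "integral\<^sup>L \<alpha> (f n) \<le> integral\<^sup>L \<beta> (f n)" for n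
    proof (rule lip)
      show "\<bar>f n x - f n y\<bar> \<le> real n * dist x y" for x y
      proof -
        have "\<bar>infdist x B - infdist y B\<bar> \<le> dist x y" by (rule infdist_triangle_abs)
        then have "\<bar>real n * infdist x B - real n * infdist y B\<bar> \<le> real n * dist x y"
          unfolding right_diff_distrib[symmetric] abs_mult by (simp add: mult_left_mono)
        then show ?thesis unfolding f_def by linarith
      qed
      show "f n x \<le> f n y" if "path_le x y" for x y
        using infdist_upward_closed[OF B(2) False that]
        unfolding f_def by (intro max.mono order_refl diff_left_mono mult_left_mono) auto
    qed (auto simp: f_def infdist_nonneg)
    then show ?thesis
      by (intro LIMSEQ_le[OF conv[OF \<alpha>] conv[OF \<beta>]]) auto
  qed simp
  have sets_le: "measure \<alpha> A \<le> measure \<beta> A" if A: "A \<in> sets borel" "upward_closed A" for A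
  proof (rule field_le_epsilon)
    fix e :: real assume e: "e > 0"
    have sup: "emeasure \<alpha> A = (SUP K \<in> {K. K \<subseteq> A \<and> compact K}. emeasure \<alpha> K)"
      by (rule inner_regular) (use \<alpha> A in auto)
    have "\<exists>K. K \<subseteq> A \<and> compact K \<and> measure \<alpha> A \<le> measure \<alpha> K + e"
    proof (rule ccontr)
      assume neg: "\<nexists>K. K \<subseteq> A \<and> compact K \<and> measure \<alpha> A \<le> measure \<alpha> K + e"
      have "emeasure \<alpha> K \<le> ennreal (measure \<alpha> A - e)" if "K \<subseteq> A" "compact K" for K
        using neg that by (auto simp: \<alpha>.emeasure_eq_measure not_le intro!: ennreal_leI)
      then have "emeasure \<alpha> A \<le> ennreal (measure \<alpha> A - e)"
        unfolding sup by (intro SUP_least) auto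
      then have "ennreal (measure \<alpha> A) \<le> ennreal (measure \<alpha> A - e)"
        by (simp add: \<alpha>.emeasure_eq_measure)
      moreover have "measure \<alpha> A > e"
        using neg[simplified, rule_format, of "{}"] by (auto simp: not_le)
      ultimately show False using e by (simp add: ennreal_le_iff)
    qed
    then obtain K where K: "K \<subseteq> A" "compact K" "measure \<alpha> A \<le> measure \<alpha> K + e" by blast
    let ?B = "{g. \<exists>f\<in>K. path_le f g}"
    have "closed ?B" by (rule closed_upward_closure[OF K(2)])
    have "measure \<alpha> K \<le> measure \<alpha> ?B"
      by (intro \<alpha>.finite_measure_mono) (use \<open>closed ?B\<close> \<alpha>(2) in \<open>auto simp: path_le_def\<close>)
    also have "\<dots> \<le> measure \<beta> ?B" by (rule closed_le[OF \<open>closed ?B\<close> upward_closed_closure])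
    also have "\<dots> \<le> measure \<beta> A"
      by (intro \<beta>.finite_measure_mono) (use A K \<beta>(2) in \<open>auto simp: upward_closed_def\<close>)
    finally show "measure \<alpha> A \<le> measure \<beta> A + e" using K(3) by simp
  qed
  obtain b where b: "b > 0" "\<And>x. \<bar>F x\<bar> \<le> b"
    using F(2) by (auto simp: bounded_pos)
  define G where "G x = (F x + b) / (2 * b)" for x
  note F(1)[measurable]
  have G: "G \<in> borel_measurable borel" unfolding G_def by measurable
  have le: "integral\<^sup>L \<alpha> G \<le> integral\<^sup>L \<beta> G"
  proof (rule integral_le_from_superlevels[OF \<alpha>(1) \<beta>(1)])
    show "0 \<le> G x" "G x \<le> 1" for x using b(1) b(2)[of x] by (auto simp: G_def field_simps)
    show "measure \<alpha> {x\<in>space \<alpha>. G x \<ge> c} \<le> measure \<beta> {x\<in>space \<beta>. G x \<ge> c}" for c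
    proof -
      have "measure \<alpha> {x. G x \<ge> c} \<le> measure \<beta> {x. G x \<ge> c}"
      proof (rule sets_le)
        show "{x. G x \<ge> c} \<in> sets borel" using G by measurable
        have "G x \<le> G y" if "path_le x y" for x y
          using F(3)[OF that] b(1) by (auto simp: G_def intro!: divide_right_mono)
        then show "upward_closed {x. G x \<ge> c}"
          by (auto simp: upward_closed_def intro: order_trans)
      qed
      then show ?thesis by simp
    qed
  qed (use G m\<alpha> m\<beta> in auto)
  have eq: "integral\<^sup>L \<mu> G = (integral\<^sup>L \<mu> F + b) / (2 * b)"
    if "prob_space \<mu>" "sets \<mu> = sets borel" for \<mu>
  proof -
    interpret prob_space \<mu> by fact
    have "F \<in> borel_measurable \<mu>" using F(1) measurable_cong_sets[OF that(2) refl] by blast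
    then have "integrable \<mu> F" by (intro integrable_const_bound[of _ b]) (use b in simp_all)
    then show ?thesis unfolding G_def by (simp add: prob_space)
  qed
  show ?thesis
    using le b(1) unfolding eq[OF \<alpha>] eq[OF \<beta>] by (simp add: divide_le_cancel)
qed

section \<open>Discretisation errors and tightness from fourth moments\<close>

definition dyadic_incr :: "nat \<Rightarrow> nat \<Rightarrow> 'a::real_normed_vector cpath \<Rightarrow> real" where
  "dyadic_incr i k f = norm (path_at f (real (Suc k) / 2^i) - path_at f (real k / 2^i))"

text \<open>The hypothesis of the Kolmogorov continuity criterion with exponent four, demanded only between
  neighbouring dyadic times of each level, which is all that chaining uses.\<close>

definition moment4 :: "'b measure \<Rightarrow> real \<Rightarrow> ('b \<Rightarrow> 'a::real_normed_vector cpath) \<Rightarrow> bool" where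
  "moment4 M c Z \<longleftrightarrow> (\<forall>i k. integrable M (\<lambda>x. dyadic_incr i k (Z x) ^ 4)
      \<and> (\<integral>x. dyadic_incr i k (Z x) ^ 4 \<partial>M) \<le> c / 4^i)"

lemma dyadic_incr_nonneg [simp]: "0 \<le> dyadic_incr i k f"
  by (simp add: dyadic_incr_def)

lemma measurable_dyadic_incr [measurable (raw)]:
  fixes Z :: "'b \<Rightarrow> 'a::{real_normed_vector, second_countable_topology} cpath"
  assumes [measurable]: "Z \<in> borel_measurable M"
  shows "(\<lambda>x. dyadic_incr i k (Z x)) \<in> borel_measurable M"
  unfolding dyadic_incr_def by measurable

text \<open>Both interpolations stay close to the path at the left end of the dyadic interval of level \<open>i\<close> that
  contains \<open>t\<close>, within the increments over the two halves of this interval.\<close>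

lemma dyadic_interp_step:
  fixes f :: "'a::real_normed_vector cpath"
  assumes t: "0 \<le> t" and m: "m = nat \<lfloor>2^i * t\<rfloor>"
  shows "norm (path_at (dyadic_interp i f) t - path_at (dyadic_interp (Suc i) f) t)
      \<le> 2 * (dyadic_incr (Suc i) (2 * m) f + dyadic_incr (Suc i) (Suc (2 * m)) f)"
proof -
  let ?a = "\<lambda>k. path_at f (real k / 2^(Suc i))"
  define n where "n = nat \<lfloor>2^(Suc i) * t\<rfloor>"
  define D where "D k = norm (?a (Suc k) - ?a k)" for k
  have D: "dyadic_incr (Suc i) k f = D k" for k by (simp add: dyadic_incr_def D_def)
  have coarse: "path_at f (real k / 2^i) = ?a (2 * k)" for k by simp
  have "\<lfloor>2^(Suc i) * t\<rfloor> = 2 * \<lfloor>2^i * t\<rfloor> \<or> \<lfloor>2^(Suc i) * t\<rfloor> = 2 * \<lfloor>2^i * t\<rfloor> + 1"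
    unfolding power_Suc mult.assoc by linarith
  moreover have "0 \<le> \<lfloor>2^i * t\<rfloor>" using t by simp
  ultimately have m': "n = 2 * m \<or> n = Suc (2 * m)" unfolding m n_def by linarith
  have "norm (path_at (dyadic_interp i f) t - ?a (2 * m)) \<le> norm (?a (2 * Suc m) - ?a (2 * m))"
    unfolding dyadic_interp_def path_at_polygon[OF zero_le_power[OF zero_le_numeral] t] coarse m
    by (rule norm_polyval_node_le) (use t in auto)
  also have "\<dots> \<le> D (2 * m) + D (Suc (2 * m))"
    unfolding D_def
    using norm_triangle_ineq[of "?a (Suc (2 * m)) - ?a (2 * m)" "?a (Suc (Suc (2 * m))) - ?a (Suc (2 * m))"]
    by simp
  finally have 1: "norm (path_at (dyadic_interp i f) t - ?a (2 * m)) \<le> D (2 * m) + D (Suc (2 * m))" .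
  have 2: "norm (path_at (dyadic_interp (Suc i) f) t - ?a n) \<le> D n"
    unfolding dyadic_interp_def path_at_polygon[OF zero_le_power[OF zero_le_numeral] t] D_def n_def
    by (rule norm_polyval_node_le) (use t in auto)
  have 3: "D n + norm (?a n - ?a (2 * m)) \<le> D (2 * m) + D (Suc (2 * m))"
    using m' by (elim disjE) (simp_all only: D_def, auto)
  have "norm (path_at (dyadic_interp i f) t - path_at (dyadic_interp (Suc i) f) t)
     \<le> norm (path_at (dyadic_interp i f) t - ?a (2 * m))
       + norm (path_at (dyadic_interp (Suc i) f) t - ?a (2 * m))"
    by (metis dist_norm dist_triangle2)
  moreover have "norm (path_at (dyadic_interp (Suc i) f) t - ?a (2 * m))
     \<le> norm (path_at (dyadic_interp (Suc i) f) t - ?a n) + norm (?a n - ?a (2 * m))"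
    by (metis dist_norm dist_triangle)
  moreover have "x \<le> 2 * s" if "x \<le> A + B" "B \<le> E + G" "A \<le> s" "E \<le> d" "d + G \<le> s"
    for x s A B E G d :: real using that by linarith
  ultimately show ?thesis unfolding D using 1 2 3 by blast
qed

text \<open>The rate is chosen so that the threshold \<open>\<theta> = chain_rate ^ i\<close> in
  \<open>y \<le> \<theta> + y^4 / \<theta>^3\<close> beats the number of increments of level \<open>i\<close>.\<close>

definition chain_rate :: real where "chain_rate = (1/2) powr (1/8)"

lemma chain_rate: "0 < chain_rate" "chain_rate < 1" "chain_rate ^ 8 = 1/2"
proof -
  show "0 < chain_rate" by (simp add: chain_rate_def)
  show *: "chain_rate ^ 8 = 1/2" by (simp add: chain_rate_def powr_power)
  show "chain_rate < 1"
  proof (rule ccontr)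
    assume "\<not> chain_rate < 1"
    then have "1 \<le> chain_rate ^ 8" by (intro one_le_power) simp
    then show False using * by simp
  qed
qed

text \<open>A bound for the expected distance of two consecutive discretisations, summable over the levels.\<close>

definition chain_bound :: "real \<Rightarrow> nat \<Rightarrow> real" where
  "chain_bound c i = (5 + 4 * c) * (real (Suc i) * chain_rate ^ i)"

lemma summable_chain_bound: "summable (chain_bound c)"
  unfolding chain_bound_def
  using geometric_deriv_sums[of chain_rate] chain_rate
  by (intro summable_mult) (auto simp: sums_iff)

lemma young_quartic: 
  fixes y \<theta> :: real
  assumes "0 \<le> y" "0 < \<theta>" shows "y \<le> \<theta> + y^4 / \<theta>^3"
proof (cases "y \<le> \<theta>")
  case True then show ?thesis using assms by (intro order_trans[OF True]) simp
next
  case False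
  then have "\<theta>^3 * y \<le> y^3 * y" using assms by (intro mult_right_mono power_mono) auto
  then have "y \<le> y^4 / \<theta>^3"
    using assms by (simp add: pos_le_divide_eq mult.commute power_numeral_reduce)
  then show ?thesis using assms by simp
qed

text \<open>The maximum of the relevant increments is bounded by \<open>\<theta>\<close> plus a multiple of the sum of
  their fourth powers, so no maximal
  inequality is needed. The time horizon \<open>i\<close> grows with the level in order to make the tail of the metric
  summable too.\<close>

lemma dist_dyadic_step_le:
  fixes f :: "'a::real_normed_vector cpath"
  assumes \<theta>: "0 < \<theta>"
  shows "dist (dyadic_interp i f) (dyadic_interp (Suc i) f)
      \<le> 4 * (\<theta> + (\<Sum>k<2^(Suc i) * Suc i. dyadic_incr (Suc i) k f ^ 4) / \<theta>^3) + (1/2)^i"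
    (is "_ \<le> 4 * (\<theta> + ?S / \<theta>^3) + _")
proof (rule dist_cpath_le)
  have S: "0 \<le> ?S" by (intro sum_nonneg) auto
  then show "0 \<le> 4 * (\<theta> + ?S / \<theta>^3)" using \<theta> by simp
  fix t :: real assume t: "0 \<le> t" "t \<le> real i"
  define m where "m = nat \<lfloor>2^i * t\<rfloor>"
  have "m \<le> 2^i * i"
  proof -
    have "real m \<le> 2^i * t" unfolding m_def using t by simp
    also have "\<dots> \<le> 2^i * real i" using t by simp
    finally have "real m \<le> real (2^i * i)" by simp
    then show ?thesis by (simp only: of_nat_le_iff)
  qed
  moreover have "(1::nat) \<le> 2^i" by simp
  ultimately have "Suc (2 * m) < 2 * 2^i + 2 * (2^i * i)" by linarith
  then have m: "Suc (2 * m) < 2^(Suc i) * Suc i" by (simp add: algebra_simps)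
  have D: "dyadic_incr (Suc i) k f \<le> \<theta> + ?S / \<theta>^3" if "k < 2^(Suc i) * Suc i" for k
  proof -
    have "dyadic_incr (Suc i) k f ^ 4 \<le> ?S"
      by (rule member_le_sum) (use that in auto)
    then have "dyadic_incr (Suc i) k f ^ 4 / \<theta>^3 \<le> ?S / \<theta>^3"
      using \<theta> by (intro divide_right_mono) auto
    then show ?thesis using young_quartic[OF dyadic_incr_nonneg \<theta>, of "Suc i" k f] by simp
  qed
  have le_four: "x \<le> 2 * (a + b) \<Longrightarrow> a \<le> s \<Longrightarrow> b \<le> s \<Longrightarrow> x \<le> 4 * s" for x a b s :: real
    by simp
  from le_four[OF dyadic_interp_step[OF t(1) m_def, of f] D[of "2 * m"] D[of "Suc (2 * m)"]] m
  show "norm (path_at (dyadic_interp i f) t - path_at (dyadic_interp (Suc i) f) t) \<le> 4 * (\<theta> + ?S / \<theta>^3)"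
    by simp
qed

definition chain_tail :: "real \<Rightarrow> nat \<Rightarrow> real" where
  "chain_tail c j = (\<Sum>i. chain_bound c (i + j))"

lemma chain_tail_tendsto: "chain_tail c \<longlonglongrightarrow> 0"
proof (rule LIMSEQ_I)
  fix e :: real assume "e > 0"
  from suminf_exist_split[OF this summable_chain_bound, of c]
  show "\<exists>N. \<forall>n\<ge>N. norm (chain_tail c n - 0) < e" unfolding chain_tail_def by simp
qed

lemma chain_bound_nonneg: "0 \<le> c \<Longrightarrow> 0 \<le> chain_bound c i"
  unfolding chain_bound_def using chain_rate by auto

context prob_space
begin

lemma integrable_dist_cpath:
  fixes f g :: "'a \<Rightarrow> 'b::{banach, second_countable_topology} cpath"
  assumes [measurable]: "f \<in> borel_measurable M" "g \<in> borel_measurable M"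
  shows "integrable M (\<lambda>x. dist (f x) (g x))"
  by (rule integrable_const_bound[of _ 1]) (auto simp: dist_cpath_le_1)

lemma expectation_dyadic_step:
  fixes Z :: "'a \<Rightarrow> 'b::{banach, second_countable_topology} cpath"
  assumes Z[measurable]: "Z \<in> borel_measurable M" and c: "0 \<le> c"
    and int: "\<And>k. integrable M (\<lambda>x. dyadic_incr (Suc i) k (Z x) ^ 4)"
      "\<And>k. expectation (\<lambda>x. dyadic_incr (Suc i) k (Z x) ^ 4) \<le> c / 4^(Suc i)"
  shows "expectation (\<lambda>x. dist (dyadic_interp i (Z x)) (dyadic_interp (Suc i) (Z x))) \<le> chain_bound c i"
proof -
  define \<theta> where "\<theta> = chain_rate ^ Suc i"
  have \<theta>: "0 < \<theta>" using chain_rate by (simp add: \<theta>_def)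
  let ?n = "2^(Suc i) * Suc i"
  have "expectation (\<lambda>x. dist (dyadic_interp i (Z x)) (dyadic_interp (Suc i) (Z x)))
      \<le> expectation (\<lambda>x. 4 * (\<theta> + (\<Sum>k<?n. dyadic_incr (Suc i) k (Z x) ^ 4) / \<theta>^3) + (1/2)^i)"
    by (intro integral_mono integrable_dist_cpath dist_dyadic_step_le \<theta>) (use int in auto)
  also have "\<dots> = 4 * (\<theta> + (\<Sum>k<?n. expectation (\<lambda>x. dyadic_incr (Suc i) k (Z x) ^ 4)) / \<theta>^3) + (1/2)^i"
    using int by (simp add: prob_space)
  also have "\<dots> \<le> 4 * (\<theta> + (\<Sum>k<?n. c / 4^(Suc i)) / \<theta>^3) + (1/2)^i"
    using \<theta> by (intro add_mono mult_left_mono divide_right_mono sum_mono int(2)) auto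
  also have "(\<Sum>k<?n. c / 4^(Suc i)) = real (Suc i) * c * (1/2)^(Suc i)"
  proof -
    have "(4::real)^(Suc i) = 2^(Suc i) * 2^(Suc i)" by (simp flip: power_mult_distrib)
    then show ?thesis by (simp add: power_one_over field_simps)
  qed
  also have "(1/2::real)^(Suc i) = \<theta>^8"
    unfolding \<theta>_def power_mult[symmetric] chain_rate(3)[symmetric] by (simp add: mult.commute)
  also have "real (Suc i) * c * \<theta>^8 / \<theta>^3 = real (Suc i) * c * \<theta>^5"
    using \<theta> by (simp add: field_simps flip: power_add)
  also have "\<dots> \<le> real (Suc i) * c * chain_rate^i"
  proof -
    have "\<theta>^5 \<le> chain_rate ^ i"
      unfolding \<theta>_def power_mult[symmetric] using chain_rate by (intro power_decreasing) auto
    then show ?thesis using c by (intro mult_left_mono) auto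
  qed
  also have "\<theta> \<le> chain_rate^i" unfolding \<theta>_def using chain_rate by (intro power_decreasing) auto
  also have "(1/2::real)^i \<le> chain_rate^i"
    unfolding chain_rate(3)[symmetric] power_mult[symmetric]
    using chain_rate by (intro power_decreasing) auto
  finally have "expectation (\<lambda>x. dist (dyadic_interp i (Z x)) (dyadic_interp (Suc i) (Z x)))
    \<le> 4 * (chain_rate^i + real (Suc i) * c * chain_rate^i) + chain_rate^i" by simp
  also have "\<dots> = 5 * chain_rate^i + 4 * c * (real (Suc i) * chain_rate^i)"
    by (simp add: algebra_simps)
  also have "5 * chain_rate^i \<le> 5 * (real (Suc i) * chain_rate^i)"
    using chain_rate by simp
  finally show ?thesis unfolding chain_bound_def by (simp add: algebra_simps)
qed

text \<open>Chaining: the error telescopes over the levels, and at high levels it vanishes by dominated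
  convergence.\<close>

lemma expectation_dist_dyadic_interp:
  fixes Z :: "'a \<Rightarrow> 'b::{banach, second_countable_topology} cpath"
  assumes Z[measurable]: "Z \<in> borel_measurable M" and mom: "moment4 M c Z" and c: "0 \<le> c"
  shows "expectation (\<lambda>x. dist (Z x) (dyadic_interp j (Z x))) \<le> chain_tail c j"
proof -
  let ?d = "\<lambda>i. expectation (\<lambda>x. dist (Z x) (dyadic_interp i (Z x)))"
  have step: "?d j \<le> (\<Sum>i<n. chain_bound c (i + j)) + ?d (n + j)" for n
  proof (induction n)
    case (Suc n)
    have "?d (n + j) \<le> expectation (\<lambda>x. dist (dyadic_interp (n+j) (Z x)) (dyadic_interp (Suc (n+j)) (Z x))
        + dist (Z x) (dyadic_interp (Suc (n+j)) (Z x)))"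
      by (intro integral_mono integrable_dist_cpath Bochner_Integration.integrable_add)
         (auto, metis add.commute dist_commute dist_triangle)
    also have "\<dots> \<le> chain_bound c (n + j) + ?d (Suc (n + j))"
      using expectation_dyadic_step[OF Z c mom[unfolded moment4_def, rule_format, THEN conjunct1]
        mom[unfolded moment4_def, rule_format, THEN conjunct2], of "n + j"]
      by (subst Bochner_Integration.integral_add) (auto intro!: integrable_dist_cpath)
    finally show ?case using Suc by simp
  qed simp
  have "?d \<longlonglongrightarrow> expectation (\<lambda>x. 0)"
  proof (rule integral_dominated_convergence[where w = "\<lambda>_. 1"])
    show "AE x in M. (\<lambda>i. dist (Z x) (dyadic_interp i (Z x))) \<longlonglongrightarrow> 0"
    proof (rule AE_I2)
      fix x
      show "(\<lambda>i. dist (Z x) (dyadic_interp i (Z x))) \<longlonglongrightarrow> 0"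
        using tendsto_dist[OF tendsto_const dyadic_interp_tendsto, of "Z x" "Z x"] by simp
    qed
  qed (auto simp: dist_cpath_le_1)
  then have "(\<lambda>n. ?d (n + j)) \<longlonglongrightarrow> 0" by (subst LIMSEQ_ignore_initial_segment) simp_all
  moreover have "(\<lambda>n. \<Sum>i<n. chain_bound c (i + j)) \<longlonglongrightarrow> chain_tail c j"
    unfolding chain_tail_def
    by (intro summable_LIMSEQ) (use summable_chain_bound in \<open>simp add: summable_iff_shift\<close>)
  ultimately have "(\<lambda>n. (\<Sum>i<n. chain_bound c (i + j)) + ?d (n + j)) \<longlonglongrightarrow> chain_tail c j + 0"
    by (rule tendsto_add[rotated])
  then show ?thesis by (intro tendsto_lowerbound[where F = sequentially and x = "chain_tail c j"])
     (use step in auto)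
qed

lemma prob_INT_ge:
  assumes S: "\<And>i::nat. S i \<in> events" and le: "\<And>i. prob (space M - S i) \<le> e * (1/2)^(Suc i)"
  shows "1 - e \<le> prob (\<Inter>i. S i)"
proof -
  have sums: "(\<lambda>i. e * (1/2)^(Suc i)) sums e" using sums_mult[OF power_half_series, of e] by simp
  have summ: "summable (\<lambda>i. prob (space M - S i))"
    by (rule summable_comparison_test'[OF sums_summable[OF sums]]) (use le in auto)
  have "prob (\<Union>i. space M - S i) \<le> (\<Sum>i. prob (space M - S i))"
    by (rule finite_measure_subadditive_countably) (use S summ in auto)
  also have "\<dots> \<le> e"
    using suminf_le[OF le summ sums_summable[OF sums]] sums by (simp add: sums_iff)
  also have "(\<Union>i. space M - S i) = space M - (\<Inter>i. S i)" by auto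
  finally show ?thesis using S by (subst (asm) prob_compl) auto
qed

lemma prob_Int_ge:
  assumes [measurable]: "S \<in> events" "T \<in> events"
    and le: "1 - e/2 \<le> prob S" "1 - e/2 \<le> prob T"
  shows "1 - e \<le> prob (S \<inter> T)"
proof -
  have "prob (space M - S \<inter> T) = prob ((space M - S) \<union> (space M - T))"
    by (rule arg_cong[of _ _ prob]) auto
  also have "\<dots> \<le> prob (space M - S) + prob (space M - T)" by (rule measure_Un_le) auto
  finally show ?thesis using le by (simp add: prob_compl)
qed

lemma prob_gt_le_Markov:
  fixes Y :: "'a \<Rightarrow> real"
  assumes "integrable M Y" "\<And>x. 0 \<le> Y x" "expectation Y \<le> a * b" "0 < b"
  shows "prob (space M - {x \<in> space M. Y x \<le> b}) \<le> a"
proof -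
  have [measurable]: "Y \<in> borel_measurable M" using assms(1) by auto
  have "prob (space M - {x \<in> space M. Y x \<le> b}) \<le> prob {x \<in> space M. b \<le> Y x}"
    by (intro finite_measure_mono) auto
  also have "\<dots> \<le> expectation Y / b"
    by (rule integral_Markov_inequality_measure[of _ _ "{}"]) (use assms in auto)
  also have "\<dots> \<le> a" using assms(3,4) by (simp add: pos_divide_le_eq)
  finally show ?thesis .
qed

lemma expectation_norm_node_le:
  fixes Z :: "'a \<Rightarrow> 'b::{banach, second_countable_topology} cpath"
  assumes Z[measurable]: "Z \<in> borel_measurable M" and mom: "moment4 M c Z" and c: "0 \<le> c"
    and Z0: "\<And>x. x \<in> space M \<Longrightarrow> path_at (Z x) 0 = 0"
  shows "integrable M (\<lambda>x. norm (path_at (Z x) (real k / 2^j)))"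
    and "expectation (\<lambda>x. norm (path_at (Z x) (real k / 2^j))) \<le> real k * (1 + c)"
proof -
  have int4: "integrable M (\<lambda>x. dyadic_incr j i (Z x) ^ 4)"
    "expectation (\<lambda>x. dyadic_incr j i (Z x) ^ 4) \<le> c" for i
  proof -
    have "c / 4^j \<le> c" using c by (simp add: divide_le_eq mult_le_cancel_left1)
    then show "integrable M (\<lambda>x. dyadic_incr j i (Z x) ^ 4)"
      "expectation (\<lambda>x. dyadic_incr j i (Z x) ^ 4) \<le> c"
      using mom order_trans unfolding moment4_def by blast+
  qed
  have le: "norm (path_at (Z x) (real k / 2^j)) \<le> (\<Sum>i<k. 1 + dyadic_incr j i (Z x) ^ 4)"
    if "x \<in> space M" for x
  proof -
    have "path_at (Z x) (real k / 2^j)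
      = (\<Sum>i<k. path_at (Z x) (real (Suc i) / 2^j) - path_at (Z x) (real i / 2^j))"
      by (subst sum_lessThan_telescope) (simp add: Z0[OF that])
    also have "norm \<dots> \<le> (\<Sum>i<k. dyadic_incr j i (Z x))"
      unfolding dyadic_incr_def by (rule norm_sum)
    also have "\<dots> \<le> (\<Sum>i<k. 1 + dyadic_incr j i (Z x) ^ 4)"
      using young_quartic[OF dyadic_incr_nonneg zero_less_one] by (intro sum_mono) simp
    finally show ?thesis .
  qed
  show int: "integrable M (\<lambda>x. norm (path_at (Z x) (real k / 2^j)))"
  proof (rule Bochner_Integration.integrable_bound)
    show "integrable M (\<lambda>x. \<Sum>i<k. 1 + dyadic_incr j i (Z x) ^ 4)" using int4 by auto
    show "AE x in M. norm (norm (path_at (Z x) (real k / 2^j))) \<le> norm (\<Sum>i<k. 1 + dyadic_incr j i (Z x) ^ 4)"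
      using le by (intro AE_I2) (auto intro: order_trans[OF _ abs_ge_self])
  qed measurable
  have "expectation (\<lambda>x. norm (path_at (Z x) (real k / 2^j)))
      \<le> expectation (\<lambda>x. \<Sum>i<k. 1 + dyadic_incr j i (Z x) ^ 4)"
    by (intro integral_mono int le) (use int4 in auto)
  also have "\<dots> = (\<Sum>i<k. 1 + expectation (\<lambda>x. dyadic_incr j i (Z x) ^ 4))"
    using int4 by (simp add: prob_space)
  also have "\<dots> \<le> (\<Sum>i<k. 1 + c)" by (intro sum_mono add_left_mono int4)
  finally show "expectation (\<lambda>x. norm (path_at (Z x) (real k / 2^j))) \<le> real k * (1 + c)" by simp
qed

text \<open>With large probability all discretisation errors along a sparse sequence of levels and all values
  at dyadic times are under control simultaneously, and this confines the path to a compact set.\<close>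

lemma tight_from_moment4:
  fixes c :: real
  assumes c: "0 \<le> c" and e: "0 < e"
  shows "\<exists>K :: 'b::euclidean_space cpath set. compact K \<and>
    (\<forall>Z. Z \<in> borel_measurable M \<longrightarrow> moment4 M c Z \<longrightarrow> (\<forall>x\<in>space M. path_at (Z x) 0 = 0)
      \<longrightarrow> 1 - e \<le> measure (distr M borel Z) K)"
proof -
  have "\<exists>n. chain_tail c n \<le> e / 2 * (1/2)^(Suc j) * (1/2)^j" for j
  proof -
    have "0 < e / 2 * (1/2)^(Suc j) * (1/2)^j" using e by simp
    from order_tendstoD(2)[OF chain_tail_tendsto this, of c]
    show ?thesis by (auto simp: eventually_sequentially intro: less_imp_le)
  qed
  then obtain n where n: "\<And>j. chain_tail c (n j) \<le> e / 2 * (1/2)^(Suc j) * (1/2)^j" by metis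
  \<comment> \<open>With these weights the exceptional probabilities add up to \<open>e / 2\<close> over all levels and nodes.\<close>
  define b where "b j k = (real k * (1 + c) + 1) / (e / 2 * (1/2)^(Suc j) * (1/2)^(Suc k))" for j k
  have b: "0 < b j k" "real k * (1 + c) \<le> e / 2 * (1/2)^(Suc j) * (1/2)^(Suc k) * b j k" for j k
  proof -
    have pos: "0 < e / 2 * (1/2)^(Suc j) * (1/2)^(Suc k)" using e by simp
    show "0 < b j k" unfolding b_def using pos c by (intro divide_pos_pos add_nonneg_pos) auto
    have "e / 2 * (1/2)^(Suc j) * (1/2)^(Suc k) * b j k = real k * (1 + c) + 1"
      unfolding b_def using pos by (simp only: times_divide_eq_right nonzero_mult_div_cancel_left less_imp_neq[symmetric] not_False_eq_True)
    then show "real k * (1 + c) \<le> e / 2 * (1/2)^(Suc j) * (1/2)^(Suc k) * b j k" by simp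
  qed
  define K where "K = {f :: 'b cpath. (\<forall>j. dist f (dyadic_interp (n j) f) \<le> (1/2)^j)
      \<and> (\<forall>j k. norm (path_at f (real k / 2^j)) \<le> b j k)}"
  have K: "compact K" unfolding K_def by (rule compact_paths) (simp add: LIMSEQ_power_zero)
  have "1 - e \<le> measure (distr M borel Z) K"
    if Z[measurable]: "Z \<in> borel_measurable M" and mom: "moment4 M c Z"
      and Z0: "\<forall>x\<in>space M. path_at (Z x) 0 = 0" for Z :: "'a \<Rightarrow> 'b cpath"
  proof -
    define S1 where "S1 j = {x \<in> space M. dist (Z x) (dyadic_interp (n j) (Z x)) \<le> (1/2)^j}" for j
    define S2 where "S2 j k = {x \<in> space M. norm (path_at (Z x) (real k / 2^j)) \<le> b j k}" for j k
    have [measurable]: "S1 j \<in> events" "S2 j k \<in> events" for j k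
      unfolding S1_def S2_def by measurable
    have "1 - e/2 \<le> prob (\<Inter>j. S1 j)"
    proof (rule prob_INT_ge)
      show "prob (space M - S1 j) \<le> e / 2 * (1/2)^(Suc j)" for j
        unfolding S1_def
        by (rule prob_gt_le_Markov)
           (use order_trans[OF expectation_dist_dyadic_interp[OF Z mom c] n] in
              \<open>auto intro!: integrable_dist_cpath\<close>)
    qed simp
    moreover have "1 - e/2 \<le> prob (\<Inter>j. \<Inter>k. S2 j k)"
    proof (rule prob_INT_ge)
      fix j
      have "1 - e / 2 * (1/2)^(Suc j) \<le> prob (\<Inter>k. S2 j k)"
      proof (rule prob_INT_ge)
        show "prob (space M - S2 j k) \<le> e / 2 * (1/2)^(Suc j) * (1/2)^(Suc k)" for k
          unfolding S2_def
        proof (rule prob_gt_le_Markov)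
          show "integrable M (\<lambda>x. norm (path_at (Z x) (real k / 2^j)))"
            by (rule expectation_norm_node_le[OF Z mom c]) (use Z0 in auto)
          have "expectation (\<lambda>x. norm (path_at (Z x) (real k / 2^j))) \<le> real k * (1 + c)"
            by (rule expectation_norm_node_le[OF Z mom c]) (use Z0 in auto)
          then show "expectation (\<lambda>x. norm (path_at (Z x) (real k / 2^j)))
              \<le> e / 2 * (1/2)^(Suc j) * (1/2)^(Suc k) * b j k"
            using b(2) by (rule order_trans)
        qed (auto simp: b)
      qed simp
      then show "prob (space M - (\<Inter>k. S2 j k)) \<le> e / 2 * (1/2)^(Suc j)"
        by (subst prob_compl) auto
    qed measurable
    ultimately have "1 - e \<le> prob ((\<Inter>j. S1 j) \<inter> (\<Inter>j. \<Inter>k. S2 j k))"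
      by (intro prob_Int_ge) measurable
    also have "(\<Inter>j. S1 j) \<inter> (\<Inter>j. \<Inter>k. S2 j k) = Z -` K \<inter> space M"
      by (auto simp: S1_def S2_def K_def)
    also have "prob \<dots> = measure (distr M borel Z) K"
      using compact_imp_closed[OF K] by (intro measure_distr[symmetric]) auto
    finally show ?thesis .
  qed
  then show ?thesis using K by blast
qed

end

section \<open>Centered normal laws and limits of independent variables\<close>

lemma sets_centered_normal [simp, measurable_cong]: "sets (centered_normal v) = sets borel"
  by (simp add: centered_normal_def)

lemma space_centered_normal [simp]: "space (centered_normal v) = UNIV"
  by (simp add: centered_normal_def)

lemma centered_normal_scale_std:
  assumes "0 \<le> v"
  shows "centered_normal v = distr std_normal_distribution borel (\<lambda>x. sqrt v * x)"
proof (cases "v = 0")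
  case True
  interpret prob_space std_normal_distribution
    by (rule prob_space_normal_density) simp
  show ?thesis using True by (simp add: centered_normal_def distr_const)
next
  case False
  then have v: "0 < sqrt v" using assms by simp
  interpret S: prob_space std_normal_distribution
    by (rule prob_space_normal_density) simp
  have "distributed std_normal_distribution lborel (\<lambda>x. x) std_normal_density"
    by (auto simp: distributed_def distr_id2)
  from S.normal_density_affine[OF this zero_less_one, of "sqrt v" 0] v
  have "distributed std_normal_distribution lborel (\<lambda>x. sqrt v * x) (normal_density 0 (sqrt v))"
    by simp
  then have "distr std_normal_distribution lborel (\<lambda>x. sqrt v * x) = density lborel (normal_density 0 (sqrt v))"
    by (simp add: distributed_def)
  then show ?thesis using False by (simp add: centered_normal_def cong: distr_cong)
qed

lemma real_distribution_centered_normal: "0 \<le> v \<Longrightarrow> real_distribution (centered_normal v)"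
proof -
  assume v: "0 \<le> v"
  interpret S: prob_space std_normal_distribution
    by (rule prob_space_normal_density) simp
  show ?thesis unfolding centered_normal_scale_std[OF v]
    by (rule S.real_distribution_distr) simp
qed

lemma prob_space_centered_normal: "0 \<le> v \<Longrightarrow> prob_space (centered_normal v)"
  using real_distribution_centered_normal by (simp add: real_distribution_def)

lemma char_centered_normal:
  assumes "0 \<le> v"
  shows "char (centered_normal v) t = complex_of_real (exp (- (v * t\<^sup>2) / 2))"
proof -
  have "char (centered_normal v) t = char std_normal_distribution (sqrt v * t)"
    unfolding centered_normal_scale_std[OF assms] char_def
    by (subst integral_distr) (auto simp: mult_ac)
  then show ?thesis using assms by (simp add: char_std_normal_distribution power_mult_distrib)
qed

lemma centered_normal_eqI:
  assumes "real_distribution \<mu>" "0 \<le> v"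
    and "\<And>t. char \<mu> t = complex_of_real (exp (- (v * t\<^sup>2) / 2))"
  shows "\<mu> = centered_normal v"
  by (rule Levy_uniqueness[OF assms(1) real_distribution_centered_normal[OF assms(2)]])
     (auto simp: char_centered_normal[OF assms(2)] assms(3))

lemma centered_normal_scale:
  assumes "0 \<le> v"
  shows "distr (centered_normal v) borel (\<lambda>x. c * x) = centered_normal (c\<^sup>2 * v)"
proof (rule centered_normal_eqI)
  interpret prob_space "centered_normal v" by (rule prob_space_centered_normal[OF assms])
  show "real_distribution (distr (centered_normal v) borel (\<lambda>x. c * x))"
    by (rule real_distribution_distr) simp
  show "char (distr (centered_normal v) borel (\<lambda>x. c * x)) t = complex_of_real (exp (- (c\<^sup>2 * v * t\<^sup>2) / 2))" for t
  proof -
    have "char (distr (centered_normal v) borel (\<lambda>x. c * x)) t = char (centered_normal v) (t * c)"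
      unfolding char_def by (subst integral_distr) (auto simp: mult_ac)
    then show ?thesis by (simp add: char_centered_normal[OF assms] power_mult_distrib mult_ac)
  qed
qed (use assms in simp)

lemma centered_normal_moment4:
  assumes "0 \<le> v"
  shows "integrable (centered_normal v) (\<lambda>x. x^4)" "(\<integral>x. x^4 \<partial>centered_normal v) = 3 * v\<^sup>2"
proof -
  have "has_bochner_integral std_normal_distribution (\<lambda>x. x^4) 3"
    using std_normal_moment_even[of 2]
    by (subst has_bochner_integral_density)
       (auto simp: fact_numeral normal_density_nonneg)
  then have *: "integrable std_normal_distribution (\<lambda>x. x^4)"
    "(\<integral>x. x^4 \<partial>std_normal_distribution) = 3"
    by (auto simp: has_bochner_integral_iff)
  have 4: "sqrt v ^ 4 = v\<^sup>2"
    using assms by (simp add: power_numeral_reduce power2_eq_square mult.assoc[symmetric])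
  show "integrable (centered_normal v) (\<lambda>x. x^4)"
    unfolding centered_normal_scale_std[OF assms]
    by (subst integrable_distr_eq) (use * in \<open>auto simp: power_mult_distrib\<close>)
  show "(\<integral>x. x^4 \<partial>centered_normal v) = 3 * v\<^sup>2"
    unfolding centered_normal_scale_std[OF assms]
    by (subst integral_distr) (use * 4 in \<open>auto simp: power_mult_distrib\<close>)
qed

context prob_space
begin

lemma indep_vars_sum_blocks:
  fixes X :: "'i \<Rightarrow> 'a \<Rightarrow> 'b::{second_countable_topology, real_normed_vector}"
  assumes "indep_vars (\<lambda>_. borel) X I" "\<And>j. j \<in> L \<Longrightarrow> K j \<subseteq> I" "disjoint_family_on K L"
  shows "indep_vars (\<lambda>_. borel) (\<lambda>j x. \<Sum>k\<in>K j. X k x) L"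
proof -
  have "indep_vars (\<lambda>_. borel) (\<lambda>j x. (\<lambda>f. \<Sum>k\<in>K j. f k) (restrict (\<lambda>i. X i x) (K j))) L"
    by (rule indep_vars_compose2[OF indep_vars_restrict[OF assms]]) measurable
  then show ?thesis by (simp cong: sum.cong)
qed

lemma distr_sum_centered_normal:
  assumes X: "indep_vars (\<lambda>_. borel) X K" "\<And>k. k \<in> K \<Longrightarrow> distr M borel (X k) = centered_normal v"
    and v: "0 \<le> v"
  shows "distr M borel (\<lambda>x. \<Sum>k\<in>K. X k x) = centered_normal (real (card K) * v)"
proof (rule centered_normal_eqI)
  have [measurable]: "X k \<in> borel_measurable M" if "k \<in> K" for k
    using X(1) that by (auto simp: indep_vars_def2)
  show "real_distribution (distr M borel (\<lambda>x. \<Sum>k\<in>K. X k x))"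
    by (rule real_distribution_distr) measurable
  show "char (distr M borel (\<lambda>x. \<Sum>k\<in>K. X k x)) t
      = complex_of_real (exp (- (real (card K) * v * t\<^sup>2) / 2))" for t
    by (subst char_distr_sum[OF X(1)])
       (simp add: X(2) char_centered_normal[OF v] exp_of_nat_mult[symmetric] mult_ac flip: of_real_power)
qed (use v in simp)

text \<open>The factorisation of expectations of bounded continuous functions passes to the limit, and
  indicators of closed sets, a generator of the Borel sets, are limits of such functions.\<close>

lemma indep_vars_limit:
  fixes X :: "'i \<Rightarrow> 'a \<Rightarrow> real" and Y :: "nat \<Rightarrow> 'i \<Rightarrow> 'a \<Rightarrow> real"
  assumes I: "finite I" "I \<noteq> {}" and Y: "\<And>m. indep_vars (\<lambda>_. borel) (Y m) I"
    and X[measurable]: "\<And>i. i \<in> I \<Longrightarrow> X i \<in> borel_measurable M"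
    and lim: "\<And>i. i \<in> I \<Longrightarrow> AE x in M. (\<lambda>m. Y m i x) \<longlonglongrightarrow> X i x"
  shows "indep_vars (\<lambda>_. borel) X I"
proof -
  have [measurable]: "Y m i \<in> borel_measurable M" if "i \<in> I" for m i
    using Y that by (auto simp: indep_vars_def2)
  have lim_all: "AE x in M. \<forall>i\<in>I. (\<lambda>m. Y m i x) \<longlonglongrightarrow> X i x"
    using lim I(1) by (subst AE_finite_all) auto
  have cont_case: "expectation (\<lambda>x. \<Prod>i\<in>I. f i (X i x)) = (\<Prod>i\<in>I. expectation (\<lambda>x. f i (X i x)))"
    if f: "\<And>i. continuous_on UNIV (f i)" "\<And>i y. 0 \<le> f i y" "\<And>i y. f i y \<le> 1" for f :: "'i \<Rightarrow> real \<Rightarrow> real"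
  proof (rule LIMSEQ_unique)
    have [measurable]: "f i \<in> borel_measurable borel" for i
      using f(1) by (rule borel_measurable_continuous_onI)
    have fl: "(\<lambda>m. f i (Y m i x)) \<longlonglongrightarrow> f i (X i x)" if "(\<lambda>m. Y m i x) \<longlonglongrightarrow> X i x" for i x
      using f(1)[of i] that
      by (auto simp: continuous_on_eq_continuous_at intro: isCont_tendsto_compose[of "X i x" "f i"])
    show "(\<lambda>m. expectation (\<lambda>x. \<Prod>i\<in>I. f i (Y m i x))) \<longlonglongrightarrow> expectation (\<lambda>x. \<Prod>i\<in>I. f i (X i x))"
    proof (rule integral_dominated_convergence[where w = "\<lambda>_. 1"])
      show "AE x in M. (\<lambda>m. \<Prod>i\<in>I. f i (Y m i x)) \<longlonglongrightarrow> (\<Prod>i\<in>I. f i (X i x))"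
        using lim_all by eventually_elim (auto intro!: tendsto_prod fl)
      show "AE x in M. norm (\<Prod>i\<in>I. f i (Y m i x)) \<le> 1" for m
        using f by (auto simp: abs_prod intro!: prod_le_1)
    qed auto
    have "(\<lambda>m. \<Prod>i\<in>I. expectation (\<lambda>x. f i (Y m i x))) \<longlonglongrightarrow> (\<Prod>i\<in>I. expectation (\<lambda>x. f i (X i x)))"
    proof (intro tendsto_prod integral_dominated_convergence[where w = "\<lambda>_. 1"])
      fix i assume i: "i \<in> I"
      then show "AE x in M. (\<lambda>m. f i (Y m i x)) \<longlonglongrightarrow> f i (X i x)"
        using lim[OF i] by (auto elim!: eventually_mono intro: fl)
    qed (use f in auto)
    moreover have "expectation (\<lambda>x. \<Prod>i\<in>I. f i (Y m i x)) = (\<Prod>i\<in>I. expectation (\<lambda>x. f i (Y m i x)))" for m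
    proof (rule indep_vars_lebesgue_integral[OF I(1)])
      show "indep_vars (\<lambda>_. borel) (\<lambda>i x. f i (Y m i x)) I"
        by (rule indep_vars_compose2[OF Y]) measurable
      show "integrable M (\<lambda>x. f i (Y m i x))" if "i \<in> I" for i
        by (rule integrable_const_bound[of _ 1]) (use f that in auto)
    qed
    ultimately show "(\<lambda>m. expectation (\<lambda>x. \<Prod>i\<in>I. f i (Y m i x))) \<longlonglongrightarrow> (\<Prod>i\<in>I. expectation (\<lambda>x. f i (X i x)))"
      by simp
  qed
  show ?thesis
  proof (subst indep_vars_finite[where E = "\<lambda>_. Collect closed", OF I(2,1)], goal_cases)
    case 1 show ?case by (simp add: borel_eq_closed)
  next
    case 3 show ?case by (auto simp: Int_stable_def)
  next
    case 6
    show ?case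
    proof
      fix A :: "'i \<Rightarrow> real set" assume "A \<in> I \<rightarrow> Collect closed"
      then have A: "closed (A i)" if "i \<in> I" for i using that by auto
      define f where "f n i y = (if i \<in> I \<and> A i \<noteq> {} then max 0 (1 - real n * infdist y (A i)) else 0)" for n i y
      have fc: "continuous_on UNIV (f n i)" for n i
        unfolding f_def by (cases "i \<in> I \<and> A i \<noteq> {}") (auto intro!: continuous_intros)
      then have [measurable]: "f n i \<in> borel_measurable borel" for n i
        by (rule borel_measurable_continuous_onI)
      have f01: "0 \<le> f n i y" "f n i y \<le> 1" for n i y by (auto simp: f_def infdist_nonneg)
      have flim: "(\<lambda>n. f n i y) \<longlonglongrightarrow> indicator (A i) y" if "i \<in> I" for i y
        using that infdist_bump_tendsto[OF A[OF that], of y] by (cases "A i = {}") (auto simp: f_def)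
      have "(\<lambda>n. expectation (\<lambda>x. \<Prod>i\<in>I. f n i (X i x))) \<longlonglongrightarrow> expectation (\<lambda>x. \<Prod>i\<in>I. indicator (A i) (X i x) :: real)"
      proof (rule integral_dominated_convergence[where w = "\<lambda>_. 1"])
        show "AE x in M. (\<lambda>n. \<Prod>i\<in>I. f n i (X i x)) \<longlonglongrightarrow> (\<Prod>i\<in>I. indicator (A i) (X i x))"
          by (intro AE_I2 tendsto_prod flim)
        show "AE x in M. norm (\<Prod>i\<in>I. f n i (X i x)) \<le> 1" for n
          using f01 by (auto simp: abs_prod intro!: prod_le_1)
        have "(\<lambda>x. indicator (A i) (X i x) :: real) \<in> borel_measurable M" if "i \<in> I" for i
          by (rule measurable_compose[OF X[OF that]]) (use A[OF that] in auto)
        then show "(\<lambda>x. \<Prod>i\<in>I. indicator (A i) (X i x) :: real) \<in> borel_measurable M"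
          by (rule borel_measurable_prod)
      qed auto
      moreover have "(\<lambda>n. \<Prod>i\<in>I. expectation (\<lambda>x. f n i (X i x)))
          \<longlonglongrightarrow> (\<Prod>i\<in>I. expectation (\<lambda>x. indicator (A i) (X i x)))"
      proof (intro tendsto_prod integral_dominated_convergence[where w = "\<lambda>_. 1"])
        fix i assume i: "i \<in> I"
        show "(\<lambda>x. indicator (A i) (X i x) :: real) \<in> borel_measurable M"
          by (rule measurable_compose[OF X[OF i]]) (use A[OF i] in auto)
        show "AE x in M. (\<lambda>n. f n i (X i x)) \<longlonglongrightarrow> indicator (A i) (X i x)"
          using flim[OF i] by auto
      qed (use f01 in auto)
      moreover have "expectation (\<lambda>x. \<Prod>i\<in>I. f n i (X i x)) = (\<Prod>i\<in>I. expectation (\<lambda>x. f n i (X i x)))" for n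
        by (rule cont_case[OF fc f01])
      ultimately have eq: "expectation (\<lambda>x. \<Prod>i\<in>I. indicator (A i) (X i x) :: real)
          = (\<Prod>i\<in>I. expectation (\<lambda>x. indicator (A i) (X i x)))"
        using LIMSEQ_unique by simp
      have meas: "X i -` A i \<inter> space M \<in> events" if "i \<in> I" for i
        using measurable_sets[OF X[OF that], of "A i"] A[OF that] by simp
      have "expectation (\<lambda>x. \<Prod>i\<in>I. indicator (A i) (X i x) :: real)
          = expectation (indicator (\<Inter>i\<in>I. X i -` A i \<inter> space M))"
        using I by (intro Bochner_Integration.integral_cong)
          (auto simp: indicator_def prod_zero_iff split: if_splits)
      also have "\<dots> = prob (\<Inter>i\<in>I. X i -` A i \<inter> space M)"
        using sets.finite_INT[OF I meas] by simp
      finally have 1: "expectation (\<lambda>x. \<Prod>i\<in>I. indicator (A i) (X i x) :: real)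
          = prob (\<Inter>i\<in>I. X i -` A i \<inter> space M)" .
      have 2: "expectation (\<lambda>x. indicator (A i) (X i x) :: real) = prob (X i -` A i \<inter> space M)" if "i \<in> I" for i
      proof -
        have "expectation (\<lambda>x. indicator (A i) (X i x) :: real) = expectation (indicator (X i -` A i \<inter> space M))"
          by (intro Bochner_Integration.integral_cong) (auto simp: indicator_def)
        then show ?thesis using meas[OF that] by simp
      qed
      show "prob (\<Inter>j\<in>I. X j -` A j \<inter> space M) = (\<Prod>j\<in>I. prob (X j -` A j \<inter> space M))"
        using eq 1 2 by (simp cong: prod.cong)
    qed
  qed auto
qed

text \<open>Characteristic functions converge by dominated convergence and determine the law.\<close>

lemma distr_limit_centered_normal:
  fixes X :: "'a \<Rightarrow> real" and Y :: "nat \<Rightarrow> 'a \<Rightarrow> real"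
  assumes Y[measurable]: "\<And>m. Y m \<in> borel_measurable M" and X[measurable]: "X \<in> borel_measurable M"
    and law: "\<And>m. distr M borel (Y m) = centered_normal (v m)" "\<And>m. 0 \<le> v m" "v \<longlonglongrightarrow> u"
    and lim: "AE x in M. (\<lambda>m. Y m x) \<longlonglongrightarrow> X x"
  shows "distr M borel X = centered_normal u"
proof (rule centered_normal_eqI)
  show "0 \<le> u" by (rule LIMSEQ_le_const[OF law(3)]) (use law(2) in auto)
  show "char (distr M borel X) t = complex_of_real (exp (- (u * t\<^sup>2) / 2))" for t
  proof (rule LIMSEQ_unique)
    have c: "char (distr M borel Z) t = (\<integral>x. iexp (t * Z x) \<partial>M)" if [measurable]: "Z \<in> borel_measurable M" for Z
      unfolding char_def by (subst integral_distr) auto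
    show "(\<lambda>m. char (distr M borel (Y m)) t) \<longlonglongrightarrow> char (distr M borel X) t"
      unfolding c[OF X] c[OF Y]
    proof (rule integral_dominated_convergence[where w = "\<lambda>_. 1"])
      show "AE x in M. (\<lambda>m. iexp (t * Y m x)) \<longlonglongrightarrow> iexp (t * X x)"
        using lim by eventually_elim (auto intro!: tendsto_intros)
    qed auto
    show "(\<lambda>m. char (distr M borel (Y m)) t) \<longlonglongrightarrow> complex_of_real (exp (- (u * t\<^sup>2) / 2))"
      unfolding law(1) char_centered_normal[OF law(2)] by (auto intro!: tendsto_intros law)
  qed
qed (rule real_distribution_distr, simp)

end

section \<open>Brownian motion on the line\<close>

definition real_bm :: "'b measure \<Rightarrow> ('b \<Rightarrow> real cpath) \<Rightarrow> bool" where
  "real_bm N B \<longleftrightarrow>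
     prob_space N \<and> B \<in> N \<rightarrow>\<^sub>M borel \<and> (\<forall>\<omega>. path_at (B \<omega>) 0 = 0) \<and>
     (\<forall>(t :: nat \<Rightarrow> real) n. 0 \<le> t 0 \<longrightarrow> strict_mono t \<longrightarrow>
        prob_space.indep_vars N (\<lambda>_. borel)
          (\<lambda>i \<omega>. path_at (B \<omega>) (t (Suc i)) - path_at (B \<omega>) (t i)) {..<n}) \<and>
     (\<forall>s t. 0 \<le> s \<longrightarrow> s < t \<longrightarrow>
        distr N borel (\<lambda>\<omega>. path_at (B \<omega>) t - path_at (B \<omega>) s) = centered_normal (t - s))"

definition on_grid :: "nat \<Rightarrow> real \<Rightarrow> bool" where
  "on_grid L t \<longleftrightarrow> (\<exists>k::nat. t = real k / 2^L)"

definition dyadic_times :: "real set" where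
  "dyadic_times = {t. \<exists>L. on_grid L t}"

lemma on_grid_Suc: "on_grid L t \<Longrightarrow> on_grid (Suc L) t"
proof -
  assume "on_grid L t"
  then obtain k :: nat where "t = real k / 2^L" by (auto simp: on_grid_def)
  then have "t = real (2 * k) / 2^(Suc L)" by simp
  then show ?thesis unfolding on_grid_def by blast
qed

lemma on_grid_mono: "L \<le> L' \<Longrightarrow> on_grid L t \<Longrightarrow> on_grid L' t"
  by (induction L' rule: dec_induct) (auto intro: on_grid_Suc)

lemma finite_dyadic_times_on_grid:
  assumes "finite J" "J \<subseteq> dyadic_times"
  shows "\<exists>L. \<forall>t\<in>J. on_grid L t"
  using assms
proof (induction J rule: finite_induct)
  case (insert x J)
  then obtain L L' where "\<forall>t\<in>J. on_grid L t" "on_grid L' x" by (auto simp: dyadic_times_def)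
  then have "\<forall>t\<in>insert x J. on_grid (max L L') t"
    using on_grid_mono[of L "max L L'"] on_grid_mono[of L' "max L L'"] by auto
  then show ?case by blast
qed simp

definition grid_sum :: "nat \<Rightarrow> (nat \<Rightarrow> real) \<Rightarrow> real \<Rightarrow> real" where
  "grid_sum L x t = (\<Sum>i<nat \<lfloor>2^L * t\<rfloor>. x i)"

lemma grid_sum_grid: "grid_sum L x (real k / 2^L) = (\<Sum>i<k. x i)"
  by (simp add: grid_sum_def)

text \<open>The increments of Brownian motion over consecutive dyadic intervals of level \<open>L\<close>.\<close>

definition noise :: "nat \<Rightarrow> (nat \<Rightarrow> real) measure" where
  "noise L = PiM UNIV (\<lambda>_. centered_normal (1 / 2^L))"

lemma sets_noise [simp, measurable_cong]: "sets (noise L) = sets (PiM UNIV (\<lambda>_. borel))"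
  unfolding noise_def by (rule sets_PiM_cong) auto

lemma prob_space_noise: "prob_space (noise L)"
  unfolding noise_def by (intro prob_space_PiM prob_space_centered_normal) simp

lemma noise_component: "distr (noise L) borel (\<lambda>x. x i) = centered_normal (1 / 2^L)"
proof -
  have "distr (noise L) borel (\<lambda>x. x i) = distr (noise L) (centered_normal (1 / 2^L)) (\<lambda>x. x i)"
    by (rule distr_cong) auto
  then show ?thesis unfolding noise_def
    by (subst (asm) distr_PiM_component) (auto intro!: prob_space_centered_normal)
qed

lemma noise_indep: "prob_space.indep_vars (noise L) (\<lambda>_. borel) (\<lambda>i x. x i) UNIV"
proof -
  interpret prob_space "noise L" by (rule prob_space_noise)
  have "distr (noise L) (PiM UNIV (\<lambda>_. borel)) (\<lambda>x. x) = noise L"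
    by (rule distr_id2) simp
  then show ?thesis
    by (subst indep_vars_iff_distr_eq_PiM) (auto simp: noise_component restrict_UNIV, simp add: noise_def restrict_UNIV)
qed

lemma noise_block:
  "finite K \<Longrightarrow> distr (noise L) borel (\<lambda>x. \<Sum>k\<in>K. x k) = centered_normal (real (card K) / 2^L)"
proof -
  interpret prob_space "noise L" by (rule prob_space_noise)
  show ?thesis
    using distr_sum_centered_normal[OF indep_vars_subset[OF noise_indep], of K "1 / 2^L"]
    by (simp add: noise_component)
qed

lemma noise_halving:
  "distr (noise (Suc L)) (PiM UNIV (\<lambda>_. borel)) (\<lambda>x i. x (2 * i) + x (Suc (2 * i))) = noise L"
proof -
  interpret prob_space "noise (Suc L)" by (rule prob_space_noise)
  have "indep_vars (\<lambda>_. borel) (\<lambda>i x. \<Sum>k\<in>{2 * i, Suc (2 * i)}. x k) UNIV"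
    by (rule indep_vars_sum_blocks[OF noise_indep])
       (auto simp: disjoint_family_on_def)
  then have ind: "indep_vars (\<lambda>_. borel) (\<lambda>i x. x (2 * i) + x (Suc (2 * i))) UNIV" by simp
  have law: "distr (noise (Suc L)) borel (\<lambda>x. x (2 * i) + x (Suc (2 * i))) = centered_normal (1 / 2^L)" for i
    using noise_block[of "{2 * i, Suc (2 * i)}" "Suc L"] by simp
  have "distr (noise (Suc L)) (PiM UNIV (\<lambda>_. borel)) (\<lambda>x. \<lambda>i\<in>UNIV. x (2 * i) + x (Suc (2 * i)))
      = PiM UNIV (\<lambda>i. distr (noise (Suc L)) borel (\<lambda>x. x (2 * i) + x (Suc (2 * i))))"
    by (rule indep_vars_iff_distr_eq_PiM[THEN iffD1, OF _ _ ind]) auto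
  then show ?thesis unfolding law by (simp add: noise_def[of L] restrict_UNIV)
qed

definition grid_law :: "nat \<Rightarrow> real set \<Rightarrow> (real \<Rightarrow> real) measure" where
  "grid_law L J = distr (noise L) (PiM J (\<lambda>_. borel)) (\<lambda>x. \<lambda>t\<in>J. grid_sum L x t)"

lemma measurable_grid_sum [measurable]: "(\<lambda>x. grid_sum L x t) \<in> borel_measurable (noise L)"
  unfolding grid_sum_def by measurable

lemma measurable_grid_sum_PiM [measurable]:
  "(\<lambda>x. grid_sum L x t) \<in> borel_measurable (PiM UNIV (\<lambda>_. borel))"
  unfolding grid_sum_def by measurable

lemma sum_pairs: "(\<Sum>i<2 * k. f i) = (\<Sum>i<k. f (2 * i) + f (Suc (2 * i)))" for f :: "nat \<Rightarrow> real"
  by (induction k) (auto simp: algebra_simps)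

text \<open>Adding up neighbouring pairs of the noise of one level gives the noise of the next coarser level, so the
  partial sums at different resolutions are consistent.\<close>

lemma grid_law_Suc:
  assumes J: "\<And>t. t \<in> J \<Longrightarrow> on_grid L t"
  shows "grid_law (Suc L) J = grid_law L J"
proof -
  have "grid_law L J = distr (distr (noise (Suc L)) (PiM UNIV (\<lambda>_. borel)) (\<lambda>x i. x (2 * i) + x (Suc (2 * i))))
      (PiM J (\<lambda>_. borel)) (\<lambda>x. \<lambda>t\<in>J. grid_sum L x t)"
    unfolding grid_law_def noise_halving ..
  also have "\<dots> = distr (noise (Suc L)) (PiM J (\<lambda>_. borel))
      (\<lambda>x. \<lambda>t\<in>J. grid_sum L (\<lambda>i. x (2 * i) + x (Suc (2 * i))) t)"
    by (subst distr_distr) (auto simp: o_def intro!: measurable_PiM_single')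
  also have "(\<lambda>x. \<lambda>t\<in>J. grid_sum L (\<lambda>i. x (2 * i) + x (Suc (2 * i))) t) = (\<lambda>x. \<lambda>t\<in>J. grid_sum (Suc L) x t)"
  proof (rule ext, rule restrict_ext)
    fix x :: "nat \<Rightarrow> real" and t assume "t \<in> J"
    then obtain k where k: "t = real k / 2^L" using J by (auto simp: on_grid_def)
    then have k2: "t = real (2 * k) / 2^(Suc L)" by simp
    have "grid_sum (Suc L) x t = (\<Sum>i<2 * k. x i)" unfolding k2 by (rule grid_sum_grid)
    moreover have "grid_sum L (\<lambda>i. x (2 * i) + x (Suc (2 * i))) t = (\<Sum>i<k. x (2 * i) + x (Suc (2 * i)))"
      unfolding k by (rule grid_sum_grid)
    ultimately show "grid_sum L (\<lambda>i. x (2 * i) + x (Suc (2 * i))) t = grid_sum (Suc L) x t"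
      by (simp only: sum_pairs)
  qed
  finally show ?thesis unfolding grid_law_def ..
qed

text \<open>The coarsest level resolving \<open>J\<close> is chosen only to have a definite value; by consistency every finer
  level gives the same law.\<close>

definition bm_fdd :: "real set \<Rightarrow> (real \<Rightarrow> real) measure" where
  "bm_fdd J = grid_law (LEAST L. \<forall>t\<in>J. on_grid L t) J"

lemma bm_fdd_eq:
  assumes "\<And>t. t \<in> J \<Longrightarrow> on_grid L t"
  shows "bm_fdd J = grid_law L J"
proof -
  let ?L = "LEAST L. \<forall>t\<in>J. on_grid L t"
  have 1: "\<forall>t\<in>J. on_grid ?L t" by (rule LeastI[of _ L]) (use assms in auto)
  have "?L \<le> L" by (rule Least_le) (use assms in auto)
  then have "grid_law L J = grid_law ?L J"
  proof (induction L rule: dec_induct)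
    case (step n)
    then show ?case using grid_law_Suc[of J n] on_grid_mono[of ?L n] 1 by auto
  qed simp
  then show ?thesis unfolding bm_fdd_def ..
qed

text \<open>Kolmogorov's extension theorem over the countable set of dyadic times.\<close>

interpretation bm: polish_projective dyadic_times bm_fdd
proof (intro polish_projective.intro projective_family.intro)
  fix J H :: "real set" assume JH: "J \<subseteq> H" and H: "finite H" "H \<subseteq> dyadic_times"
  obtain L where L: "\<And>t. t \<in> H \<Longrightarrow> on_grid L t" using finite_dyadic_times_on_grid[OF H] by blast
  have *: "distr (grid_law L H) (PiM J (\<lambda>_. borel)) (\<lambda>f. restrict f J) = grid_law L J"
    unfolding grid_law_def using JH
    by (subst distr_distr) (auto simp: o_def Int_absorb1 intro!: measurable_restrict_subset)
  show "bm_fdd J = distr (bm_fdd H) (PiM J (\<lambda>_. borel)) (\<lambda>f. restrict f J)"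
  proof -
    have eH: "bm_fdd H = grid_law L H" by (rule bm_fdd_eq) (rule L)
    have eJ: "bm_fdd J = grid_law L J" by (rule bm_fdd_eq) (erule L[OF subsetD[OF JH]])
    show ?thesis unfolding eH eJ by (rule *[symmetric])
  qed
next
  fix J :: "real set" assume J: "finite J" "J \<subseteq> dyadic_times"
  obtain L where L: "\<And>t. t \<in> J \<Longrightarrow> on_grid L t" using finite_dyadic_times_on_grid[OF J] by blast
  have eq: "bm_fdd J = grid_law L J" by (rule bm_fdd_eq) (rule L)
  show "prob_space (bm_fdd J)"
    unfolding eq grid_law_def
    by (intro prob_space.prob_space_distr prob_space_noise) measurable
qed

abbreviation "bm_lim \<equiv> bm.lim"

lemma sets_bm_lim [simp, measurable_cong]: "sets bm_lim = sets (PiM dyadic_times (\<lambda>_. borel))"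
  by (simp add: bm.sets_lim)

lemma prob_space_bm_lim: "prob_space bm_lim"
  by (rule bm.P.prob_space_axioms)

lemma bm_lim_distr:
  assumes J: "finite J" "\<And>t. t \<in> J \<Longrightarrow> on_grid L t" and \<phi>[measurable]: "\<phi> \<in> measurable (PiM J (\<lambda>_. borel)) N"
  shows "distr bm_lim N (\<lambda>x. \<phi> (restrict x J)) = distr (noise L) N (\<lambda>x. \<phi> (\<lambda>t\<in>J. grid_sum L x t))"
proof -
  have JI: "J \<subseteq> dyadic_times" using J by (auto simp: dyadic_times_def)
  have m: "(\<lambda>x. restrict x J) \<in> measurable bm_lim (PiM J (\<lambda>_. borel))"
    using measurable_restrict_subset[OF JI, of "\<lambda>_. borel :: real measure"]
      measurable_cong_sets[OF sets_bm_lim refl] by blast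
  have "distr bm_lim (PiM J (\<lambda>_. borel)) (\<lambda>x. restrict x J) = grid_law L J"
  proof (rule measure_eqI)
    fix A assume "A \<in> sets (distr bm_lim (PiM J (\<lambda>_. borel)) (\<lambda>x. restrict x J))"
    then have A: "A \<in> sets (PiM J (\<lambda>_. borel))" by simp
    have "emeasure (distr bm_lim (PiM J (\<lambda>_. borel)) (\<lambda>x. restrict x J)) A
        = emeasure bm_lim ((\<lambda>x. restrict x J) -` A \<inter> space bm_lim)"
      by (rule emeasure_distr[OF m A])
    also have "(\<lambda>x. restrict x J) -` A \<inter> space bm_lim = bm.emb dyadic_times J A"
      using sets_eq_imp_space_eq[OF sets_bm_lim] by (auto simp: prod_emb_def space_PiM)
    also have "emeasure bm_lim \<dots> = bm_fdd J A" by (rule bm.emeasure_lim_emb[OF JI J(1) A])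
    finally show "emeasure (distr bm_lim (PiM J (\<lambda>_. borel)) (\<lambda>x. restrict x J)) A = emeasure (grid_law L J) A"
      using bm_fdd_eq[of J L] J(2) by metis
  qed (simp add: grid_law_def)
  then have law: "distr bm_lim (PiM J (\<lambda>_. borel)) (\<lambda>x. restrict x J) = grid_law L J" .
  have "distr bm_lim N (\<lambda>x. \<phi> (restrict x J)) = distr (distr bm_lim (PiM J (\<lambda>_. borel)) (\<lambda>x. restrict x J)) N \<phi>"
    unfolding distr_distr[OF \<phi> m] o_def ..
  also have "\<dots> = distr (grid_law L J) N \<phi>" unfolding law ..
  also have "\<dots> = distr (noise L) N (\<lambda>x. \<phi> (\<lambda>t\<in>J. grid_sum L x t))"
  proof -
    have "(\<lambda>x. \<lambda>t\<in>J. grid_sum L x t) \<in> measurable (noise L) (PiM J (\<lambda>_. borel))" by measurable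
    then show ?thesis unfolding grid_law_def by (subst distr_distr[OF \<phi>]) (simp_all add: o_def)
  qed
  finally show ?thesis .
qed

lemma measurable_bm_component: "t \<in> dyadic_times \<Longrightarrow> (\<lambda>x. x t) \<in> borel_measurable bm_lim"
  by (subst measurable_cong_sets[OF sets_bm_lim refl]) (rule measurable_component_singleton)

lemma grid_dyadic_times [simp]: "real k / 2^L \<in> dyadic_times"
  by (auto simp: dyadic_times_def on_grid_def)

lemma bm_increments:
  fixes a b :: "nat \<Rightarrow> nat" and n L :: nat
  assumes ab: "\<And>i. i < n \<Longrightarrow> a i \<le> b i" and disj: "disjoint_family_on (\<lambda>i. {a i..<b i}) {..<n}"
  defines "D \<equiv> \<lambda>i x. x (real (b i) / 2^L) - x (real (a i) / 2^L) :: real"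
  shows "prob_space.indep_vars bm_lim (\<lambda>_. borel) D {..<n}"
    and "\<And>i. i < n \<Longrightarrow> distr bm_lim borel (D i) = centered_normal (real (b i - a i) / 2^L)"
proof -
  interpret N: prob_space "noise L" by (rule prob_space_noise)
  define S where "S i x = (\<Sum>k\<in>{a i..<b i}. x k)" for i and x :: "nat \<Rightarrow> real"
  define J where "J = (\<Union>i<n. {real (b i) / 2^L, real (a i) / 2^L})"
  have J: "finite J" "\<And>t. t \<in> J \<Longrightarrow> on_grid L t" by (auto simp: J_def on_grid_def)
  have Jm[simp]: "real (b i) / 2^L \<in> J" "real (a i) / 2^L \<in> J" if "i < n" for i
    using that by (auto simp: J_def)
  have DS: "D i (restrict (grid_sum L x) J) = S i x" if "i < n" for i x
  proof -
    have "{..<b i} = {..<a i} \<union> {a i..<b i}" "{..<a i} \<inter> {a i..<b i} = {}" using ab[OF that] by auto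
    then have "(\<Sum>k<b i. x k) = (\<Sum>k<a i. x k) + S i x"
      unfolding S_def by (metis finite_atLeastLessThan finite_lessThan sum.union_disjoint)
    then show ?thesis using that by (simp add: D_def grid_sum_grid)
  qed
  have Dr: "D i (restrict x J) = D i x" if "i < n" for i x using that by (simp add: D_def)
  have DS': "D i (grid_sum L x) = S i x" if "i < n" for i x using DS[OF that] Dr[OF that] by simp
  have Dm: "D i \<in> borel_measurable (PiM J (\<lambda>_. borel))" if "i < n" for i
    unfolding D_def by (intro borel_measurable_diff measurable_component_singleton Jm that)
  have [measurable]: "D i \<in> borel_measurable bm_lim" for i
    unfolding D_def by (intro borel_measurable_diff measurable_bm_component grid_dyadic_times)
  have [measurable]: "S i \<in> borel_measurable (noise L)" for i unfolding S_def by measurable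
  have one: "distr bm_lim borel (D i) = distr (noise L) borel (S i)" if "i < n" for i
    using bm_lim_distr[OF J Dm[OF that]] by (simp add: Dr[OF that] DS'[OF that])
  show law: "distr bm_lim borel (D i) = centered_normal (real (b i - a i) / 2^L)" if "i < n" for i
    unfolding one[OF that] S_def using noise_block[of "{a i..<b i}" L] by simp
  show "bm.P.indep_vars (\<lambda>_. borel) D {..<n}"
  proof (cases "n = 0")
    case True then show ?thesis by (simp add: bm.P.indep_vars_def bm.P.indep_sets_def)
  next
    case False
    have indS: "N.indep_vars (\<lambda>_. borel) S {..<n}"
      unfolding S_def by (rule N.indep_vars_sum_blocks[OF noise_indep _ disj]) simp
    have joint: "distr bm_lim (PiM {..<n} (\<lambda>_. borel)) (\<lambda>x. \<lambda>i\<in>{..<n}. D i x)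
        = distr (noise L) (PiM {..<n} (\<lambda>_. borel)) (\<lambda>x. \<lambda>i\<in>{..<n}. S i x)"
    proof -
      have "distr bm_lim (PiM {..<n} (\<lambda>_. borel)) (\<lambda>x. (\<lambda>y. \<lambda>i\<in>{..<n}. D i y) (restrict x J))
        = distr (noise L) (PiM {..<n} (\<lambda>_. borel)) (\<lambda>x. (\<lambda>y. \<lambda>i\<in>{..<n}. D i y) (\<lambda>t\<in>J. grid_sum L x t))"
        by (rule bm_lim_distr[OF J]) (assumption, rule measurable_restrict, rule Dm, simp)
      then show ?thesis by (simp add: Dr DS' cong: restrict_cong)
    qed
    also have "\<dots> = PiM {..<n} (\<lambda>i. distr (noise L) borel (S i))"
      by (rule N.indep_vars_iff_distr_eq_PiM[THEN iffD1, OF _ _ indS]) (use False in auto)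
    also have "\<dots> = PiM {..<n} (\<lambda>i. distr bm_lim borel (D i))"
      by (rule PiM_cong) (auto simp: one)
    finally show ?thesis
      by (intro bm.P.indep_vars_iff_distr_eq_PiM[THEN iffD2]) (use False in auto)
  qed
qed

lemma Cauchy_summable_dist:
  fixes X :: "nat \<Rightarrow> 'a::metric_space"
  assumes "summable (\<lambda>n. dist (X n) (X (Suc n)))"
  shows "Cauchy X"
  unfolding Cauchy_altdef
proof (intro allI impI)
  fix e :: real assume "e > 0"
  then obtain N where N: "\<And>m n. m \<ge> N \<Longrightarrow> norm (\<Sum>i=m..<n. dist (X i) (X (Suc i))) < e"
    using assms unfolding summable_Cauchy by blast
  have le: "dist (X m) (X n) \<le> (\<Sum>i=m..<n. dist (X i) (X (Suc i)))" if "m \<le> n" for m n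
    using that
  proof (induction n rule: dec_induct)
    case (step n)
    then show ?case using dist_triangle[of "X m" "X (Suc n)" "X n"] by simp
  qed simp
  have "dist (X m) (X n) < e" if "m \<ge> N" "n > m" for m n
  proof -
    have "dist (X m) (X n) \<le> norm (\<Sum>i=m..<n. dist (X i) (X (Suc i)))"
      using le[of m n] that(2) by (simp add: sum_nonneg)
    then show ?thesis using N[OF that(1), of n] by simp
  qed
  then show "\<exists>M. \<forall>m\<ge>M. \<forall>n>m. dist (X m) (X n) < e" by blast
qed

definition dyadic_floor :: "nat \<Rightarrow> real \<Rightarrow> nat" where
  "dyadic_floor m s = nat \<lfloor>2^m * s\<rfloor>"

lemma dyadic_floor_tendsto:
  assumes "0 \<le> s"
  shows "(\<lambda>m. real (dyadic_floor m s) / 2^m) \<longlonglongrightarrow> s"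
proof (rule tendsto_sandwich)
  have b: "real (dyadic_floor m s) \<le> 2^m * s" "2^m * s - 1 \<le> real (dyadic_floor m s)" for m
    unfolding dyadic_floor_def using assms by (simp, linarith)
  show "\<forall>\<^sub>F m in sequentially. real (dyadic_floor m s) / 2^m \<le> s"
    using b(1) by (intro always_eventually allI) (simp add: pos_divide_le_eq mult.commute)
  have "s - (1/2)^m \<le> real (dyadic_floor m s) / 2^m" for m
    using divide_right_mono[OF b(2)[of m], of "2^m"]
    by (simp add: diff_divide_distrib power_one_over)
  then show "\<forall>\<^sub>F m in sequentially. s - (1/2)^m \<le> real (dyadic_floor m s) / 2^m" by simp
  show "(\<lambda>m. s - (1/2)^m) \<longlonglongrightarrow> s"
    using tendsto_diff[OF tendsto_const LIMSEQ_power_zero[of "1/2::real"], of s] by simp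
qed simp

lemma path_at_tendsto_time:
  assumes "\<tau> \<longlonglongrightarrow> s" "0 \<le> s" "\<And>m. 0 \<le> \<tau> m"
  shows "(\<lambda>m. path_at f (\<tau> m)) \<longlonglongrightarrow> path_at f s"
  by (rule continuous_on_tendsto_compose[OF continuous_on_path_at assms(1)]) (use assms in auto)

text \<open>Subtracting the value at \<open>0\<close> makes every path, not only almost every path, start at \<open>0\<close>, and leaves
  the increments unchanged.\<close>

definition bm_approx :: "nat \<Rightarrow> (real \<Rightarrow> real) \<Rightarrow> real cpath" where
  "bm_approx j x = polygon (2^j) (\<lambda>k. x (real k / 2^j) - x 0)"

lemma bm_approx_grid:
  assumes "on_grid L t" "L \<le> j"
  shows "path_at (bm_approx j x) t = x t - x 0"
proof -
  obtain k :: nat where k: "t = real k / 2^j"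
    using on_grid_mono[OF assms(2,1)] by (auto simp: on_grid_def)
  then have "polyval (2^j) (\<lambda>k. x (real k / 2^j) - x 0) t = x (real k / 2^j) - x 0"
    by (intro polyval_grid) auto
  then show ?thesis unfolding bm_approx_def using k by (simp add: path_at_polygon)
qed

lemma zero_dyadic [simp]: "0 \<in> dyadic_times"
  using grid_dyadic_times[of 0 0] by simp

lemma measurable_bm_approx [measurable]: "bm_approx j \<in> borel_measurable bm_lim"
  unfolding bm_approx_def by (rule measurable_polygon) (auto intro!: borel_measurable_diff measurable_bm_component)

lemma dyadic_interp_bm_approx:
  assumes "i \<le> j"
  shows "dyadic_interp i (bm_approx j x) = bm_approx i x"
proof -
  have "path_at (bm_approx j x) (real k / 2^i) = x (real k / 2^i) - x 0" for k
    by (rule bm_approx_grid[OF _ assms]) (auto simp: on_grid_def)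
  then show ?thesis unfolding dyadic_interp_def bm_approx_def[of i] by simp
qed

lemma bm_approx_step:
  "(\<integral>x. dist (bm_approx i x) (bm_approx (Suc i) x) \<partial>bm_lim) \<le> chain_bound 3 i"
proof -
  have incr: "dyadic_incr (Suc i) k (bm_approx (Suc i) x) ^ 4
      = (x (real (Suc k) / 2^(Suc i)) - x (real k / 2^(Suc i))) ^ 4" for k x
  proof -
    have "path_at (bm_approx (Suc i) x) (real k / 2^(Suc i)) = x (real k / 2^(Suc i)) - x 0" for k
      by (rule bm_approx_grid[OF _ order_refl]) (auto simp: on_grid_def)
    then show ?thesis unfolding dyadic_incr_def by (simp only:) simp
  qed
  have law: "distr bm_lim borel (\<lambda>x. x (real (Suc k) / 2^(Suc i)) - x (real k / 2^(Suc i)))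
      = centered_normal (1 / 2^(Suc i))" for k
    using bm_increments(2)[of 1 "\<lambda>_. k" "\<lambda>_. Suc k" 0 "Suc i"] by (simp add: disjoint_family_on_def)
  have meas: "(\<lambda>x. x (real (Suc k) / 2^(Suc i)) - x (real k / 2^(Suc i))) \<in> borel_measurable bm_lim" for k
    by (intro borel_measurable_diff measurable_bm_component grid_dyadic_times)
  have four: "3 * (1 / 2^(Suc i))\<^sup>2 = 3 / (4::real)^(Suc i)"
    by (simp add: power_divide power_mult_distrib power2_eq_square flip: power_mult_distrib)
  have "bm.P.expectation (\<lambda>x. dist (dyadic_interp i (bm_approx (Suc i) x)) (dyadic_interp (Suc i) (bm_approx (Suc i) x)))
      \<le> chain_bound 3 i"
  proof (rule bm.P.expectation_dyadic_step)
    fix k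
    show "integrable bm_lim (\<lambda>x. dyadic_incr (Suc i) k (bm_approx (Suc i) x) ^ 4)"
      unfolding incr
      by (rule integrable_distr[OF meas[of k], where f = "\<lambda>y. y^4", unfolded law])
         (rule centered_normal_moment4(1), simp)
    have "bm.P.expectation (\<lambda>x. dyadic_incr (Suc i) k (bm_approx (Suc i) x) ^ 4)
        = (\<integral>y. y^4 \<partial>centered_normal (1 / 2^(Suc i)))"
      unfolding incr law[of k, symmetric] by (subst integral_distr[OF meas]) auto
    also have "\<dots> = 3 / 4^(Suc i)"
      unfolding four[symmetric] by (rule centered_normal_moment4(2)) simp
    finally show "bm.P.expectation (\<lambda>x. dyadic_incr (Suc i) k (bm_approx (Suc i) x) ^ 4) \<le> 3 / 4^(Suc i)" by simp
  qed auto
  then show ?thesis by (simp add: dyadic_interp_bm_approx)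
qed

text \<open>Consecutive approximations have summable expected distances, so almost surely the distances
  themselves are summable.\<close>

lemma bm_approx_Cauchy: "AE x in bm_lim. Cauchy (\<lambda>j. bm_approx j x)"
proof -
  let ?d = "\<lambda>i x. dist (bm_approx i x) (bm_approx (Suc i) x)"
  have int: "integrable bm_lim (?d i)" for i by (rule bm.P.integrable_dist_cpath) auto
  have "(\<integral>\<^sup>+x. (\<Sum>i. ennreal (?d i x)) \<partial>bm_lim) = (\<Sum>i. \<integral>\<^sup>+x. ennreal (?d i x) \<partial>bm_lim)"
    by (rule nn_integral_suminf) measurable
  also have "\<dots> \<le> (\<Sum>i. ennreal (chain_bound 3 i))"
    using bm_approx_step by (intro suminf_le) (auto simp: nn_integral_eq_integral int intro!: ennreal_leI)
  also have "\<dots> = ennreal (\<Sum>i. chain_bound 3 i)"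
    by (rule suminf_ennreal2) (auto simp: chain_bound_nonneg summable_chain_bound)
  also have "\<dots> < \<infinity>" by simp
  finally have "(\<integral>\<^sup>+x. (\<Sum>i. ennreal (?d i x)) \<partial>bm_lim) \<noteq> \<infinity>" by simp
  then have "AE x in bm_lim. (\<Sum>i. ennreal (?d i x)) \<noteq> \<infinity>"
    by (intro nn_integral_noteq_infinite) measurable
  then show ?thesis
    by eventually_elim (auto intro!: Cauchy_summable_dist summable_suminf_not_top)
qed

text \<open>Increments over dyadic intervals are independent and normal by construction; both properties pass
  to arbitrary times by continuity of the paths.\<close>

theorem real_bm_exists: "\<exists>(N :: (real \<Rightarrow> real) measure) B. real_bm N B"
proof -
  define A where "A j x = (if Cauchy (\<lambda>j. bm_approx j x) then bm_approx j x else polygon 1 (\<lambda>_. 0))" for j x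
  have [measurable]: "A j \<in> borel_measurable bm_lim" for j unfolding A_def by measurable
  define B where "B x = lim (\<lambda>j. A j x)" for x
  have lim: "(\<lambda>j. A j x) \<longlonglongrightarrow> B x" for x
  proof -
    have "convergent (\<lambda>j. A j x)"
      by (cases "Cauchy (\<lambda>j. bm_approx j x)") (simp_all add: A_def Cauchy_convergent convergent_const)
    then show ?thesis unfolding B_def by (simp add: convergent_LIMSEQ_iff)
  qed
  have [measurable]: "B \<in> borel_measurable bm_lim"
    by (rule borel_measurable_LIMSEQ_metric[OF _ lim]) measurable
  have start: "path_at (B x) 0 = 0" for x
  proof (rule LIMSEQ_unique[OF tendsto_path_at[OF lim order_refl]])
    have "path_at (A j x) 0 = 0" for j
      unfolding A_def using bm_approx_grid[of 0 0 j x]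
      by (auto simp: on_grid_def path_at_polygon polyval_def)
    then show "(\<lambda>j. path_at (A j x) 0) \<longlonglongrightarrow> 0" by simp
  qed
  have dyadic: "AE x in bm_lim. \<forall>L. \<forall>k::nat. path_at (B x) (real k / 2^L) = x (real k / 2^L) - x 0"
    using bm_approx_Cauchy
  proof eventually_elim
    case (elim x)
    show ?case
    proof (intro allI)
      fix L and k :: nat
      have "path_at (A j x) (real k / 2^L) = x (real k / 2^L) - x 0" if "L \<le> j" for j
        using bm_approx_grid[OF _ that, of "real k / 2^L" x] elim by (auto simp: A_def on_grid_def)
      then have "(\<lambda>j. path_at (A j x) (real k / 2^L)) \<longlonglongrightarrow> x (real k / 2^L) - x 0"
        by (intro tendsto_eventually eventually_sequentiallyI[of L])
      then show "path_at (B x) (real k / 2^L) = x (real k / 2^L) - x 0"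
        by (intro LIMSEQ_unique[OF tendsto_path_at[OF lim]]) auto
    qed
  qed
  define Y where "Y m s t x = x (real (dyadic_floor m t) / 2^m) - x (real (dyadic_floor m s) / 2^m)"
    for m s t and x :: "real \<Rightarrow> real"
  have Ym[measurable]: "Y m s t \<in> borel_measurable bm_lim" for m s t
    unfolding Y_def by (intro borel_measurable_diff measurable_bm_component grid_dyadic_times)
  have Ylim: "AE x in bm_lim. (\<lambda>m. Y m s t x) \<longlonglongrightarrow> path_at (B x) t - path_at (B x) s"
    if "0 \<le> s" "0 \<le> t" for s t
    using dyadic
  proof eventually_elim
    case (elim x)
    have "Y m s t x = path_at (B x) (real (dyadic_floor m t) / 2^m) - path_at (B x) (real (dyadic_floor m s) / 2^m)" for m
      using elim by (simp add: Y_def)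
    then show ?case
      using that by (simp only:) (intro tendsto_diff path_at_tendsto_time dyadic_floor_tendsto, auto)
  qed
  have mono: "dyadic_floor m s \<le> dyadic_floor m t" if "s \<le> t" for m s t
    unfolding dyadic_floor_def using that by (intro nat_mono floor_mono) simp
  have incr: "distr bm_lim borel (\<lambda>x. path_at (B x) t - path_at (B x) s) = centered_normal (t - s)"
    if st: "0 \<le> s" "s < t" for s t
  proof (rule bm.P.distr_limit_centered_normal[OF Ym])
    have "disjoint_family_on (\<lambda>i. {dyadic_floor m s..<dyadic_floor m t}) {..<1::nat}" for m
      by (auto simp: disjoint_family_on_def)
    then show "distr bm_lim borel (Y m s t)
        = centered_normal (real (dyadic_floor m t - dyadic_floor m s) / 2^m)" for m
      using bm_increments(2)[of 1 "\<lambda>_. dyadic_floor m s" "\<lambda>_. dyadic_floor m t" 0 m] mono[of s t m] st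
      by (simp add: Y_def[abs_def])
    have eq: "real (dyadic_floor m t - dyadic_floor m s) / 2^m
        = real (dyadic_floor m t) / 2^m - real (dyadic_floor m s) / 2^m" for m
      using mono[of s t m] st by (simp add: of_nat_diff diff_divide_distrib)
    show "(\<lambda>m. real (dyadic_floor m t - dyadic_floor m s) / 2^m) \<longlonglongrightarrow> t - s"
      unfolding eq by (intro tendsto_diff dyadic_floor_tendsto) (use st in auto)
  qed (use st in \<open>auto intro: Ylim\<close>)
  have ind: "bm.P.indep_vars (\<lambda>_. borel) (\<lambda>i x. path_at (B x) (t (Suc i)) - path_at (B x) (t i)) {..<n}"
    if t: "0 \<le> t 0" "strict_mono t" for t :: "nat \<Rightarrow> real" and n
  proof (cases "n = 0")
    case True then show ?thesis by (simp add: bm.P.indep_vars_def bm.P.indep_sets_def)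
  next
    case False
    have tpos: "0 \<le> t i" for i using t strict_mono_less_eq[OF t(2), of 0 i] by simp
    show ?thesis
    proof (rule bm.P.indep_vars_limit)
      fix m
      have tm: "dyadic_floor m (t i) \<le> dyadic_floor m (t j)" if "i \<le> j" for i j
        using that t(2) by (intro mono) (simp add: strict_mono_less_eq)
      have "disjoint_family_on (\<lambda>i. {dyadic_floor m (t i)..<dyadic_floor m (t (Suc i))}) {..<n}"
        unfolding disjoint_family_on_def
      proof (intro ballI impI)
        fix i j :: nat assume "i \<noteq> j"
        then consider "Suc i \<le> j" | "Suc j \<le> i" by linarith
        then show "{dyadic_floor m (t i)..<dyadic_floor m (t (Suc i))} \<inter>
            {dyadic_floor m (t j)..<dyadic_floor m (t (Suc j))} = {}"
          using tm[of "Suc i" j] tm[of "Suc j" i] by cases auto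
      qed
      then show "bm.P.indep_vars (\<lambda>_. borel) (\<lambda>i. Y m (t i) (t (Suc i))) {..<n}"
        using bm_increments(1)[of n "\<lambda>i. dyadic_floor m (t i)" "\<lambda>i. dyadic_floor m (t (Suc i))" m] tm
        by (simp add: Y_def[abs_def])
    next
      fix i show "AE x in bm_lim. (\<lambda>m. Y m (t i) (t (Suc i)) x)
          \<longlonglongrightarrow> path_at (B x) (t (Suc i)) - path_at (B x) (t i)"
        by (rule Ylim) (auto simp: tpos)
      show "(\<lambda>x. path_at (B x) (t (Suc i)) - path_at (B x) (t i)) \<in> borel_measurable bm_lim"
        using tpos by measurable
    qed (use False in auto)
  qed
  have "real_bm bm_lim B"
    unfolding real_bm_def using prob_space_bm_lim start ind incr by auto
  then show ?thesis by blast
qed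

section \<open>Sums of independent variables\<close>

context prob_space
begin

lemma expectation_mult_power_indep:
  fixes X Y :: "'a \<Rightarrow> real"
  assumes ind: "indep_var borel X borel Y"
    and int: "integrable M (\<lambda>x. X x ^ a)" "integrable M (\<lambda>x. Y x ^ b)"
  shows "integrable M (\<lambda>x. X x ^ a * Y x ^ b)"
    and "expectation (\<lambda>x. X x ^ a * Y x ^ b) = expectation (\<lambda>x. X x ^ a) * expectation (\<lambda>x. Y x ^ b)"
proof -
  have "indep_var borel ((\<lambda>y. y^a) \<circ> X) borel ((\<lambda>y. y^b) \<circ> Y)"
    by (rule indep_var_compose[OF ind]) auto
  then have "indep_var borel (\<lambda>x. X x ^ a) borel (\<lambda>x. Y x ^ b)" by (simp add: o_def)
  from indep_var_integrable[OF this int] indep_var_lebesgue_integral[OF this int]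
  show "integrable M (\<lambda>x. X x ^ a * Y x ^ b)"
    "expectation (\<lambda>x. X x ^ a * Y x ^ b) = expectation (\<lambda>x. X x ^ a) * expectation (\<lambda>x. Y x ^ b)" by auto
qed

lemma integrable_power_bounded:
  fixes X :: "'a \<Rightarrow> real"
  assumes [measurable]: "X \<in> borel_measurable M" and b: "\<And>x. x \<in> space M \<Longrightarrow> \<bar>X x\<bar> \<le> B"
  shows "integrable M (\<lambda>x. X x ^ k)"
  by (rule integrable_const_bound[of _ "B ^ k"])
     (auto simp: power_abs intro!: AE_I2 power_mono b)

text \<open>In the expansion of the fourth power of a sum with one more summand, the terms of odd degree in
  the new summand vanish, because either it or the old sum enters linearly and has mean zero.\<close>

lemma sum_indep_moments:
  fixes Y :: "'i \<Rightarrow> 'a \<Rightarrow> real"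
  assumes "finite A" "indep_vars (\<lambda>_. borel) Y A"
    and mean: "\<And>i. i \<in> A \<Longrightarrow> expectation (Y i) = 0"
    and bound: "\<And>i x. i \<in> A \<Longrightarrow> x \<in> space M \<Longrightarrow> \<bar>Y i x\<bar> \<le> B"
  shows "expectation (\<lambda>x. (\<Sum>i\<in>A. Y i x) ^ 4) \<le> 3 * B^4 * (real (card A))\<^sup>2"
    and "expectation (\<lambda>x. (\<Sum>i\<in>A. Y i x) ^ 2) \<le> B^2 * real (card A)"
    and "expectation (\<lambda>x. \<Sum>i\<in>A. Y i x) = 0"
proof -
  have "expectation (\<lambda>x. (\<Sum>i\<in>A. Y i x) ^ 4) \<le> 3 * B^4 * (real (card A))\<^sup>2
    \<and> expectation (\<lambda>x. (\<Sum>i\<in>A. Y i x) ^ 2) \<le> B^2 * real (card A) \<and> expectation (\<lambda>x. \<Sum>i\<in>A. Y i x) = 0"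
    using assms
  proof (induction A rule: finite_induct)
    case (insert i A)
    let ?S = "\<lambda>x. \<Sum>i\<in>A. Y i x"
    have ind: "indep_var borel (Y i) borel ?S"
      by (rule indep_vars_sum[OF insert(1,2) insert(4)])
    have Ym[measurable]: "Y k \<in> borel_measurable M" if "k \<in> insert i A" for k
      using insert(4) that by (auto simp: indep_vars_def2)
    have Sm[measurable]: "?S \<in> borel_measurable M" by (rule borel_measurable_sum) auto
    have IH: "expectation (\<lambda>x. ?S x ^ 4) \<le> 3 * B^4 * (real (card A))\<^sup>2"
      "expectation (\<lambda>x. ?S x ^ 2) \<le> B^2 * real (card A)" "expectation ?S = 0"
      using insert.IH[OF indep_vars_subset[OF insert(4)]] insert(5,6) by auto
    have Yb: "\<bar>Y i x\<bar> \<le> B" if "x \<in> space M" for x using insert(6) that by auto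
    have Sb: "\<bar>?S x\<bar> \<le> real (card A) * B" if "x \<in> space M" for x
    proof -
      have "\<bar>?S x\<bar> \<le> (\<Sum>i\<in>A. \<bar>Y i x\<bar>)" by (rule sum_abs)
      also have "\<dots> \<le> real (card A) * B" by (rule sum_bounded_above) (use insert(6) that in auto)
      finally show ?thesis .
    qed
    have Yi: "integrable M (\<lambda>x. Y i x ^ k)" for k by (rule integrable_power_bounded[OF _ Yb]) auto
    have Si: "integrable M (\<lambda>x. ?S x ^ k)" for k by (rule integrable_power_bounded[OF Sm Sb])
    note YS = expectation_mult_power_indep[OF ind Yi Si]
    have Y0: "expectation (Y i) = 0" using insert(5) by simp
    have Ybd: "expectation (\<lambda>x. Y i x ^ k) \<le> B ^ k" if "even k" for k
    proof -
      have "expectation (\<lambda>x. Y i x ^ k) \<le> expectation (\<lambda>x. B ^ k)"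
      proof (rule integral_mono[OF Yi])
        show "Y i x ^ k \<le> B ^ k" if "x \<in> space M" for x
          using power_mono[OF Yb[OF that], of k] \<open>even k\<close> by (simp add: power_even_abs)
      qed simp
      then show ?thesis by (simp add: prob_space)
    qed
    have B0: "0 \<le> B"
      using not_empty Yb abs_ge_zero order_trans by blast
    have exp4: "expectation (\<lambda>x. (Y i x + ?S x) ^ 4)
        = expectation (\<lambda>x. Y i x ^ 4) + 6 * (expectation (\<lambda>x. Y i x ^ 2) * expectation (\<lambda>x. ?S x ^ 2))
          + expectation (\<lambda>x. ?S x ^ 4)"
    proof -
      have "expectation (\<lambda>x. (Y i x + ?S x) ^ 4) = expectation (\<lambda>x. Y i x ^ 4 * ?S x ^ 0 + 4 * (Y i x ^ 3 * ?S x ^ 1)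
          + 6 * (Y i x ^ 2 * ?S x ^ 2) + 4 * (Y i x ^ 1 * ?S x ^ 3) + Y i x ^ 0 * ?S x ^ 4)"
        by (intro Bochner_Integration.integral_cong) (auto simp: power_numeral_reduce algebra_simps)
      also have "\<dots> = expectation (\<lambda>x. Y i x ^ 4 * ?S x ^ 0) + 4 * expectation (\<lambda>x. Y i x ^ 3 * ?S x ^ 1)
          + 6 * expectation (\<lambda>x. Y i x ^ 2 * ?S x ^ 2) + 4 * expectation (\<lambda>x. Y i x ^ 1 * ?S x ^ 3)
          + expectation (\<lambda>x. Y i x ^ 0 * ?S x ^ 4)"
        by (simp only: Bochner_Integration.integral_add Bochner_Integration.integrable_add
            integrable_mult_right integral_mult_right_zero YS(1))
      also have "\<dots> = expectation (\<lambda>x. Y i x ^ 4) + 6 * (expectation (\<lambda>x. Y i x ^ 2) * expectation (\<lambda>x. ?S x ^ 2))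
          + expectation (\<lambda>x. ?S x ^ 4)"
        unfolding YS(2) by (simp add: Y0 IH(3) prob_space)
      finally show ?thesis .
    qed
    have exp2: "expectation (\<lambda>x. (Y i x + ?S x) ^ 2)
        = expectation (\<lambda>x. Y i x ^ 2) + expectation (\<lambda>x. ?S x ^ 2)"
    proof -
      have "expectation (\<lambda>x. (Y i x + ?S x) ^ 2)
          = expectation (\<lambda>x. Y i x ^ 2 * ?S x ^ 0 + 2 * (Y i x ^ 1 * ?S x ^ 1) + Y i x ^ 0 * ?S x ^ 2)"
        by (intro Bochner_Integration.integral_cong) (auto simp: power2_eq_square algebra_simps)
      also have "\<dots> = expectation (\<lambda>x. Y i x ^ 2 * ?S x ^ 0) + 2 * expectation (\<lambda>x. Y i x ^ 1 * ?S x ^ 1)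
          + expectation (\<lambda>x. Y i x ^ 0 * ?S x ^ 2)"
        by (simp only: Bochner_Integration.integral_add Bochner_Integration.integrable_add
            integrable_mult_right integral_mult_right_zero YS(1))
      also have "\<dots> = expectation (\<lambda>x. Y i x ^ 2) + expectation (\<lambda>x. ?S x ^ 2)"
        unfolding YS(2) by (simp add: Y0 prob_space)
      finally show ?thesis .
    qed
    have exp1: "expectation (\<lambda>x. Y i x + ?S x) = 0"
      using Yi[of 1] Si[of 1] by (simp add: Y0 IH(3))
    have "expectation (\<lambda>x. (Y i x + ?S x) ^ 4)
        \<le> B^4 + 6 * (B^2 * (B^2 * real (card A))) + 3 * B^4 * (real (card A))\<^sup>2"
      unfolding exp4 using Ybd[of 4] Ybd[of 2] IH B0
      by (intro add_mono mult_left_mono mult_mono) (auto intro!: Bochner_Integration.integral_nonneg)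
    also have "\<dots> = B^4 * (1 + 6 * real (card A) + 3 * (real (card A))\<^sup>2)"
      by (simp add: power_numeral_reduce algebra_simps)
    also have "\<dots> \<le> B^4 * (3 * (real (Suc (card A)))\<^sup>2)"
      using B0 by (intro mult_left_mono) (auto simp: power2_eq_square algebra_simps)
    finally have 4: "expectation (\<lambda>x. (Y i x + ?S x) ^ 4) \<le> 3 * B^4 * (real (Suc (card A)))\<^sup>2" by (simp add: mult_ac)
    have 2: "expectation (\<lambda>x. (Y i x + ?S x) ^ 2) \<le> B^2 * real (Suc (card A))"
      unfolding exp2 using Ybd[of 2] IH(2) by (simp add: algebra_simps)
    show ?case using 4 2 exp1 insert(1,2) by simp
  qed simp
  then show "expectation (\<lambda>x. (\<Sum>i\<in>A. Y i x) ^ 4) \<le> 3 * B^4 * (real (card A))\<^sup>2"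
    "expectation (\<lambda>x. (\<Sum>i\<in>A. Y i x) ^ 2) \<le> B^2 * real (card A)" "expectation (\<lambda>x. \<Sum>i\<in>A. Y i x) = 0" by auto
qed

lemma distr_sum_iid:
  fixes Y :: "'i \<Rightarrow> 'a \<Rightarrow> real"
  assumes ind: "indep_vars (\<lambda>_. borel) Y I" and law: "\<And>i. i \<in> I \<Longrightarrow> distr M borel (Y i) = \<mu>"
    and AB: "A \<subseteq> I" "B \<subseteq> I" "card A = card B"
  shows "distr M borel (\<lambda>x. \<Sum>i\<in>A. Y i x) = distr M borel (\<lambda>x. \<Sum>i\<in>B. Y i x)"
proof (rule Levy_uniqueness)
  have [measurable]: "Y k \<in> borel_measurable M" if "k \<in> I" for k
    using ind that by (auto simp: indep_vars_def2)
  show "real_distribution (distr M borel (\<lambda>x. \<Sum>i\<in>A. Y i x))" "real_distribution (distr M borel (\<lambda>x. \<Sum>i\<in>B. Y i x))"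
    using AB by (auto intro!: real_distribution_distr borel_measurable_sum)
  have "char (distr M borel (\<lambda>x. \<Sum>i\<in>K. Y i x)) t = char \<mu> t ^ card K" if "K \<subseteq> I" for K t
  proof -
    have "char (distr M borel (\<lambda>x. \<Sum>i\<in>K. Y i x)) t = (\<Prod>i\<in>K. char (distr M borel (Y i)) t)"
      by (rule char_distr_sum[OF indep_vars_subset[OF ind that]])
    also have "\<dots> = (\<Prod>i\<in>K. char \<mu> t)" by (intro prod.cong refl) (use law that in auto)
    finally show ?thesis by simp
  qed
  then show "char (distr M borel (\<lambda>x. \<Sum>i\<in>A. Y i x)) = char (distr M borel (\<lambda>x. \<Sum>i\<in>B. Y i x))"
    using AB by (intro ext) simp
qed

text \<open>The central limit theorem along a dyadic grid. On a product of Skorohod spaces the normalised block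
  sums converge pointwise, which upgrades the one-dimensional limit theorem to a limit theorem for all
  blocks simultaneously.\<close>

lemma grid_central_limit:
  fixes \<zeta> :: "nat \<Rightarrow> 'a \<Rightarrow> real" and g :: "(nat \<Rightarrow> real) \<Rightarrow> real" and j :: nat
  assumes ind: "indep_vars (\<lambda>_. borel) \<zeta> UNIV" and law: "\<And>i. distr M borel (\<zeta> i) = \<mu>"
    and mean: "\<And>i. expectation (\<zeta> i) = 0" and sq: "\<And>i. integrable M (\<lambda>x. (\<zeta> i x)\<^sup>2)"
    and var: "\<And>i. variance (\<zeta> i) = \<sigma>\<^sup>2" and \<sigma>: "\<sigma> > 0"
    and gm[measurable]: "g \<in> borel_measurable (PiM UNIV (\<lambda>_. borel))"
    and g: "\<And>a b. (\<And>k. (\<lambda>n. a n k) \<longlonglongrightarrow> b k) \<Longrightarrow> (\<lambda>n. g (a n)) \<longlonglongrightarrow> g b" "\<And>a. \<bar>g a\<bar> \<le> 1"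
  shows "(\<lambda>n. expectation (\<lambda>x. g (\<lambda>k. (\<Sum>i<nat \<lfloor>real n * (real k / 2^j)\<rfloor>. \<zeta> i x) / sqrt (real n))))
    \<longlonglongrightarrow> (\<integral>y. g (\<lambda>k. \<sigma> * (\<Sum>i<k. y i)) \<partial>noise j)"
proof -
  have \<zeta>m[measurable]: "\<zeta> i \<in> borel_measurable M" for i using ind by (auto simp: indep_vars_def2)
  define S where "S n x = (\<Sum>i<n. \<zeta> i x)" for n x
  have [measurable]: "S n \<in> borel_measurable M" for n unfolding S_def by measurable
  define b where "b n k = nat \<lfloor>real n * (real k / 2^j)\<rfloor>" for n k :: nat
  define q where "q n k = b n (Suc k) - b n k" for n k
  have b_mono: "b n k \<le> b n k'" if "k \<le> k'" for n k k'
    unfolding b_def using that by (intro nat_mono floor_mono mult_left_mono divide_right_mono) auto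
  have b0: "b n 0 = 0" for n by (simp add: b_def)
  have b_bounds: "real (b n k) \<le> real n * (real k / 2^j)" "real n * (real k / 2^j) - 1 \<le> real (b n k)" for n k
    unfolding b_def by (simp, linarith)
  have q_lim: "(\<lambda>n. real (q n k) / real n) \<longlonglongrightarrow> 1 / 2^j" for k
  proof -
    have bl: "(\<lambda>n. real (b n k) / real n) \<longlonglongrightarrow> real k / 2^j" for k
    proof (rule tendsto_sandwich)
      show "\<forall>\<^sub>F n in sequentially. real k / 2^j - 1 / real n \<le> real (b n k) / real n"
      proof (rule eventually_sequentiallyI[of 1])
        fix n :: nat assume "1 \<le> n"
        then show "real k / 2^j - 1 / real n \<le> real (b n k) / real n"
          using divide_right_mono[OF b_bounds(2)[of n k], of "real n"] by (simp add: diff_divide_distrib)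
      qed
      show "\<forall>\<^sub>F n in sequentially. real (b n k) / real n \<le> real k / 2^j"
      proof (rule eventually_sequentiallyI[of 1])
        fix n :: nat assume "1 \<le> n"
        then show "real (b n k) / real n \<le> real k / 2^j"
          using divide_right_mono[OF b_bounds(1)[of n k], of "real n"] by simp
      qed
      show "(\<lambda>n. real k / 2^j - 1 / real n) \<longlonglongrightarrow> real k / 2^j"
        using tendsto_diff[OF tendsto_const lim_1_over_n] by fastforce
    qed simp
    have "real (q n k) / real n = real (b n (Suc k)) / real n - real (b n k) / real n" for n
      unfolding q_def using b_mono[of k "Suc k" n] by (simp add: of_nat_diff diff_divide_distrib)
    then have "(\<lambda>n. real (q n k) / real n) \<longlonglongrightarrow> real (Suc k) / 2^j - real k / 2^j"
      by (simp only:) (intro tendsto_diff bl)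
    then show ?thesis by (simp add: diff_divide_distrib[symmetric])
  qed
  have q_inf: "filterlim (\<lambda>n. q n k) at_top sequentially" for k
  proof -
    have "filterlim (\<lambda>n. real n * (real (q n k) / real n)) at_top sequentially"
      by (rule filterlim_at_top_mult_tendsto_pos[OF q_lim]) (auto simp: filterlim_real_sequentially mult.commute)
    moreover have "real n * (real (q n k) / real n) = real (q n k)" for n
      by (cases "n = 0") (auto simp: q_def b_def)
    ultimately have "filterlim (\<lambda>n. real (q n k)) at_top sequentially" by simp
    then show ?thesis
      unfolding filterlim_at_top by (metis (mono_tags, lifting) eventually_mono of_nat_le_iff)
  qed
  define \<nu> where "\<nu> n = distr M borel (\<lambda>x. S n x / sqrt (real n * \<sigma>\<^sup>2))" for n
  have clt: "weak_conv_m \<nu> std_normal_distribution"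
    unfolding \<nu>_def S_def
    by (rule central_limit_theorem_zero_mean[OF ind mean \<sigma> sq var law])
  have "real_distribution (\<nu> n)" for n unfolding \<nu>_def by (rule real_distribution_distr) measurable
  from Skorohod[OF this real_dist_normal_dist clt]
  obtain \<Omega> :: "real measure" and V :: "nat \<Rightarrow> real \<Rightarrow> real" and V' :: "real \<Rightarrow> real"
    where \<Omega>: "prob_space \<Omega>" and V[measurable]: "\<And>n. V n \<in> borel_measurable \<Omega>"
      and Vlaw: "\<And>n. distr \<Omega> borel (V n) = \<nu> n" and V'm: "V' \<in> measurable \<Omega> lborel"
      and V'law: "distr \<Omega> borel V' = std_normal_distribution"
      and Vlim: "\<And>x. x \<in> space \<Omega> \<Longrightarrow> (\<lambda>n. V n x) \<longlonglongrightarrow> V' x" by blast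
  have [measurable]: "V' \<in> borel_measurable \<Omega>" using V'm by simp
  interpret \<Omega>: prob_space \<Omega> by fact
  define P where "P = PiM (UNIV :: nat set) (\<lambda>_. \<Omega>)"
  interpret P: prob_space P unfolding P_def by (rule prob_space_PiM) (rule \<Omega>)
  have comp: "distr P \<Omega> (\<lambda>w. w k) = \<Omega>" for k
    unfolding P_def by (rule distr_PiM_component) (auto intro: \<Omega>)
  have compm[measurable]: "(\<lambda>w. w k) \<in> measurable P \<Omega>" for k unfolding P_def by measurable
  have indP: "P.indep_vars (\<lambda>_. \<Omega>) (\<lambda>k w. w k) UNIV"
  proof (rule P.indep_vars_iff_distr_eq_PiM[THEN iffD2])
    have "distr P (PiM UNIV (\<lambda>_. \<Omega>)) (\<lambda>w. w) = P" by (rule distr_id2) (simp add: P_def)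
    then show "distr P (PiM UNIV (\<lambda>_. \<Omega>)) (\<lambda>w. \<lambda>k\<in>UNIV. w k) = PiM UNIV (\<lambda>k. distr P \<Omega> (\<lambda>w. w k))"
      by (simp only: comp restrict_UNIV) (simp add: P_def)
  qed auto
  have prodP: "distr P (PiM UNIV (\<lambda>_. borel)) (\<lambda>w k. h k (w k)) = PiM UNIV (\<lambda>k. distr \<Omega> borel (h k))"
    if h[measurable]: "\<And>k. h k \<in> borel_measurable \<Omega>" for h :: "nat \<Rightarrow> real \<Rightarrow> real"
  proof -
    have "P.indep_vars (\<lambda>_. borel) (\<lambda>k w. h k (w k)) UNIV"
      by (rule P.indep_vars_compose2[OF indP]) measurable
    then have "distr P (PiM UNIV (\<lambda>_. borel)) (\<lambda>w. \<lambda>k\<in>UNIV. h k (w k))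
        = PiM UNIV (\<lambda>k. distr P borel (\<lambda>w. h k (w k)))"
      by (intro P.indep_vars_iff_distr_eq_PiM[THEN iffD1]) auto
    moreover have "distr P borel (\<lambda>w. h k (w k)) = distr \<Omega> borel (h k)" for k
      using distr_distr[OF h compm, of k k] by (simp add: comp o_def)
    ultimately show ?thesis by (simp add: restrict_UNIV)
  qed
  define c where "c n k = sqrt (real (q n k)) / sqrt (real n) * \<sigma>" for n k
  define T where "T n k x = (\<Sum>i\<in>{b n k..<b n (Suc k)}. \<zeta> i x) / sqrt (real n)" for n k x
  have [measurable]: "T n k \<in> borel_measurable M" for n k unfolding T_def by measurable
  have Tlaw: "distr M borel (T n k) = distr \<Omega> borel (\<lambda>w. c n k * V (q n k) w)" for n k
  proof -
    have "distr M borel (\<lambda>x. \<Sum>i\<in>{b n k..<b n (Suc k)}. \<zeta> i x) = distr M borel (S (q n k))"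
      unfolding S_def by (rule distr_sum_iid[OF ind law]) (auto simp: q_def)
    then have "distr (distr M borel (\<lambda>x. \<Sum>i\<in>{b n k..<b n (Suc k)}. \<zeta> i x)) borel (\<lambda>y. y / sqrt (real n))
        = distr (distr M borel (S (q n k))) borel (\<lambda>y. y / sqrt (real n))" by simp
    then have "distr M borel (T n k) = distr M borel (\<lambda>x. S (q n k) x / sqrt (real n))"
      by (subst (asm) (1 2) distr_distr) (auto simp: o_def T_def[abs_def])
    also have "(\<lambda>x. S (q n k) x / sqrt (real n)) = (\<lambda>x. c n k * (S (q n k) x / sqrt (real (q n k) * \<sigma>\<^sup>2)))"
      using \<sigma> by (cases "q n k = 0") (auto simp: c_def S_def real_sqrt_mult fun_eq_iff)
    also have "distr M borel \<dots> = distr (\<nu> (q n k)) borel (\<lambda>y. c n k * y)"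
      unfolding \<nu>_def by (subst distr_distr) (auto simp: o_def)
    also have "\<dots> = distr \<Omega> borel (\<lambda>w. c n k * V (q n k) w)"
      unfolding Vlaw[symmetric] by (subst distr_distr) (auto simp: o_def)
    finally show ?thesis .
  qed
  have joint: "distr M (PiM UNIV (\<lambda>_. borel)) (\<lambda>x k. T n k x)
      = distr P (PiM UNIV (\<lambda>_. borel)) (\<lambda>w k. c n k * V (q n k) (w k))" for n
  proof -
    have disj: "disjoint_family (\<lambda>k. {b n k..<b n (Suc k)})"
      unfolding disjoint_family_on_def
    proof (intro ballI impI)
      fix i j :: nat assume "i \<noteq> j"
      then consider "Suc i \<le> j" | "Suc j \<le> i" by linarith
      then show "{b n i..<b n (Suc i)} \<inter> {b n j..<b n (Suc j)} = {}"
        using b_mono[of "Suc i" j n] b_mono[of "Suc j" i n] by cases auto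
    qed
    have "indep_vars (\<lambda>_. borel) (\<lambda>k x. \<Sum>i\<in>{b n k..<b n (Suc k)}. \<zeta> i x) UNIV"
      by (rule indep_vars_sum_blocks[OF ind _ disj]) simp
    then have "indep_vars (\<lambda>_. borel) (T n) UNIV"
      unfolding T_def by (rule indep_vars_compose2[of _ _ _ "\<lambda>_ y. y / sqrt (real n)"]) measurable
    then have "distr M (PiM UNIV (\<lambda>_. borel)) (\<lambda>x. \<lambda>k\<in>UNIV. T n k x) = PiM UNIV (\<lambda>k. distr M borel (T n k))"
      by (intro indep_vars_iff_distr_eq_PiM[THEN iffD1]) auto
    then show ?thesis
      unfolding Tlaw restrict_UNIV by (subst prodP) auto
  qed
  define G where "G a = g (\<lambda>k. \<Sum>i<k. a i)" for a
  have Gm[measurable]: "G \<in> borel_measurable (PiM UNIV (\<lambda>_. borel))"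
    unfolding G_def by (rule measurable_compose[OF _ gm]) (rule measurable_PiM_single', auto)
  have node: "(\<Sum>i<b n k. \<zeta> i x) / sqrt (real n) = (\<Sum>i<k. T n i x)" for n k x
  proof (induction k)
    case (Suc k)
    have "{..<b n (Suc k)} = {..<b n k} \<union> {b n k..<b n (Suc k)}" "{..<b n k} \<inter> {b n k..<b n (Suc k)} = {}"
      using b_mono[of k "Suc k" n] by auto
    then have "(\<Sum>i<b n (Suc k). \<zeta> i x) = (\<Sum>i<b n k. \<zeta> i x) + (\<Sum>i\<in>{b n k..<b n (Suc k)}. \<zeta> i x)"
      by (metis finite_atLeastLessThan finite_lessThan sum.union_disjoint)
    then show ?case using Suc by (simp add: T_def add_divide_distrib)
  qed (simp add: b0)
  have lhs: "expectation (\<lambda>x. g (\<lambda>k. (\<Sum>i<b n k. \<zeta> i x) / sqrt (real n)))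
      = P.expectation (\<lambda>w. G (\<lambda>k. c n k * V (q n k) (w k)))" for n
  proof -
    have "expectation (\<lambda>x. g (\<lambda>k. (\<Sum>i<b n k. \<zeta> i x) / sqrt (real n))) = expectation (\<lambda>x. G (\<lambda>k. T n k x))"
      by (simp add: node G_def)
    also have "\<dots> = integral\<^sup>L (distr M (PiM UNIV (\<lambda>_. borel)) (\<lambda>x k. T n k x)) G"
      by (subst integral_distr) (auto intro!: measurable_PiM_single')
    also have "\<dots> = P.expectation (\<lambda>w. G (\<lambda>k. c n k * V (q n k) (w k)))"
      unfolding joint by (subst integral_distr) (auto intro!: measurable_PiM_single')
    finally show ?thesis .
  qed
  have clim: "(\<lambda>n. c n k) \<longlonglongrightarrow> sqrt (1 / 2^j) * \<sigma>" for k
    unfolding c_def real_sqrt_divide[symmetric] by (intro tendsto_intros q_lim)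
  have "(\<lambda>n. P.expectation (\<lambda>w. G (\<lambda>k. c n k * V (q n k) (w k))))
      \<longlonglongrightarrow> P.expectation (\<lambda>w. G (\<lambda>k. sqrt (1 / 2^j) * \<sigma> * V' (w k)))"
  proof (rule integral_dominated_convergence[where w = "\<lambda>_. 1"])
    show "AE w in P. (\<lambda>n. G (\<lambda>k. c n k * V (q n k) (w k))) \<longlonglongrightarrow> G (\<lambda>k. sqrt (1 / 2^j) * \<sigma> * V' (w k))"
    proof (rule AE_I2)
      fix w assume "w \<in> space P"
      then have w: "w k \<in> space \<Omega>" for k by (auto simp: P_def space_PiM)
      have Vl: "(\<lambda>n. V (q n k) (w k)) \<longlonglongrightarrow> V' (w k)" for k
        by (rule filterlim_compose[OF Vlim[OF w] q_inf])
      show "(\<lambda>n. G (\<lambda>k. c n k * V (q n k) (w k))) \<longlonglongrightarrow> G (\<lambda>k. sqrt (1 / 2^j) * \<sigma> * V' (w k))"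
        unfolding G_def by (intro g(1) tendsto_sum tendsto_mult clim Vl)
    qed
  qed (use g(2) in \<open>auto simp: G_def[abs_def] intro!: measurable_compose[OF _ gm] measurable_PiM_single'\<close>)
  moreover have "P.expectation (\<lambda>w. G (\<lambda>k. sqrt (1 / 2^j) * \<sigma> * V' (w k))) = (\<integral>y. g (\<lambda>k. \<sigma> * (\<Sum>i<k. y i)) \<partial>noise j)"
  proof -
    have "distr \<Omega> borel (\<lambda>w. sqrt (1 / 2^j) * V' w) = centered_normal (1 / 2^j)"
      unfolding centered_normal_scale_std[of "1 / 2^j", simplified] V'law[symmetric]
      by (subst distr_distr) (auto simp: o_def)
    then have law': "distr P (PiM UNIV (\<lambda>_. borel)) (\<lambda>w k. sqrt (1 / 2^j) * V' (w k)) = noise j"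
      by (subst prodP) (auto simp: noise_def)
    have "(\<integral>y. g (\<lambda>k. \<sigma> * (\<Sum>i<k. y i)) \<partial>noise j) = (\<integral>y. G (\<lambda>k. \<sigma> * y k) \<partial>noise j)"
      unfolding G_def by (simp add: sum_distrib_left)
    also have "\<dots> = P.expectation (\<lambda>w. G (\<lambda>k. \<sigma> * (sqrt (1 / 2^j) * V' (w k))))"
      unfolding law'[symmetric]
      by (subst integral_distr) (auto intro!: measurable_PiM_single' measurable_compose[OF _ Gm])
    finally show ?thesis by (simp add: mult_ac)
  qed
  ultimately show ?thesis
    unfolding lhs[unfolded b_def] by simp
qed

end

section \<open>The excitation probabilities\<close>

text \<open>The index is shifted: the step from time \<open>i\<close> to time \<open>i + 1\<close>, if it leaves a fresh site, is
  excited with probability \<open>exc_prob C i\<close>.\<close>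

definition exc_prob :: "real \<Rightarrow> nat \<Rightarrow> real" where
  "exc_prob C i = min (C * real (Suc i) powr (-1/2)) 1"

lemma exc_prob_le: "exc_prob C i \<le> C / sqrt (real (Suc i))"
  unfolding exc_prob_def by (simp add: powr_minus_divide powr_half_sqrt)

lemma exc_prob_bounds: "0 < C \<Longrightarrow> 0 \<le> exc_prob C i" "exc_prob C i \<le> 1"
  by (auto simp: exc_prob_def)

lemma exc_prob_antimono:
  assumes "0 < C" "i \<le> k"
  shows "exc_prob C k \<le> exc_prob C i"
  unfolding exc_prob_def using assms
  by (intro min.mono mult_left_mono powr_mono2') auto

text \<open>Telescoping: \<open>1 / sqrt k\<close> is at most the increment of \<open>2 * sqrt\<close> from \<open>k - 1\<close> to \<open>k\<close>. This sum is where the drift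
  \<open>2 * C * sqrt t\<close> of the limit comes from.\<close>

lemma sum_exc_prob_le:
  assumes "0 < C" "a \<le> b"
  shows "(\<Sum>i\<in>{a..<b}. exc_prob C i) \<le> 2 * C * sqrt (real (b - a))"
proof -
  have sqrt_step: "1 / sqrt (real (Suc b)) \<le> 2 * (sqrt (real (Suc b)) - sqrt (real b))" for b
  proof -
    define s where "s = sqrt (real (Suc b))"
    define t where "t = sqrt (real b)"
    have st: "0 < s" "t \<le> s" "(s - t) * (s + t) = 1"
      by (auto simp: s_def t_def algebra_simps)
    have "(s - t) * (s + t) \<le> (s - t) * (2 * s)" using st(2) by (intro mult_left_mono) auto
    then have "1 \<le> 2 * (s - t) * s" unfolding st(3) by (simp only: mult_ac)
    then have "1 / s \<le> 2 * (s - t)" using st(1) by (simp only: pos_divide_le_eq)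
    then show ?thesis unfolding s_def t_def .
  qed
  have "(\<Sum>i\<in>{a..<b}. exc_prob C i) \<le> 2 * C * (sqrt (real b) - sqrt (real a))"
    using assms(2)
  proof (induction b rule: dec_induct)
    case (step b)
    have "exc_prob C b \<le> C * (1 / sqrt (real (Suc b)))" using exc_prob_le[of C b] by simp
    also have "\<dots> \<le> C * (2 * (sqrt (real (Suc b)) - sqrt (real b)))"
      using sqrt_step[of b] assms(1) by (intro mult_left_mono) auto
    finally show ?case using step by (simp add: algebra_simps)
  qed simp
  also have "sqrt (real b) \<le> sqrt (real (b - a)) + sqrt (real a)"
    using sqrt_add_le_add_sqrt[of "real (b - a)" "real a"] assms(2) by simp
  finally show ?thesis using assms(1) by (simp add: mult_left_mono)
qed

lemma sum_exc_prob_sq_le: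
  assumes "0 < C"
  shows "(\<Sum>i<m. (exc_prob C i)\<^sup>2) \<le> C\<^sup>2 * (1 + ln (real m + 1))"
proof -
  have sq: "(exc_prob C i)\<^sup>2 \<le> C\<^sup>2 / real (Suc i)" for i
  proof -
    have "(exc_prob C i)\<^sup>2 \<le> (C / sqrt (real (Suc i)))\<^sup>2"
      using exc_prob_le exc_prob_bounds assms by (intro power_mono) auto
    then show ?thesis by (simp add: power_divide)
  qed
  have harm_pos: "(\<Sum>i<m. 1 / real (Suc i)) \<le> 1 + ln (real m)" if "0 < m" for m
    using that
  proof (induction m rule: nat_induct_non_zero)
    case (Suc m)
    have "ln (real m / (real m + 1)) \<le> real m / (real m + 1) - 1"
      using Suc by (intro ln_le_minus_one) simp
    moreover have "real m / (real m + 1) - 1 = - (1 / (real m + 1))" by (simp add: field_simps)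
    moreover have "ln (real m / (real m + 1)) = ln (real m) - ln (real m + 1)"
      using Suc by (simp add: ln_div)
    ultimately have "1 / (real m + 1) \<le> ln (real m + 1) - ln (real m)" by linarith
    then show ?case using Suc by (simp add: add.commute)
  qed simp
  have harm: "(\<Sum>i<m. 1 / real (Suc i)) \<le> 1 + ln (real m + 1)"
  proof (cases "m = 0")
    case False
    then have "ln (real m) \<le> ln (real m + 1)" by simp
    then show ?thesis using False by (intro order_trans[OF harm_pos]) simp_all
  qed simp
  have "(\<Sum>i<m. (exc_prob C i)\<^sup>2) \<le> (\<Sum>i<m. C\<^sup>2 * (1 / real (Suc i)))"
    by (intro sum_mono) (use sq in simp)
  also have "\<dots> \<le> C\<^sup>2 * (1 + ln (real m + 1))"
    unfolding sum_distrib_left[symmetric] by (intro mult_left_mono harm) simp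
  finally show ?thesis .
qed

section \<open>Second moments of weakly dependent sums\<close>

context prob_space
begin

lemma expectation_abs_le_sqrt:
  fixes Z :: "'a \<Rightarrow> real"
  assumes "integrable M Z" "integrable M (\<lambda>x. (Z x)\<^sup>2)" "expectation (\<lambda>x. (Z x)\<^sup>2) \<le> v"
  shows "expectation (\<lambda>x. \<bar>Z x\<bar>) \<le> sqrt v"
proof -
  have "(expectation (\<lambda>x. \<bar>Z x\<bar>))\<^sup>2 \<le> expectation (\<lambda>x. (Z x)\<^sup>2)"
    using variance_eq[of "\<lambda>x. \<bar>Z x\<bar>"] assms variance_positive[of "\<lambda>x. \<bar>Z x\<bar>"] by simp
  then show ?thesis using assms(3) by (intro real_le_rsqrt) simp
qed

text \<open>Each index has fewer than \<open>2 * q\<close> correlated partners, and a product is at most half the sum of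
  the squares. For \<open>q = 1\<close> this is the bound for martingale differences.\<close>

lemma weakly_dependent_second_moment:
  fixes w :: "nat \<Rightarrow> 'a \<Rightarrow> real" and q :: nat
  assumes [measurable]: "\<And>i. i \<in> A \<Longrightarrow> w i \<in> borel_measurable M"
    and A: "finite A" and bound: "\<And>i x. i \<in> A \<Longrightarrow> x \<in> space M \<Longrightarrow> \<bar>w i x\<bar> \<le> B"
    and second: "\<And>i. i \<in> A \<Longrightarrow> expectation (\<lambda>x. (w i x)\<^sup>2) \<le> v i"
    and indep: "\<And>i k. i \<in> A \<Longrightarrow> k \<in> A \<Longrightarrow> i + q \<le> k \<Longrightarrow> expectation (\<lambda>x. w i x * w k x) = 0"
  shows "expectation (\<lambda>x. (\<Sum>i\<in>A. w i x)\<^sup>2) \<le> 2 * real q * (\<Sum>i\<in>A. v i)"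
    and "integrable M (\<lambda>x. \<Sum>i\<in>A. w i x)" "integrable M (\<lambda>x. (\<Sum>i\<in>A. w i x)\<^sup>2)"
proof -
  have int: "integrable M (w i)" if "i \<in> A" for i
    using integrable_power_bounded[of "w i" B 1] bound that by simp
  have prod_int: "integrable M (\<lambda>x. w i x * w k x)" if ik: "i \<in> A" "k \<in> A" for i k
  proof (rule integrable_const_bound[of _ "B * B"])
    show "AE x in M. norm (w i x * w k x) \<le> B * B"
    proof (rule AE_I2)
      fix x assume x: "x \<in> space M"
      have "\<bar>w i x\<bar> * \<bar>w k x\<bar> \<le> B * B"
        using bound[OF ik(1) x] bound[OF ik(2) x] by (intro mult_mono) auto
      then show "norm (w i x * w k x) \<le> B * B" by (simp add: abs_mult)
    qed
  qed (use ik in measurable)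
  show "integrable M (\<lambda>x. \<Sum>i\<in>A. w i x)" using int by auto
  have sq: "(\<Sum>i\<in>A. w i x)\<^sup>2 = (\<Sum>i\<in>A. \<Sum>k\<in>A. w i x * w k x)" for x
    by (simp add: power2_eq_square sum_product)
  show "integrable M (\<lambda>x. (\<Sum>i\<in>A. w i x)\<^sup>2)" unfolding sq using prod_int by auto
  have v0: "0 \<le> v i" if "i \<in> A" for i
    by (rule order_trans[OF _ second[OF that]]) (auto intro!: Bochner_Integration.integral_nonneg)
  define N where "N i k \<longleftrightarrow> i < k + q \<and> k < i + q" for i k :: nat
  have Ewk: "expectation (\<lambda>x. w i x * w k x) \<le> (if N i k then (v i + v k) / 2 else 0)"
    if ik: "i \<in> A" "k \<in> A" for i k
  proof (cases "N i k")
    case True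
    have "expectation (\<lambda>x. w i x * w k x) \<le> expectation (\<lambda>x. ((w i x)\<^sup>2 + (w k x)\<^sup>2) / 2)"
    proof (rule integral_mono)
      show "w i x * w k x \<le> ((w i x)\<^sup>2 + (w k x)\<^sup>2) / 2" for x
        using sum_squares_bound[of "w i x" "w k x"] by simp
    qed (use prod_int ik in \<open>auto simp: power2_eq_square\<close>)
    also have "\<dots> = (expectation (\<lambda>x. (w i x)\<^sup>2) + expectation (\<lambda>x. (w k x)\<^sup>2)) / 2"
      using prod_int ik by (simp add: power2_eq_square)
    also have "\<dots> \<le> (v i + v k) / 2" by (intro divide_right_mono add_mono second ik) auto
    finally show ?thesis using True by simp
  next
    case False
    then show ?thesis using indep[OF ik] indep[OF ik(2,1)] by (auto simp: N_def mult.commute not_less)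
  qed
  have cardN: "real (card {k\<in>A. N i k}) \<le> 2 * real q" for i
  proof -
    have "{k\<in>A. N i k} \<subseteq> {i + 1 - q..<i + q}" by (auto simp: N_def)
    then have "card {k\<in>A. N i k} \<le> card {i + 1 - q..<i + q}" by (intro card_mono) auto
    also have "\<dots> \<le> 2 * q" by simp
    finally show ?thesis by (metis of_nat_le_iff of_nat_mult of_nat_numeral)
  qed
  have half: "(\<Sum>i\<in>A. \<Sum>k\<in>A. if N i k then v i / 2 else 0) \<le> real q * (\<Sum>i\<in>A. v i)"
  proof -
    have "(\<Sum>k\<in>A. if N i k then v i / 2 else 0) \<le> real q * v i" if "i \<in> A" for i
    proof -
      have "(\<Sum>k\<in>A. if N i k then v i / 2 else 0) = real (card {k\<in>A. N i k}) * (v i / 2)"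
        by (simp add: sum.inter_filter[OF A, symmetric])
      also have "\<dots> \<le> 2 * real q * (v i / 2)"
        using cardN v0[OF that] by (intro mult_right_mono) auto
      finally show ?thesis by simp
    qed
    then show ?thesis unfolding sum_distrib_left by (rule sum_mono)
  qed
  have "expectation (\<lambda>x. (\<Sum>i\<in>A. w i x)\<^sup>2) = (\<Sum>i\<in>A. \<Sum>k\<in>A. expectation (\<lambda>x. w i x * w k x))"
    unfolding sq using prod_int by (simp add: Bochner_Integration.integral_sum)
  also have "\<dots> \<le> (\<Sum>i\<in>A. \<Sum>k\<in>A. if N i k then (v i + v k) / 2 else 0)"
    by (intro sum_mono Ewk)
  also have "\<dots> = (\<Sum>i\<in>A. \<Sum>k\<in>A. if N i k then v i / 2 else 0) + (\<Sum>i\<in>A. \<Sum>k\<in>A. if N i k then v k / 2 else 0)"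
    unfolding sum.distrib[symmetric] by (intro sum.cong refl) (auto simp: add_divide_distrib)
  also have "(\<Sum>i\<in>A. \<Sum>k\<in>A. if N i k then v k / 2 else 0) = (\<Sum>k\<in>A. \<Sum>i\<in>A. if N k i then v k / 2 else 0)"
    by (subst sum.swap) (intro sum.cong refl if_cong, auto simp: N_def)
  finally show "expectation (\<lambda>x. (\<Sum>i\<in>A. w i x)\<^sup>2) \<le> 2 * real q * (\<Sum>i\<in>A. v i)"
    using half by simp
qed

lemma indep_var_vimage_algebra:
  fixes H W :: "'a \<Rightarrow> real"
  assumes ind: "indep_var S X T Y"
    and H: "H \<in> borel_measurable (vimage_algebra (space M) X S)"
    and W: "W \<in> borel_measurable (vimage_algebra (space M) Y T)"
  shows "indep_var borel H borel W"
proof -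
  have X: "X \<in> measurable M S" and Y: "Y \<in> measurable M T"
    using ind by (auto simp: indep_var_eq)
  have HM: "H -` A \<inter> space M \<in> sigma_sets (space M) {X -` A \<inter> space M |A. A \<in> sets S}" if "A \<in> sets borel" for A
    using measurable_sets[OF H that] by (simp add: sets_vimage_algebra)
  have WM: "W -` A \<inter> space M \<in> sigma_sets (space M) {Y -` A \<inter> space M |A. A \<in> sets T}" if "A \<in> sets borel" for A
    using measurable_sets[OF W that] by (simp add: sets_vimage_algebra)
  have subX: "sigma_sets (space M) {X -` A \<inter> space M |A. A \<in> sets S} \<subseteq> events"
    by (rule sets.sigma_sets_subset) (use X measurable_sets in auto)
  have subY: "sigma_sets (space M) {Y -` A \<inter> space M |A. A \<in> sets T} \<subseteq> events"
    by (rule sets.sigma_sets_subset) (use Y measurable_sets in auto)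
  have [measurable]: "H \<in> borel_measurable M" "W \<in> borel_measurable M"
    using HM WM subX subY by (auto intro!: measurableI)
  have "sigma_sets (space M) {H -` A \<inter> space M |A. A \<in> sets borel}
      \<subseteq> sigma_sets (space M) {X -` A \<inter> space M |A. A \<in> sets S}"
    by (rule sigma_sets_mono) (use HM in auto)
  moreover have "sigma_sets (space M) {W -` A \<inter> space M |A. A \<in> sets borel}
      \<subseteq> sigma_sets (space M) {Y -` A \<inter> space M |A. A \<in> sets T}"
    by (rule sigma_sets_mono) (use WM in auto)
  moreover have "indep_set (sigma_sets (space M) {X -` A \<inter> space M |A. A \<in> sets S})
      (sigma_sets (space M) {Y -` A \<inter> space M |A. A \<in> sets T})"
    using ind by (auto simp: indep_var_eq)
  ultimately have "indep_set (sigma_sets (space M) {H -` A \<inter> space M |A. A \<in> sets borel})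
      (sigma_sets (space M) {W -` A \<inter> space M |A. A \<in> sets borel})"
    unfolding indep_set_def by (elim indep_sets_mono_sets) (auto split: bool.split)
  then show ?thesis unfolding indep_var_eq by auto
qed

end

section \<open>The excited random walk\<close>

lemma sets_Collect_neq:
  fixes f g :: "'a \<Rightarrow> 'b::{second_countable_topology, real_normed_vector}"
  assumes [measurable]: "f \<in> borel_measurable N" "g \<in> borel_measurable N"
  shows "{x \<in> space N. f x \<noteq> g x} \<in> sets N"
proof -
  have "{x \<in> space N. norm (f x - g x) \<noteq> 0} \<in> sets N" by measurable
  then show ?thesis by simp
qed

locale sqrt_erw = excited_random_walk M F l "\<lambda>n. min (C * real n powr (-1/2)) 1" \<xi> \<gamma> U X
  for M :: "'a measure" and F l C \<xi> \<gamma> U and X :: "nat \<Rightarrow> 'a \<Rightarrow> real^'d" +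
  assumes C_pos: "0 < C"
begin

abbreviation "\<pi> \<equiv> exc_prob C"

text \<open>The steps are renumbered from \<open>0\<close>, so that the step with number \<open>i\<close> leaves the position at time \<open>i\<close>.\<close>

definition \<zeta> where "\<zeta> i = \<xi> (Suc i)"
definition \<eta> where "\<eta> i = \<gamma> (Suc i)"
definition u where "u i = U (Suc i)"
definition fresh where "fresh i \<omega> \<longleftrightarrow> (\<forall>k<i. X k \<omega> \<noteq> X i \<omega>)"
definition Y where "Y n \<omega> = (\<Sum>i<n. \<zeta> i \<omega>)"

lemma measurable_steps [measurable]:
  "\<zeta> i \<in> borel_measurable M" "\<eta> i \<in> borel_measurable M" "u i \<in> borel_measurable M"
  using iid_\<xi>(1) iid_\<gamma>(1) iid_uniform(1) by (auto simp: indep_vars_def2 \<zeta>_def \<eta>_def u_def)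

lemma X_0: "\<omega> \<in> space M \<Longrightarrow> X 0 \<omega> = 0"
  using process[of \<omega> 0] by simp

lemma X_Suc:
  assumes "\<omega> \<in> space M"
  shows "X (Suc n) \<omega> = X n \<omega> + (if fresh n \<omega> \<and> u n \<omega> \<le> \<pi> n then \<eta> n \<omega> else \<zeta> n \<omega>)"
proof -
  have "X (Suc n) \<omega> = X n \<omega>
        + (indicator (revisit X n) \<omega> *\<^sub>R \<xi> (Suc n) \<omega>
        + indicator (- revisit X n \<inter> {\<omega>. U (Suc n) \<omega> > min (C * real (Suc n) powr (-1/2)) 1}) \<omega> *\<^sub>R \<xi> (Suc n) \<omega>
        + indicator (- revisit X n \<inter> {\<omega>. U (Suc n) \<omega> \<le> min (C * real (Suc n) powr (-1/2)) 1}) \<omega> *\<^sub>R \<gamma> (Suc n) \<omega>)"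
    unfolding process[OF assms] by simp
  also have "(indicator (revisit X n) \<omega> *\<^sub>R \<xi> (Suc n) \<omega>
        + indicator (- revisit X n \<inter> {\<omega>. U (Suc n) \<omega> > min (C * real (Suc n) powr (-1/2)) 1}) \<omega> *\<^sub>R \<xi> (Suc n) \<omega>
        + indicator (- revisit X n \<inter> {\<omega>. U (Suc n) \<omega> \<le> min (C * real (Suc n) powr (-1/2)) 1}) \<omega> *\<^sub>R \<gamma> (Suc n) \<omega>)
     = (if fresh n \<omega> \<and> u n \<omega> \<le> \<pi> n then \<eta> n \<omega> else \<zeta> n \<omega>)"
    by (auto simp: indicator_def revisit_def fresh_def \<zeta>_def \<eta>_def u_def exc_prob_def)
  finally show ?thesis .
qed

text \<open>The walk up to time \<open>n\<close> is a function of the first \<open>n\<close> steps. The \<open>\<sigma>\<close>-algebra is arbitrary here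
  because the past of the walk is needed later as well.\<close>

lemma measurable_X_gen:
  assumes sp: "space N = space M"
    and N: "\<And>i. i < n \<Longrightarrow> \<zeta> i \<in> borel_measurable N" "\<And>i. i < n \<Longrightarrow> \<eta> i \<in> borel_measurable N"
      "\<And>i. i < n \<Longrightarrow> u i \<in> borel_measurable N"
  shows "k \<le> n \<Longrightarrow> X k \<in> borel_measurable N"
proof (induction k rule: less_induct)
  case (less k)
  show ?case
  proof (cases k)
    case 0
    have "X 0 \<in> borel_measurable N \<longleftrightarrow> (\<lambda>_. 0 :: real^'d) \<in> borel_measurable N"
      by (rule measurable_cong) (simp add: sp X_0)
    then show ?thesis using 0 by simp
  next
    case (Suc m)
    have Xm[measurable]: "X i \<in> borel_measurable N" if "i \<le> m" for i
      by (rule less(1)) (use less(2) that Suc in auto)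
    have [measurable]: "\<zeta> m \<in> borel_measurable N" "\<eta> m \<in> borel_measurable N" "u m \<in> borel_measurable N"
      using N less(2) Suc by auto
    have "{\<omega> \<in> space N. \<forall>i\<in>{..<m}. X i \<omega> \<noteq> X m \<omega>} \<in> sets N"
      by (rule sets.sets_Collect_finite_All) (intro sets_Collect_neq Xm, auto)
    moreover have "fresh m = (\<lambda>\<omega>. \<forall>i\<in>{..<m}. X i \<omega> \<noteq> X m \<omega>)" by (auto simp: fresh_def fun_eq_iff)
    ultimately have [measurable]: "Measurable.pred N (fresh m)" by (simp only: pred_def)
    have "X (Suc m) \<in> borel_measurable N \<longleftrightarrow>
      (\<lambda>\<omega>. X m \<omega> + (if fresh m \<omega> \<and> u m \<omega> \<le> \<pi> m then \<eta> m \<omega> else \<zeta> m \<omega>)) \<in> borel_measurable N"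
      by (rule measurable_cong) (simp add: sp X_Suc)
    moreover have "(\<lambda>\<omega>. X m \<omega> + (if fresh m \<omega> \<and> u m \<omega> \<le> \<pi> m then \<eta> m \<omega> else \<zeta> m \<omega>)) \<in> borel_measurable N"
      by measurable
    ultimately show ?thesis unfolding Suc by (rule iffD2)
  qed
qed

lemma measurable_X [measurable]: "X n \<in> borel_measurable M"
  by (rule measurable_X_gen[of M n]) auto

lemma measurable_fresh_gen:
  assumes "\<And>k. k \<le> n \<Longrightarrow> X k \<in> borel_measurable N"
  shows "Measurable.pred N (fresh n)"
proof -
  have "{\<omega> \<in> space N. \<forall>i\<in>{..<n}. X i \<omega> \<noteq> X n \<omega>} \<in> sets N"
    by (rule sets.sets_Collect_finite_All) (intro sets_Collect_neq assms, auto)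
  moreover have "fresh n = (\<lambda>\<omega>. \<forall>i\<in>{..<n}. X i \<omega> \<noteq> X n \<omega>)" by (auto simp: fresh_def fun_eq_iff)
  ultimately show ?thesis by (simp only: pred_def)
qed

lemma measurable_fresh [measurable]: "Measurable.pred M (fresh n)"
  by (rule measurable_fresh_gen) measurable

text \<open>All steps are put into a single independent family; the uniform variables become vectors along
  \<open>l\<close>.\<close>

definition Z :: "nat \<times> nat \<Rightarrow> 'a \<Rightarrow> real^'d" where
  "Z = (\<lambda>(i, c) \<omega>. if c = 0 then \<zeta> i \<omega> else if c = 1 then \<eta> i \<omega> else u i \<omega> *\<^sub>R l)"

lemma measurable_Z [measurable]: "Z j \<in> borel_measurable M"
  by (cases j) (simp add: Z_def, measurable)

text \<open>Cylinder events factorise in three stages: the uniform variables split off from the pair of step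
  sequences, the two step sequences from each other, and finally each sequence into its members.\<close>

lemma indep_triples:
  assumes I: "finite I" "I \<noteq> {}"
    and P: "\<And>i. i \<in> I \<Longrightarrow> P i \<in> sets borel" and Q: "\<And>i. i \<in> I \<Longrightarrow> Q i \<in> sets borel"
    and R: "\<And>i. i \<in> I \<Longrightarrow> R i \<in> sets borel"
  shows "prob (\<Inter>i\<in>I. (\<zeta> i -` P i \<inter> space M) \<inter> (\<eta> i -` Q i \<inter> space M) \<inter> (u i -` R i \<inter> space M))
    = (\<Prod>i\<in>I. prob (\<zeta> i -` P i \<inter> space M) * prob (\<eta> i -` Q i \<inter> space M) * prob (u i -` R i \<inter> space M))"
proof -
  let ?b = "\<lambda>_. borel :: (real^'d) measure"
  let ?r = "\<lambda>_. borel :: real measure"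
  have cyl: "{f \<in> space (PiM {1..} (\<lambda>_. borel)). \<forall>i\<in>I. f (Suc i) \<in> P i} \<in> sets (PiM {1..} (\<lambda>_. borel))"
    if "\<And>i. i \<in> I \<Longrightarrow> P i \<in> sets borel" for P :: "nat \<Rightarrow> 'z::topological_space set"
  proof (rule sets.sets_Collect_finite_All[OF _ I(1)])
    fix i assume i: "i \<in> I"
    have "(\<lambda>f. f (Suc i)) \<in> measurable (PiM {1..} (\<lambda>_. borel)) (borel :: 'z measure)"
      by (rule measurable_component_singleton) simp
    from measurable_sets[OF this that[OF i]]
    show "{f \<in> space (PiM {1..} (\<lambda>_. borel)). f (Suc i) \<in> P i} \<in> sets (PiM {1..} (\<lambda>_. borel))"
      by (simp add: vimage_def Int_def conj_commute)
  qed
  define CP where "CP = {f \<in> space (PiM {1..} ?b). \<forall>i\<in>I. f (Suc i) \<in> P i}"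
  define CQ where "CQ = {f \<in> space (PiM {1..} ?b). \<forall>i\<in>I. f (Suc i) \<in> Q i}"
  define CR where "CR = {f \<in> space (PiM {1..} ?r). \<forall>i\<in>I. f (Suc i) \<in> R i}"
  have CP: "CP \<in> sets (PiM {1..} ?b)" unfolding CP_def by (rule cyl[OF P])
  have CQ: "CQ \<in> sets (PiM {1..} ?b)" unfolding CQ_def by (rule cyl[OF Q])
  have CR: "CR \<in> sets (PiM {1..} ?r)" unfolding CR_def by (rule cyl[OF R])
  define fx where "fx = (\<lambda>\<omega>. \<lambda>i\<in>{1..}. \<xi> i \<omega>)"
  define fg where "fg = (\<lambda>\<omega>. \<lambda>i\<in>{1..}. \<gamma> i \<omega>)"
  define fU where "fU = (\<lambda>\<omega>. \<lambda>i\<in>{1..}. U i \<omega>)"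
  have A0: "fx -` CP \<inter> space M = (\<Inter>i\<in>I. \<zeta> i -` P i \<inter> space M)"
    using I(2) by (auto simp: fx_def CP_def \<zeta>_def space_PiM)
  have A1: "fg -` CQ \<inter> space M = (\<Inter>i\<in>I. \<eta> i -` Q i \<inter> space M)"
    using I(2) by (auto simp: fg_def CQ_def \<eta>_def space_PiM)
  have A2: "fU -` CR \<inter> space M = (\<Inter>i\<in>I. u i -` R i \<inter> space M)"
    using I(2) by (auto simp: fU_def CR_def u_def space_PiM)
  have A01: "(\<lambda>\<omega>. (fx \<omega>, fg \<omega>)) -` (CP \<times> CQ) \<inter> space M = (fx -` CP \<inter> space M) \<inter> (fg -` CQ \<inter> space M)"
    by auto
  have e01: "prob ((\<lambda>\<omega>. (fx \<omega>, fg \<omega>)) -` (CP \<times> CQ) \<inter> space M) = prob (fx -` CP \<inter> space M) * prob (fg -` CQ \<inter> space M)"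
    using indep_varD[OF indep_\<xi>_\<gamma> CP CQ] unfolding fx_def fg_def .
  have m1: "fU -` CR \<inter> space M \<in> {fU -` A \<inter> space M | A. A \<in> sets (PiM {1..} (\<lambda>_. borel))}"
    using CR by blast
  have m2: "(\<lambda>\<omega>. (fx \<omega>, fg \<omega>)) -` (CP \<times> CQ) \<inter> space M \<in> {(\<lambda>\<omega>. (fx \<omega>, fg \<omega>)) -` A \<inter> space M | A.
            A \<in> sets (PiM {1..} (\<lambda>_. borel) \<Otimes>\<^sub>M PiM {1..} (\<lambda>_. borel))}"
    using pair_measureI[OF CP CQ] by blast
  have e2: "prob ((fU -` CR \<inter> space M) \<inter> ((\<lambda>\<omega>. (fx \<omega>, fg \<omega>)) -` (CP \<times> CQ) \<inter> space M))
      = prob (fU -` CR \<inter> space M) * prob ((\<lambda>\<omega>. (fx \<omega>, fg \<omega>)) -` (CP \<times> CQ) \<inter> space M)"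
    by (rule indep_setD[OF _ m1 m2]) (use indep_U in \<open>simp only: fx_def fg_def fU_def\<close>)
  have reix: "prob (\<Inter>i\<in>I. V (Suc i) -` A i \<inter> space M) = (\<Prod>i\<in>I. prob (V (Suc i) -` A i \<inter> space M))"
    if ind: "indep_vars (\<lambda>_. borel) V {1..}" and A: "\<And>i. i \<in> I \<Longrightarrow> A i \<in> sets borel"
    for V :: "nat \<Rightarrow> 'a \<Rightarrow> 'z::topological_space" and A
  proof -
    have "prob (\<Inter>i\<in>Suc ` I. V i -` A (i - 1) \<inter> space M) = (\<Prod>i\<in>Suc ` I. prob (V i -` A (i - 1) \<inter> space M))"
      by (rule indep_varsD[OF ind]) (use I A in auto)
    moreover have "(\<Inter>i\<in>Suc ` I. V i -` A (i - 1) \<inter> space M) = (\<Inter>i\<in>I. V (Suc i) -` A i \<inter> space M)"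
      by (simp only: image_image diff_Suc_1)
    moreover have "(\<Prod>i\<in>Suc ` I. prob (V i -` A (i - 1) \<inter> space M)) = (\<Prod>i\<in>I. prob (V (Suc i) -` A i \<inter> space M))"
      by (subst prod.reindex) (simp_all only: inj_Suc inj_on_def o_def diff_Suc_1 nat.inject, simp)
    ultimately show ?thesis by (simp only:)
  qed
  have "(\<Inter>i\<in>I. (\<zeta> i -` P i \<inter> space M) \<inter> (\<eta> i -` Q i \<inter> space M) \<inter> (u i -` R i \<inter> space M))
      = (fU -` CR \<inter> space M) \<inter> ((\<lambda>\<omega>. (fx \<omega>, fg \<omega>)) -` (CP \<times> CQ) \<inter> space M)"
    unfolding A01 A0 A1 A2 by auto
  then have "prob (\<Inter>i\<in>I. (\<zeta> i -` P i \<inter> space M) \<inter> (\<eta> i -` Q i \<inter> space M) \<inter> (u i -` R i \<inter> space M))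
      = prob (fU -` CR \<inter> space M) * (prob (fx -` CP \<inter> space M) * prob (fg -` CQ \<inter> space M))"
    by (simp only: e2 e01)
  also have "\<dots> = (\<Prod>i\<in>I. prob (u i -` R i \<inter> space M))
      * ((\<Prod>i\<in>I. prob (\<zeta> i -` P i \<inter> space M)) * (\<Prod>i\<in>I. prob (\<eta> i -` Q i \<inter> space M)))"
    unfolding A0 A1 A2 \<zeta>_def \<eta>_def u_def
    using reix[OF iid_\<xi>(1) P] reix[OF iid_\<gamma>(1) Q] reix[OF iid_uniform(1) R] by simp
  finally show ?thesis by (simp add: prod.distrib mult_ac)
qed

lemma indep_Z: "indep_vars (\<lambda>_. borel) Z (UNIV \<times> {..<3})"
  unfolding indep_vars_def2
proof (intro conjI ballI indep_setsI)
  fix A and J :: "(nat \<times> nat) set"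
  assume J: "J \<noteq> {}" "J \<subseteq> UNIV \<times> {..<3}" "finite J"
    and A: "\<forall>j\<in>J. A j \<in> {Z j -` S \<inter> space M | S. S \<in> sets borel}"
  from A have "\<forall>j\<in>J. \<exists>S. S \<in> sets borel \<and> A j = Z j -` S \<inter> space M" by auto
  then obtain S where S: "\<And>j. j \<in> J \<Longrightarrow> S j \<in> sets borel" "\<And>j. j \<in> J \<Longrightarrow> A j = Z j -` S j \<inter> space M"
    by metis
  define S' where "S' j = (if j \<in> J then S j else UNIV)" for j
  have S'm: "S' j \<in> sets borel" for j using S by (auto simp: S'_def)
  define I where "I = fst ` J"
  have I: "finite I" "I \<noteq> {}" using J by (auto simp: I_def)
  define R where "R i = (\<lambda>t :: real. t *\<^sub>R l) -` S' (i, 2)" for i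
  have Rm: "R i \<in> sets borel" for i
  proof -
    have "(\<lambda>t :: real. t *\<^sub>R l) \<in> borel_measurable borel" by measurable
    from measurable_sets[OF this S'm] show ?thesis by (simp add: R_def)
  qed
  have c3: "{..<3} = {0, 1, 2 :: nat}" by auto
  have Z012: "Z (i, 0) = \<zeta> i" "Z (i, Suc 0) = \<eta> i" "Z (i, 2) -` S' (i, 2) = u i -` R i" for i
    by (auto simp: Z_def R_def)
  have "(\<Inter>j\<in>J. A j) = (\<Inter>j\<in>I \<times> {..<3}. Z j -` S' j \<inter> space M)"
  proof -
    have sub: "J \<subseteq> I \<times> {..<3}" using J(2) by (force simp: I_def)
    have "(\<Inter>j\<in>J. A j) = (\<Inter>j\<in>J. Z j -` S' j \<inter> space M)" by (intro INF_cong) (auto simp: S(2) S'_def)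
    also have "\<dots> = (\<Inter>j\<in>I \<times> {..<3}. Z j -` S' j \<inter> space M)"
    proof (intro equalityI subsetI)
      fix x assume x: "x \<in> (\<Inter>j\<in>J. Z j -` S' j \<inter> space M)"
      then have "x \<in> space M" using J(1) by auto
      moreover have "Z j x \<in> S' j" for j
      proof (cases "j \<in> J")
        case True then show ?thesis using x by blast
      qed (simp add: S'_def)
      ultimately show "x \<in> (\<Inter>j\<in>I \<times> {..<3}. Z j -` S' j \<inter> space M)" by blast
    qed (use sub in blast)
    finally show ?thesis .
  qed
  also have "\<dots> = (\<Inter>i\<in>I. (\<zeta> i -` S' (i, 0) \<inter> space M) \<inter> (\<eta> i -` S' (i, 1) \<inter> space M) \<inter> (u i -` R i \<inter> space M))"
  proof -
    have "(\<Inter>j\<in>I \<times> {..<3}. Z j -` S' j \<inter> space M) = (\<Inter>i\<in>I. \<Inter>c\<in>{..<3}. Z (i, c) -` S' (i, c) \<inter> space M)"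
      by auto
    also have "\<dots> = (\<Inter>i\<in>I. (Z (i, 0) -` S' (i, 0) \<inter> space M) \<inter> (Z (i, 1) -` S' (i, 1) \<inter> space M)
        \<inter> (Z (i, 2) -` S' (i, 2) \<inter> space M))"
      unfolding c3 by (simp add: Int_assoc)
    finally show ?thesis using Z012 by simp
  qed
  also have "prob \<dots> = (\<Prod>i\<in>I. prob (\<zeta> i -` S' (i, 0) \<inter> space M) * prob (\<eta> i -` S' (i, 1) \<inter> space M) * prob (u i -` R i \<inter> space M))"
    by (rule indep_triples[OF I]) (auto simp: S'm Rm)
  also have "\<dots> = (\<Prod>i\<in>I. \<Prod>c\<in>{..<3}. prob (Z (i, c) -` S' (i, c) \<inter> space M))"
    unfolding c3 by (simp add: Z012 mult.assoc)
  also have "\<dots> = (\<Prod>j\<in>I \<times> {..<3}. prob (Z j -` S' j \<inter> space M))"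
    by (simp add: prod.cartesian_product)
  also have "\<dots> = (\<Prod>j\<in>J. prob (Z j -` S' j \<inter> space M))"
    by (rule prod.mono_neutral_right) (use I J in \<open>force simp: I_def S'_def prob_space\<close>)+
  also have "\<dots> = (\<Prod>j\<in>J. prob (A j))" by (intro prod.cong refl) (simp add: S(2) S'_def)
  finally show "prob (\<Inter>j\<in>J. A j) = (\<Prod>j\<in>J. prob (A j))" .
qed auto

definition step_algebra :: "(nat \<times> nat) set \<Rightarrow> 'a measure" where
  "step_algebra A = vimage_algebra (space M) (\<lambda>\<omega>. restrict (\<lambda>j. Z j \<omega>) A) (PiM A (\<lambda>_. borel))"

lemma space_step_algebra [simp]: "space (step_algebra A) = space M"
  by (simp add: step_algebra_def)

lemma measurable_step_algebra:
  assumes "j \<in> A" shows "Z j \<in> borel_measurable (step_algebra A)"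
proof -
  have "(\<lambda>\<omega>. restrict (\<lambda>j. Z j \<omega>) A) \<in> measurable (step_algebra A) (PiM A (\<lambda>_. borel))"
    unfolding step_algebra_def by (rule measurable_vimage_algebra1) (auto simp: space_PiM)
  from measurable_compose[OF this measurable_component_singleton[OF assms]]
  show ?thesis using assms by simp
qed

lemma measurable_step_algebra_steps:
  "(i, 0) \<in> A \<Longrightarrow> \<zeta> i \<in> borel_measurable (step_algebra A)"
  "(i, 1) \<in> A \<Longrightarrow> \<eta> i \<in> borel_measurable (step_algebra A)"
  "(i, 2) \<in> A \<Longrightarrow> u i \<in> borel_measurable (step_algebra A)"
proof -
  show "(i, 0) \<in> A \<Longrightarrow> \<zeta> i \<in> borel_measurable (step_algebra A)"
    using measurable_step_algebra[of "(i, 0)" A] by (simp add: Z_def)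
  show "(i, 1) \<in> A \<Longrightarrow> \<eta> i \<in> borel_measurable (step_algebra A)"
    using measurable_step_algebra[of "(i, 1)" A] by (simp add: Z_def)
  assume "(i, 2) \<in> A"
  then have "(\<lambda>\<omega>. Z (i, 2) \<omega> \<bullet> l) \<in> borel_measurable (step_algebra A)"
    using measurable_step_algebra by measurable
  then show "u i \<in> borel_measurable (step_algebra A)"
    using direction by (simp add: Z_def dot_square_norm)
qed

lemma step_algebra_indep:
  fixes H W :: "'a \<Rightarrow> real"
  assumes AB: "A \<inter> B = {}" "A \<subseteq> UNIV \<times> {..<3}" "B \<subseteq> UNIV \<times> {..<3}"
    and H: "H \<in> borel_measurable (step_algebra A)" and W: "W \<in> borel_measurable (step_algebra B)"
    and int: "integrable M H" "integrable M W"
  shows "expectation (\<lambda>\<omega>. H \<omega> * W \<omega>) = expectation H * expectation W"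
  by (rule indep_var_lebesgue_integral[OF
      indep_var_vimage_algebra[OF indep_var_restrict[OF indep_Z AB]] int])
     (use H W in \<open>simp_all add: step_algebra_def\<close>)

end

lemma power4_add_le: "(x + y)^4 \<le> 8 * (x^4 + y^4)" for x y :: real
proof -
  have sq: "(a + b)^2 \<le> 2 * (a^2 + b^2)" for a b :: real
    using sum_squares_bound[of a b] by (simp add: power2_eq_square algebra_simps)
  have "(x + y)^4 = ((x + y)^2)^2" by simp
  also have "\<dots> \<le> (2 * (x^2 + y^2))^2" by (intro power_mono sq) simp
  also have "\<dots> = 4 * (x^2 + y^2)^2" by (simp only: power_mult_distrib) simp
  also have "\<dots> \<le> 4 * (2 * ((x^2)^2 + (y^2)^2))" by (intro mult_left_mono sq) simp
  finally show ?thesis by simp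
qed

lemma norm_power4_cart_le: "norm v ^ 4 \<le> real CARD('d) * (\<Sum>j\<in>UNIV. (v $ j)^4)" for v :: "real^'d"
proof -
  have "norm v ^ 4 = (norm v ^ 2)^2" by simp
  also have "norm v ^ 2 = (\<Sum>j\<in>UNIV. (v $ j)^2)"
    by (simp add: norm_vec_def L2_set_def sum_nonneg)
  also have "(\<Sum>j\<in>UNIV. (v $ j)^2)^2 \<le> (\<Sum>j\<in>UNIV. ((v $ j)^2)^2) * real CARD('d)"
    by (rule sum_squared_le_sum_of_squares)
  finally show ?thesis by (simp add: mult.commute)
qed

text \<open>Interpolation at unit speed preserves fourth-moment bounds: besides the increment between grid
  points only the two boundary pieces enter, and these are short.\<close>

lemma polyval_increment4_le:
  fixes a :: "nat \<Rightarrow> 'a::real_normed_vector" and x y K :: real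
  assumes xy: "0 \<le> x" "x \<le> y" and step: "\<And>k. norm (a (Suc k) - a k) \<le> K"
  defines "m' \<equiv> nat \<lfloor>y\<rfloor>" and "m \<equiv> min (Suc (nat \<lfloor>x\<rfloor>)) (nat \<lfloor>y\<rfloor>)"
  shows "norm (polyval 1 a y - polyval 1 a x)^4 \<le> 64 * (2 * K^4 * (y - x)^2 + norm (a m' - a m)^4)"
    and "m \<le> m'" and "real (m' - m) \<le> y - x"
proof -
  have K: "0 \<le> K" using order_trans[OF norm_ge_zero step] .
  define p where "p = nat \<lfloor>x\<rfloor>"
  have p: "real p \<le> x" "x < real p + 1" and m': "real m' \<le> y" "y < real m' + 1"
    unfolding p_def m'_def using xy by (simp_all add: of_nat_nat)
  have pm': "p \<le> m'" unfolding p_def m'_def using xy by (intro nat_mono floor_mono)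
  have px: "polyval 1 a x = a p + (x - real p) *\<^sub>R (a (Suc p) - a p)"
    and py: "polyval 1 a y = a m' + (y - real m') *\<^sub>R (a (Suc m') - a m')"
    unfolding polyval_def Let_def p_def m'_def by simp_all
  show "m \<le> m'" unfolding m_def m'_def by simp
  have mp: "m = min (Suc p) m'" unfolding m_def m'_def p_def ..
  show "real (m' - m) \<le> y - x"
    unfolding mp using p m' xy by (auto simp: min_def of_nat_diff)
  have short: "(K * s)^4 \<le> K^4 * (y - x)^2" if "0 \<le> s" "s \<le> 1" "s \<le> y - x" for s
  proof -
    have "s^4 = s^2 * s^2" by (simp flip: power_add)
    also have "\<dots> \<le> 1 * (y - x)^2" using that by (intro mult_mono power_mono) (auto simp: power_le_one)
    finally show ?thesis using K by (simp add: power_mult_distrib mult_left_mono)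
  qed
  have pos: "0 \<le> K^4 * (y - x)^2" using K by simp
  show "norm (polyval 1 a y - polyval 1 a x)^4 \<le> 64 * (2 * K^4 * (y - x)^2 + norm (a m' - a m)^4)"
  proof (cases "p = m'")
    case True
    have "polyval 1 a y - polyval 1 a x = (y - x) *\<^sub>R (a (Suc p) - a p)"
      unfolding px py True by (simp add: algebra_simps)
    then have "norm (polyval 1 a y - polyval 1 a x) \<le> K * (y - x)"
      using mult_right_mono[OF step[of p], of "y - x"] xy by (simp add: mult.commute)
    then have "norm (polyval 1 a y - polyval 1 a x)^4 \<le> (K * (y - x))^4" by (intro power_mono) auto
    also have "\<dots> \<le> K^4 * (y - x)^2" by (rule short) (use xy p m' True in auto)
    finally have h: "norm (polyval 1 a y - polyval 1 a x)^4 \<le> K^4 * (y - x)^2" .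
    have "A \<le> 64 * (2 * P + Q)" if "A \<le> P" "0 \<le> P" "0 \<le> Q" for A P Q :: real
      using that by simp
    from this[OF h pos, of "norm (a m' - a m)^4"] show ?thesis by (simp only: mult.assoc) simp
  next
    case False
    then have "Suc p \<le> m'" using pm' by simp
    then have mS: "m = Suc p" unfolding mp by simp
    have le1: "real p + 1 \<le> real m'" using \<open>Suc p \<le> m'\<close> by (simp flip: of_nat_Suc)
    have eq: "polyval 1 a y - polyval 1 a x = (y - real m') *\<^sub>R (a (Suc m') - a m')
        + ((a m' - a m) + (real p + 1 - x) *\<^sub>R (a (Suc p) - a p))"
      unfolding px py mS by (simp add: algebra_simps)
    have "norm (polyval 1 a y - polyval 1 a x) \<le> K * (y - real m') + (norm (a m' - a m) + K * (real p + 1 - x))"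
      unfolding eq
    proof (rule norm_triangle_le, rule add_mono)
      show "norm ((y - real m') *\<^sub>R (a (Suc m') - a m')) \<le> K * (y - real m')"
        using mult_left_mono[OF step[of m'], of "y - real m'"] m' by (simp add: mult.commute)
      show "norm ((a m' - a m) + (real p + 1 - x) *\<^sub>R (a (Suc p) - a p)) \<le> norm (a m' - a m) + K * (real p + 1 - x)"
        using mult_left_mono[OF step[of p], of "real p + 1 - x"] p
        by (intro norm_triangle_le add_mono order_refl) (simp add: mult.commute)
    qed
    then have "norm (polyval 1 a y - polyval 1 a x)^4
        \<le> (K * (y - real m') + (norm (a m' - a m) + K * (real p + 1 - x)))^4" by (intro power_mono) auto
    also have "\<dots> \<le> 8 * ((K * (y - real m'))^4 + (norm (a m' - a m) + K * (real p + 1 - x))^4)"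
      by (rule power4_add_le)
    also have "\<dots> \<le> 8 * ((K * (y - real m'))^4 + 8 * (norm (a m' - a m)^4 + (K * (real p + 1 - x))^4))"
      by (intro mult_left_mono add_left_mono power4_add_le) simp
    also have "\<dots> \<le> 8 * (K^4 * (y - x)^2 + 8 * (norm (a m' - a m)^4 + K^4 * (y - x)^2))"
      by (intro mult_left_mono add_mono short order_refl) (use p m' le1 in auto)
    also have "\<dots> \<le> 64 * (2 * K^4 * (y - x)^2 + norm (a m' - a m)^4)"
      using pos by (simp add: mult.assoc)
    finally show ?thesis .
  qed
qed

context prob_space
begin

lemma integrable_nonneg_bound:
  fixes f g :: "'a \<Rightarrow> real"
  assumes "integrable M g" "f \<in> borel_measurable M" "\<And>x. 0 \<le> f x" "\<And>x. x \<in> space M \<Longrightarrow> f x \<le> g x"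
  shows "integrable M f"
proof (rule Bochner_Integration.integrable_bound[OF assms(1,2)])
  show "AE x in M. norm (f x) \<le> norm (g x)"
    using assms(3,4) by (intro AE_I2) (auto intro: order_trans[OF _ abs_ge_self])
qed

lemma indep_vars_inj:
  assumes ind: "indep_vars (\<lambda>_. borel) X I" and f: "inj_on f J" "f ` J \<subseteq> I"
  shows "indep_vars (\<lambda>_. borel) (\<lambda>j. X (f j)) J"
proof -
  have "indep_vars (\<lambda>j. PiM {f j} (\<lambda>_. borel)) (\<lambda>j \<omega>. restrict (\<lambda>i. X i \<omega>) {f j}) J"
    by (rule indep_vars_restrict[OF ind]) (use f in \<open>auto simp: disjoint_family_on_def inj_on_def\<close>)
  then have "indep_vars (\<lambda>_. borel) (\<lambda>j \<omega>. (\<lambda>g. g (f j)) (restrict (\<lambda>i. X i \<omega>) {f j})) J"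
    by (rule indep_vars_compose2) (rule measurable_component_singleton, simp)
  then show ?thesis by simp
qed

end

section \<open>Moment bounds for the excited random walk\<close>

context sqrt_erw
begin

definition K where
  "K = (SOME K. K > 0 \<and> (\<forall>n\<ge>1. \<forall>\<omega>\<in>space M. norm (\<xi> n \<omega>) \<le> K \<and> norm (\<gamma> n \<omega>) \<le> K))"

lemma K: "0 < K" "\<omega> \<in> space M \<Longrightarrow> norm (\<zeta> i \<omega>) \<le> K" "\<omega> \<in> space M \<Longrightarrow> norm (\<eta> i \<omega>) \<le> K"
proof -
  have "\<exists>K. K > 0 \<and> (\<forall>n\<ge>1. \<forall>\<omega>\<in>space M. norm (\<xi> n \<omega>) \<le> K \<and> norm (\<gamma> n \<omega>) \<le> K)"
    using uniformly_bounded by blast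
  from someI_ex[OF this] have "K > 0 \<and> (\<forall>n\<ge>1. \<forall>\<omega>\<in>space M. norm (\<xi> n \<omega>) \<le> K \<and> norm (\<gamma> n \<omega>) \<le> K)"
    unfolding K_def .
  then show "0 < K" "\<omega> \<in> space M \<Longrightarrow> norm (\<zeta> i \<omega>) \<le> K" "\<omega> \<in> space M \<Longrightarrow> norm (\<eta> i \<omega>) \<le> K"
    by (auto simp: \<zeta>_def \<eta>_def)
qed

lemma inner_l_le: "\<bar>v \<bullet> l\<bar> \<le> norm v"
  using Cauchy_Schwarz_ineq2[of v l] direction by simp

lemma integrable_steps: "integrable M (\<zeta> i)" "integrable M (\<eta> i)"
  by (rule integrable_const_bound[of _ K]; use K in \<open>auto intro!: AE_I2\<close>)+

lemma mean_\<zeta>: "expectation (\<lambda>\<omega>. \<zeta> i \<omega> \<bullet> v) = 0"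
  using mean_\<xi>(2)[of "Suc i"] integrable_steps(1)[of i] by (simp add: \<zeta>_def)

lemma indep_\<zeta>: "indep_vars (\<lambda>_. borel) \<zeta> UNIV"
  unfolding \<zeta>_def by (rule indep_vars_inj[OF iid_\<xi>(1)]) auto

lemma indep_u: "indep_vars (\<lambda>_. borel) u UNIV"
  unfolding u_def by (rule indep_vars_inj[OF iid_uniform(1)]) auto

definition excited :: "nat \<Rightarrow> 'a \<Rightarrow> real" where
  "excited i \<omega> = of_bool (u i \<omega> \<le> \<pi> i)"

lemma measurable_excited [measurable]: "excited i \<in> borel_measurable M"
  unfolding excited_def by measurable

lemma excited_01: "0 \<le> excited i \<omega>" "excited i \<omega> \<le> 1"
  by (auto simp: excited_def)

lemma integrable_excited [simp]: "integrable M (excited i)"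
  by (rule integrable_const_bound[of _ 1]) (auto simp: excited_def)

lemma \<pi>_bounds [simp]: "0 \<le> \<pi> i" "\<pi> i \<le> 1"
  using exc_prob_bounds(1)[OF C_pos] exc_prob_bounds(2) by auto

lemma expectation_excited: "expectation (excited i) = \<pi> i"
proof -
  let ?U = "uniform_measure lborel {0..1::real}"
  have law: "distr M borel (u i) = ?U" unfolding u_def by (rule iid_uniform(2)) simp
  have "expectation (excited i) = (\<integral>x. indicator {..\<pi> i} x \<partial>distr M borel (u i))"
    unfolding excited_def by (subst integral_distr) (auto simp: indicator_def of_bool_def)
  also have "\<dots> = measure ?U {..\<pi> i}" unfolding law by simp
  also have "{0..1} \<inter> {..\<pi> i} = {0..\<pi> i}"
    using exc_prob_bounds(2)[of C i] by auto
  then have "measure ?U {..\<pi> i} = \<pi> i"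
    by (simp add: measure_def emeasure_uniform_measure divide_ennreal_def)
  finally show ?thesis .
qed

lemma X_diff:
  assumes "\<omega> \<in> space M" "a \<le> b"
  shows "X b \<omega> - X a \<omega> = (\<Sum>i\<in>{a..<b}. \<zeta> i \<omega>)
    + (\<Sum>i\<in>{a..<b}. (of_bool (fresh i \<omega>) * excited i \<omega>) *\<^sub>R (\<eta> i \<omega> - \<zeta> i \<omega>))"
  using assms(2)
proof (induction b rule: dec_induct)
  case (step b)
  have "X (Suc b) \<omega> - X b \<omega> = \<zeta> b \<omega> + (of_bool (fresh b \<omega>) * excited b \<omega>) *\<^sub>R (\<eta> b \<omega> - \<zeta> b \<omega>)"
    unfolding X_Suc[OF assms(1)] by (auto simp: excited_def)
  then show ?case using step by (simp add: algebra_simps)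
qed simp

lemma X_step_le: "\<omega> \<in> space M \<Longrightarrow> norm (X (Suc n) \<omega> - X n \<omega>) \<le> K"
  using K by (auto simp: X_Suc)

definition c\<^sub>0 where
  "c\<^sub>0 = 8 * (real CARD('d) * (real CARD('d) * (3 * K^4)) + (2 * K)^4 * (8 * (3 + (2 * C)^4)))"

lemma norm_sum_\<zeta>_moment4:
  "integrable M (\<lambda>\<omega>. norm (\<Sum>i\<in>{a..<b}. \<zeta> i \<omega>)^4)"
  "expectation (\<lambda>\<omega>. norm (\<Sum>i\<in>{a..<b}. \<zeta> i \<omega>)^4) \<le> real CARD('d) * (real CARD('d) * (3 * K^4)) * (real (b - a))\<^sup>2"
proof -
  let ?S = "\<lambda>\<omega>. \<Sum>i\<in>{a..<b}. \<zeta> i \<omega>"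
  have Sb: "norm (?S \<omega>) \<le> real (b - a) * K" if "\<omega> \<in> space M" for \<omega>
    using sum_norm_bound[of "{a..<b}" "\<lambda>i. \<zeta> i \<omega>" K] K(2)[OF that] by simp
  show int: "integrable M (\<lambda>\<omega>. norm (?S \<omega>)^4)"
    by (rule integrable_power_bounded[of _ "real (b - a) * K"]) (use Sb in auto)
  have comp: "integrable M (\<lambda>\<omega>. (?S \<omega> $ j)^4)"
    "expectation (\<lambda>\<omega>. (?S \<omega> $ j)^4) \<le> 3 * K^4 * (real (b - a))\<^sup>2" for j
  proof -
    have meas: "(\<lambda>\<omega>. ?S \<omega> $ j) \<in> borel_measurable M"
      by (rule measurable_compose[of _ M borel]) (auto intro!: borel_measurable_sum borel_measurable_continuous_onI continuous_intros)
    show "integrable M (\<lambda>\<omega>. (?S \<omega> $ j)^4)"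
      by (rule integrable_power_bounded[OF meas, of "real (b - a) * K"])
         (use Sb component_le_norm_cart order_trans in blast)
    have nth: "(\<lambda>v :: real^'d. v $ j) \<in> borel_measurable borel"
      by (auto intro!: borel_measurable_continuous_onI continuous_intros)
    have "expectation (\<lambda>\<omega>. (\<Sum>i\<in>{a..<b}. \<zeta> i \<omega> $ j)^4) \<le> 3 * K^4 * (real (card {a..<b}))\<^sup>2"
    proof (rule sum_indep_moments(1))
      show "indep_vars (\<lambda>_. borel) (\<lambda>i \<omega>. \<zeta> i \<omega> $ j) {a..<b}"
        by (rule indep_vars_compose2[OF indep_vars_subset[OF indep_\<zeta>] nth]) simp
      show "expectation (\<lambda>\<omega>. \<zeta> i \<omega> $ j) = 0" for i
        using mean_\<zeta>[of i "axis j 1"] by (simp add: inner_axis)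
      show "\<bar>\<zeta> i \<omega> $ j\<bar> \<le> K" if "\<omega> \<in> space M" for i \<omega>
        using component_le_norm_cart K(2)[OF that] order_trans by blast
    qed simp
    then show "expectation (\<lambda>\<omega>. (?S \<omega> $ j)^4) \<le> 3 * K^4 * (real (b - a))\<^sup>2" by simp
  qed
  have "expectation (\<lambda>\<omega>. norm (?S \<omega>)^4) \<le> expectation (\<lambda>\<omega>. real CARD('d) * (\<Sum>j\<in>UNIV. (?S \<omega> $ j)^4))"
    by (intro integral_mono int norm_power4_cart_le) (use comp in auto)
  also have "\<dots> = real CARD('d) * (\<Sum>j\<in>UNIV. expectation (\<lambda>\<omega>. (?S \<omega> $ j)^4))"
    using comp(1) by (simp del: sum_component)
  also have "\<dots> \<le> real CARD('d) * (\<Sum>j\<in>(UNIV :: 'd set). 3 * K^4 * (real (b - a))\<^sup>2)"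
    by (intro mult_left_mono sum_mono comp(2)) simp
  finally show "expectation (\<lambda>\<omega>. norm (?S \<omega>)^4) \<le> real CARD('d) * (real CARD('d) * (3 * K^4)) * (real (b - a))\<^sup>2"
    by (simp add: mult_ac)
qed

lemma sum_excited_moment4:
  assumes "a \<le> b"
  shows "integrable M (\<lambda>\<omega>. (\<Sum>i\<in>{a..<b}. excited i \<omega>)^4)"
    "expectation (\<lambda>\<omega>. (\<Sum>i\<in>{a..<b}. excited i \<omega>)^4) \<le> 8 * (3 + (2 * C)^4) * (real (b - a))\<^sup>2"
proof -
  let ?N = "\<lambda>\<omega>. \<Sum>i\<in>{a..<b}. excited i \<omega>"
  let ?c = "\<lambda>\<omega>. \<Sum>i\<in>{a..<b}. excited i \<omega> - \<pi> i"
  have c1: "\<bar>excited i \<omega> - \<pi> i\<bar> \<le> 1" for i \<omega>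
    using excited_01[of i \<omega>] \<pi>_bounds[of i] by linarith
  show int: "integrable M (\<lambda>\<omega>. ?N \<omega>^4)"
  proof (rule integrable_power_bounded)
    show "\<bar>?N \<omega>\<bar> \<le> real (b - a)" for \<omega>
      using sum_norm_bound[of "{a..<b}" "\<lambda>i. excited i \<omega>" 1] excited_01 by simp
  qed measurable
  have intc: "integrable M (\<lambda>\<omega>. ?c \<omega>^4)"
  proof (rule integrable_power_bounded)
    show "\<bar>?c \<omega>\<bar> \<le> real (b - a)" for \<omega>
      using sum_norm_bound[of "{a..<b}" "\<lambda>i. excited i \<omega> - \<pi> i" 1] c1 by simp
  qed measurable
  have Ec: "expectation (\<lambda>\<omega>. ?c \<omega>^4) \<le> 3 * 1^4 * (real (card {a..<b}))\<^sup>2"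
  proof (rule sum_indep_moments(1))
    show "indep_vars (\<lambda>_. borel) (\<lambda>i \<omega>. excited i \<omega> - \<pi> i) {a..<b}"
      unfolding excited_def
      by (rule indep_vars_compose2[OF indep_vars_subset[OF indep_u], where Y = "\<lambda>i t. of_bool (t \<le> \<pi> i) - \<pi> i"]) auto
    show "expectation (\<lambda>\<omega>. excited i \<omega> - \<pi> i) = 0" for i
      by (simp add: expectation_excited prob_space)
  qed (auto simp: c1)
  have \<pi>s: "0 \<le> (\<Sum>i\<in>{a..<b}. \<pi> i)" by (simp add: sum_nonneg)
  have "(\<Sum>i\<in>{a..<b}. \<pi> i)^4 \<le> (2 * C * sqrt (real (b - a)))^4"
    using sum_exc_prob_le[OF C_pos assms] \<pi>s by (intro power_mono)
  also have "\<dots> = (2 * C)^4 * (real (b - a))\<^sup>2"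
  proof -
    have "sqrt (real (b - a))^4 = (sqrt (real (b - a))^2)^2" by (simp only: flip: power_mult) simp
    then show ?thesis by (simp add: power_mult_distrib)
  qed
  finally have pi4: "(\<Sum>i\<in>{a..<b}. \<pi> i)^4 \<le> (2 * C)^4 * (real (b - a))\<^sup>2" .
  have "expectation (\<lambda>\<omega>. ?N \<omega>^4) \<le> expectation (\<lambda>\<omega>. 8 * (?c \<omega>^4 + (\<Sum>i\<in>{a..<b}. \<pi> i)^4))"
  proof (rule integral_mono[OF int])
    show "?N \<omega>^4 \<le> 8 * (?c \<omega>^4 + (\<Sum>i\<in>{a..<b}. \<pi> i)^4)" for \<omega>
      using power4_add_le[of "?c \<omega>" "\<Sum>i\<in>{a..<b}. \<pi> i"] by (simp add: sum_subtractf)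
  qed (use intc in auto)
  also have "\<dots> = 8 * (expectation (\<lambda>\<omega>. ?c \<omega>^4) + (\<Sum>i\<in>{a..<b}. \<pi> i)^4)"
    using intc by (simp add: prob_space)
  also have "\<dots> \<le> 8 * (3 * (real (b - a))\<^sup>2 + (2 * C)^4 * (real (b - a))\<^sup>2)"
    using Ec pi4 by (intro mult_left_mono add_mono) auto
  finally show "expectation (\<lambda>\<omega>. ?N \<omega>^4) \<le> 8 * (3 + (2 * C)^4) * (real (b - a))\<^sup>2"
    by (simp add: algebra_simps)
qed

text \<open>The square-root decay of the excitation probabilities makes the number of excitations in a time
  window of length \<open>n\<close> at most of order \<open>sqrt n\<close>, just like the fluctuations of the walk itself.\<close>

lemma X_moment4:
  assumes "a \<le> b"
  shows "integrable M (\<lambda>\<omega>. norm (X b \<omega> - X a \<omega>)^4)"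
    and "expectation (\<lambda>\<omega>. norm (X b \<omega> - X a \<omega>)^4) \<le> c\<^sub>0 * (real (b - a))\<^sup>2"
proof -
  let ?S = "\<lambda>\<omega>. norm (\<Sum>i\<in>{a..<b}. \<zeta> i \<omega>)"
  let ?N = "\<lambda>\<omega>. \<Sum>i\<in>{a..<b}. excited i \<omega>"
  have le: "norm (X b \<omega> - X a \<omega>)^4 \<le> 8 * (?S \<omega>^4 + (2 * K)^4 * ?N \<omega>^4)" if \<omega>: "\<omega> \<in> space M" for \<omega>
  proof -
    have "norm (\<Sum>i\<in>{a..<b}. (of_bool (fresh i \<omega>) * excited i \<omega>) *\<^sub>R (\<eta> i \<omega> - \<zeta> i \<omega>)) \<le> (\<Sum>i\<in>{a..<b}. 2 * K * excited i \<omega>)"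
    proof (rule sum_norm_le)
      fix i
      have "norm (\<eta> i \<omega> - \<zeta> i \<omega>) \<le> 2 * K"
        using norm_triangle_ineq4[of "\<eta> i \<omega>" "\<zeta> i \<omega>"] K(2,3)[OF \<omega>, of i] by simp
      moreover have "0 \<le> of_bool (fresh i \<omega>) * excited i \<omega>" "of_bool (fresh i \<omega>) * excited i \<omega> \<le> excited i \<omega>"
        using excited_01[of i \<omega>] by auto
      ultimately have "(of_bool (fresh i \<omega>) * excited i \<omega>) * norm (\<eta> i \<omega> - \<zeta> i \<omega>) \<le> excited i \<omega> * (2 * K)"
        using excited_01 by (intro mult_mono) auto
      then show "norm ((of_bool (fresh i \<omega>) * excited i \<omega>) *\<^sub>R (\<eta> i \<omega> - \<zeta> i \<omega>)) \<le> 2 * K * excited i \<omega>"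
        using excited_01[of i \<omega>] by (simp add: mult_ac)
    qed
    then have "norm (X b \<omega> - X a \<omega>) \<le> ?S \<omega> + 2 * K * ?N \<omega>"
      unfolding X_diff[OF \<omega> assms] sum_distrib_left by (intro norm_triangle_le add_left_mono)
    then have "norm (X b \<omega> - X a \<omega>)^4 \<le> (?S \<omega> + 2 * K * ?N \<omega>)^4" by (intro power_mono) auto
    also have "\<dots> \<le> 8 * (?S \<omega>^4 + (2 * K * ?N \<omega>)^4)" by (rule power4_add_le)
    finally show ?thesis by (simp add: power_mult_distrib)
  qed
  have intd: "integrable M (\<lambda>\<omega>. 8 * (?S \<omega>^4 + (2 * K)^4 * ?N \<omega>^4))"
    using norm_sum_\<zeta>_moment4(1) sum_excited_moment4(1)[OF assms] by auto
  show int: "integrable M (\<lambda>\<omega>. norm (X b \<omega> - X a \<omega>)^4)"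
    by (rule integrable_nonneg_bound[OF intd _ _ le]) auto
  have "expectation (\<lambda>\<omega>. norm (X b \<omega> - X a \<omega>)^4) \<le> expectation (\<lambda>\<omega>. 8 * (?S \<omega>^4 + (2 * K)^4 * ?N \<omega>^4))"
    by (intro integral_mono int intd le)
  also have "\<dots> = 8 * (expectation (\<lambda>\<omega>. ?S \<omega>^4) + (2 * K)^4 * expectation (\<lambda>\<omega>. ?N \<omega>^4))"
    using norm_sum_\<zeta>_moment4(1) sum_excited_moment4(1)[OF assms] by simp
  also have "\<dots> \<le> 8 * (real CARD('d) * (real CARD('d) * (3 * K^4)) * (real (b - a))\<^sup>2
      + (2 * K)^4 * (8 * (3 + (2 * C)^4) * (real (b - a))\<^sup>2))"
    by (intro mult_left_mono add_mono norm_sum_\<zeta>_moment4(2) sum_excited_moment4(2)[OF assms]) auto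
  finally show "expectation (\<lambda>\<omega>. norm (X b \<omega> - X a \<omega>)^4) \<le> c\<^sub>0 * (real (b - a))\<^sup>2"
    by (simp add: c\<^sub>0_def algebra_simps)
qed

lemma c\<^sub>0_nonneg: "0 \<le> c\<^sub>0"
  unfolding c\<^sub>0_def using K(1) C_pos by (intro mult_nonneg_nonneg add_nonneg_nonneg) auto

lemma rescaled_path_polygon: "rescaled_path X n \<omega> = polygon (real n) (\<lambda>k. X k \<omega> /\<^sub>R sqrt (real n))"
  unfolding rescaled_path_def polygon_def polyval_def by (simp add: scaleR_diff_right)

lemma measurable_rescaled_path [measurable]: "rescaled_path X n \<in> borel_measurable M"
  unfolding rescaled_path_polygon[abs_def] by (rule measurable_polygon) auto

definition c\<^sub>1 where "c\<^sub>1 = 64 * (2 * K^4 + c\<^sub>0)"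

lemma c\<^sub>1_nonneg: "0 \<le> c\<^sub>1"
  unfolding c\<^sub>1_def using K(1) c\<^sub>0_nonneg by simp

lemma rescaled_path_start: "\<omega> \<in> space M \<Longrightarrow> path_at (rescaled_path X n \<omega>) 0 = 0"
  by (simp add: rescaled_path_polygon path_at_polygon polyval_def X_0)

text \<open>Space and time are scaled as for Brownian motion, hence the constant does not depend on \<open>n\<close>.\<close>

lemma rescaled_path_moment4:
  assumes n: "n \<ge> 1"
  shows "moment4 M c\<^sub>1 (rescaled_path X n)"
  unfolding moment4_def
proof (intro allI)
  fix i k :: nat
  define x where "x = real n * (real k / 2^i)"
  define y where "y = real n * (real (Suc k) / 2^i)"
  have xy: "0 \<le> x" "x \<le> y" unfolding x_def y_def by (auto intro!: mult_left_mono divide_right_mono)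
  have yx: "y - x = real n / 2^i" unfolding x_def y_def by (simp add: field_simps)
  define m' where "m' = nat \<lfloor>y\<rfloor>"
  define m where "m = min (Suc (nat \<lfloor>x\<rfloor>)) (nat \<lfloor>y\<rfloor>)"
  let ?D = "\<lambda>\<omega>. norm (X m' \<omega> - X m \<omega>)^4"
  let ?r = "real n"
  have rn: "0 < ?r" using n by simp
  have s4: "sqrt ?r ^ 4 = ?r^2"
  proof -
    have "sqrt ?r ^ 4 = (sqrt ?r ^ 2)^2" by (simp only: flip: power_mult) simp
    then show ?thesis using rn by simp
  qed
  have mm: "m \<le> m'" "real (m' - m) \<le> y - x"
    using polyval_increment4_le(2,3)[OF xy, of "\<lambda>_. 0 :: real" 0] unfolding m_def m'_def by auto
  have le: "dyadic_incr i k (rescaled_path X n \<omega>)^4 \<le> 64 * (2 * K^4 * (y - x)^2 + ?D \<omega>) / ?r^2"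
    if \<omega>: "\<omega> \<in> space M" for \<omega>
  proof -
    have scale: "polyval ?r (\<lambda>k. X k \<omega> /\<^sub>R sqrt ?r) t = polyval 1 (\<lambda>k. X k \<omega>) (?r * t) /\<^sub>R sqrt ?r" for t
      by (simp add: polyval_def Let_def scaleR_add_right scaleR_diff_right mult.commute)
    have "path_at (rescaled_path X n \<omega>) (real (Suc k) / 2^i) - path_at (rescaled_path X n \<omega>) (real k / 2^i)
        = (polyval 1 (\<lambda>k. X k \<omega>) y - polyval 1 (\<lambda>k. X k \<omega>) x) /\<^sub>R sqrt ?r"
      unfolding rescaled_path_polygon x_def y_def
      by (simp only: path_at_polygon of_nat_0_le_iff divide_nonneg_nonneg zero_le_power zero_le_numeral scale scaleR_diff_right)
    then have "dyadic_incr i k (rescaled_path X n \<omega>)^4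
        = norm (polyval 1 (\<lambda>k. X k \<omega>) y - polyval 1 (\<lambda>k. X k \<omega>) x)^4 / ?r^2"
      unfolding dyadic_incr_def using rn by (simp add: power_mult_distrib power_inverse s4 divide_inverse mult.commute)
    also have "\<dots> \<le> 64 * (2 * K^4 * (y - x)^2 + ?D \<omega>) / ?r^2"
      unfolding m_def m'_def
      by (intro divide_right_mono polyval_increment4_le(1)[OF xy] X_step_le \<omega>) simp
    finally show ?thesis .
  qed
  have intd: "integrable M (\<lambda>\<omega>. 64 * (2 * K^4 * (y - x)^2 + ?D \<omega>) / ?r^2)"
    using X_moment4(1)[OF mm(1)] by auto
  have int: "integrable M (\<lambda>\<omega>. dyadic_incr i k (rescaled_path X n \<omega>)^4)"
    by (rule integrable_nonneg_bound[OF intd _ _ le]) auto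
  have "expectation (\<lambda>\<omega>. dyadic_incr i k (rescaled_path X n \<omega>)^4)
      \<le> expectation (\<lambda>\<omega>. 64 * (2 * K^4 * (y - x)^2 + ?D \<omega>) / ?r^2)"
    by (intro integral_mono int intd le)
  also have "\<dots> = 64 * (2 * K^4 * (y - x)^2 + expectation ?D) / ?r^2"
    using X_moment4(1)[OF mm(1)] by (simp add: prob_space)
  also have "\<dots> \<le> 64 * (2 * K^4 * (y - x)^2 + c\<^sub>0 * (y - x)^2) / ?r^2"
  proof (intro divide_right_mono mult_left_mono add_left_mono)
    have "expectation ?D \<le> c\<^sub>0 * (real (m' - m))\<^sup>2" by (rule X_moment4(2)[OF mm(1)])
    also have "\<dots> \<le> c\<^sub>0 * (y - x)^2"
      using mm(2) c\<^sub>0_nonneg by (intro mult_left_mono power_mono) auto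
    finally show "expectation ?D \<le> c\<^sub>0 * (y - x)^2" .
  qed auto
  also have "\<dots> = c\<^sub>1 / 4^i"
  proof -
    have "(4::real)^i = 2^i * 2^i" by (simp flip: power_mult_distrib)
    then show ?thesis unfolding yx c\<^sub>1_def using rn by (simp add: power_divide field_simps power2_eq_square)
  qed
  finally show "integrable M (\<lambda>\<omega>. dyadic_incr i k (rescaled_path X n \<omega>)^4)
      \<and> expectation (\<lambda>\<omega>. dyadic_incr i k (rescaled_path X n \<omega>)^4) \<le> c\<^sub>1 / 4^i"
    using int by simp
qed

end

section \<open>The drift of the excited random walk\<close>

context sqrt_erw
begin

definition \<mu> where "\<mu> = expectation (\<lambda>\<omega>. \<gamma> 1 \<omega> \<bullet> l)"

lemma mean_\<eta>: "expectation (\<lambda>\<omega>. \<eta> i \<omega> \<bullet> l) = \<mu>"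
proof -
  have d: "expectation (\<lambda>\<omega>. \<gamma> n \<omega> \<bullet> l) = (\<integral>v. v \<bullet> l \<partial>distr M borel (\<gamma> n))" if "n \<ge> 1" for n
    using iid_\<gamma>(1) that by (subst integral_distr) (auto simp: indep_vars_def2)
  show ?thesis unfolding \<eta>_def \<mu>_def using d[of "Suc i"] d[of 1] iid_\<gamma>(2)[of "Suc i"] by simp
qed

lemma \<mu>_nonneg: "0 \<le> \<mu>"
proof -
  obtain c where c: "c > 0" "\<And>n. n \<ge> 1 \<Longrightarrow> AE \<omega> in M. real_cond_exp M (F (n - 1)) (\<lambda>\<omega>. \<gamma> n \<omega> \<bullet> l) \<omega> \<ge> c"
    using cond_drift_\<gamma> by blast
  have "finite_measure_subalgebra M (F 0)"
    using filtration(2)[of 0] finite_measure_axioms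
    by (simp add: finite_measure_subalgebra_def finite_measure_subalgebra_axioms_def)
  then interpret finite_measure_subalgebra M "F 0" .
  have int: "integrable M (\<lambda>\<omega>. \<gamma> 1 \<omega> \<bullet> l)"
    using integrable_steps(2)[of 0] by (simp add: \<eta>_def)
  have "0 \<le> expectation (real_cond_exp M (F 0) (\<lambda>\<omega>. \<gamma> 1 \<omega> \<bullet> l))"
    by (rule integral_nonneg_AE) (use c(2)[of 1] c(1) in \<open>auto elim!: eventually_mono\<close>)
  also have "\<dots> = \<mu>" unfolding \<mu>_def by (rule real_cond_exp_int(2)[OF int])
  finally show ?thesis .
qed

lemma \<mu>_le: "\<mu> \<le> K"
proof -
  have "\<mu> \<le> expectation (\<lambda>\<omega>. K)"
    unfolding mean_\<eta>[of 0, symmetric]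
  proof (rule integral_mono)
    show "\<eta> 0 \<omega> \<bullet> l \<le> K" if "\<omega> \<in> space M" for \<omega>
      using inner_l_le[of "\<eta> 0 \<omega>"] K(3)[OF that, of 0] by simp
  qed (use integrable_steps(2) in auto)
  then show ?thesis by (simp add: prob_space)
qed

text \<open>The centred contribution of the \<open>i\<close>-th step, were it taken from a fresh site.\<close>

definition V where "V i \<omega> = excited i \<omega> * ((\<eta> i \<omega> - \<zeta> i \<omega>) \<bullet> l) - \<mu> * \<pi> i"

lemma measurable_V [measurable]: "V i \<in> borel_measurable M"
  unfolding V_def by measurable

lemma inner_diff_le: "\<omega> \<in> space M \<Longrightarrow> \<bar>(\<eta> i \<omega> - \<zeta> i \<omega>) \<bullet> l\<bar> \<le> 2 * K"
  using inner_l_le[of "\<eta> i \<omega> - \<zeta> i \<omega>"] norm_triangle_ineq4[of "\<eta> i \<omega>" "\<zeta> i \<omega>"] K(2,3)[of \<omega> i] by simp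

lemma V_le: "\<omega> \<in> space M \<Longrightarrow> \<bar>V i \<omega>\<bar> \<le> 3 * K"
proof -
  assume \<omega>: "\<omega> \<in> space M"
  have "\<bar>excited i \<omega> * ((\<eta> i \<omega> - \<zeta> i \<omega>) \<bullet> l)\<bar> \<le> 1 * (2 * K)"
    unfolding abs_mult using excited_01[of i \<omega>] inner_diff_le[OF \<omega>] by (intro mult_mono) auto
  moreover have "\<bar>\<mu> * \<pi> i\<bar> \<le> K * 1"
    unfolding abs_mult using \<mu>_nonneg \<mu>_le by (intro mult_mono) auto
  ultimately show ?thesis unfolding V_def by linarith
qed

lemma integrable_V: "integrable M (V i)"
  using integrable_power_bounded[OF measurable_V V_le, of i 1] by simp

lemma excited_meas: "(i, 2) \<in> A \<Longrightarrow> excited i \<in> borel_measurable (step_algebra A)"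
  unfolding excited_def using measurable_step_algebra_steps(3)[of i A] by measurable

lemma mean_V: "expectation (V i) = 0"
proof -
  have m: "(\<lambda>\<omega>. (\<eta> i \<omega> - \<zeta> i \<omega>) \<bullet> l) \<in> borel_measurable (step_algebra {(i, 0), (i, 1)})"
    using measurable_step_algebra_steps(1,2)[of i "{(i, 0), (i, 1)}"] by measurable
  have int: "integrable M (\<lambda>\<omega>. (\<eta> i \<omega> - \<zeta> i \<omega>) \<bullet> l)"
    using integrable_steps by auto
  have "expectation (\<lambda>\<omega>. excited i \<omega> * ((\<eta> i \<omega> - \<zeta> i \<omega>) \<bullet> l))
      = expectation (excited i) * expectation (\<lambda>\<omega>. (\<eta> i \<omega> - \<zeta> i \<omega>) \<bullet> l)"
    by (rule step_algebra_indep[OF _ _ _ excited_meas m, of "{(i, 2)}"]) (use int in auto)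
  also have "expectation (\<lambda>\<omega>. (\<eta> i \<omega> - \<zeta> i \<omega>) \<bullet> l) = \<mu>"
    using integrable_steps[of i] by (simp add: inner_diff_left mean_\<eta> mean_\<zeta>)
  finally have e: "expectation (\<lambda>\<omega>. excited i \<omega> * ((\<eta> i \<omega> - \<zeta> i \<omega>) \<bullet> l)) = \<mu> * \<pi> i"
    by (simp add: expectation_excited)
  have "integrable M (\<lambda>\<omega>. V i \<omega> + \<mu> * \<pi> i)" using integrable_V by auto
  then have "integrable M (\<lambda>\<omega>. excited i \<omega> * ((\<eta> i \<omega> - \<zeta> i \<omega>) \<bullet> l))" by (simp add: V_def)
  then show ?thesis unfolding V_def by (simp add: e prob_space)
qed

lemma second_moment_V: "expectation (\<lambda>\<omega>. (V i \<omega>)\<^sup>2) \<le> 10 * K\<^sup>2 * \<pi> i"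
proof -
  have "expectation (\<lambda>\<omega>. (V i \<omega>)\<^sup>2) \<le> expectation (\<lambda>\<omega>. 8 * K\<^sup>2 * excited i \<omega> + 2 * K\<^sup>2 * \<pi> i)"
  proof (rule integral_mono)
    show "integrable M (\<lambda>\<omega>. (V i \<omega>)\<^sup>2)" by (rule integrable_power_bounded[OF measurable_V V_le])
    fix \<omega> assume \<omega>: "\<omega> \<in> space M"
    let ?d = "(\<eta> i \<omega> - \<zeta> i \<omega>) \<bullet> l"
    have sq: "(a - b)\<^sup>2 \<le> 2 * a\<^sup>2 + 2 * b\<^sup>2" for a b :: real
      using sum_squares_bound[of a "- b"] by (simp add: power2_eq_square algebra_simps)
    have "(V i \<omega>)\<^sup>2 \<le> 2 * (excited i \<omega> * ?d)\<^sup>2 + 2 * (\<mu> * \<pi> i)\<^sup>2" unfolding V_def by (rule sq)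
    also have "(excited i \<omega> * ?d)\<^sup>2 \<le> excited i \<omega> * (4 * K\<^sup>2)"
    proof -
      have "(excited i \<omega> * ?d)\<^sup>2 = excited i \<omega> * \<bar>?d\<bar>\<^sup>2"
        by (simp add: excited_def power_mult_distrib)
      also have "\<dots> \<le> excited i \<omega> * (2 * K)\<^sup>2"
        using inner_diff_le[OF \<omega>] excited_01 by (intro mult_left_mono power_mono) auto
      finally show ?thesis by (simp add: power_mult_distrib)
    qed
    also have "(\<mu> * \<pi> i)\<^sup>2 \<le> K\<^sup>2 * \<pi> i"
    proof -
      have "(\<pi> i)\<^sup>2 \<le> \<pi> i" by (simp add: power2_eq_square mult_left_le)
      then show ?thesis
        unfolding power_mult_distrib using \<mu>_nonneg \<mu>_le by (intro mult_mono power_mono) auto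
    qed
    finally show "(V i \<omega>)\<^sup>2 \<le> 8 * K\<^sup>2 * excited i \<omega> + 2 * K\<^sup>2 * \<pi> i" by (simp add: mult_ac)
  qed (use integrable_excited in auto)
  also have "\<dots> = 10 * K\<^sup>2 * \<pi> i" by (simp add: expectation_excited prob_space)
  finally show ?thesis .
qed

definition fluct where "fluct m \<omega> = (\<Sum>i<m. of_bool (fresh i \<omega>) * V i \<omega>)"

lemma past_measurable:
  "X k \<in> borel_measurable (step_algebra ({..<n} \<times> {..<3}))" if "k \<le> n"
  by (rule measurable_X_gen[of _ n, OF _ _ _ _ that]) (auto intro!: measurable_step_algebra_steps)

lemma fresh_measurable: "k \<le> n \<Longrightarrow> Measurable.pred (step_algebra ({..<n} \<times> {..<3})) (fresh k)"
  by (rule measurable_fresh_gen) (rule past_measurable, simp)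

lemma V_measurable: "{(i, 0), (i, 1), (i, 2)} \<subseteq> A \<Longrightarrow> V i \<in> borel_measurable (step_algebra A)"
  unfolding V_def using measurable_step_algebra_steps(1,2)[of i A] excited_meas[of i A] by measurable

text \<open>Whether a site is fresh is decided before the next step is drawn, so \<open>fluct\<close> is a martingale; since
  only excitations contribute, its variance is of order \<open>sqrt m\<close>.\<close>

lemma fluct_moment:
  "integrable M (fluct m)" "expectation (\<lambda>\<omega>. \<bar>fluct m \<omega>\<bar>) \<le> sqrt (20 * K\<^sup>2 * (\<Sum>i<m. \<pi> i))"
proof -
  let ?w = "\<lambda>i \<omega>. of_bool (fresh i \<omega>) * V i \<omega>"
  have wm: "?w i \<in> borel_measurable M" for i by measurable
  have bound: "\<bar>?w i \<omega>\<bar> \<le> 3 * K" if "\<omega> \<in> space M" for i \<omega>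
    using V_le[OF that, of i] K(1) by simp
  have second: "expectation (\<lambda>\<omega>. (?w i \<omega>)\<^sup>2) \<le> 10 * K\<^sup>2 * \<pi> i" for i
  proof -
    have "expectation (\<lambda>\<omega>. (?w i \<omega>)\<^sup>2) \<le> expectation (\<lambda>\<omega>. (V i \<omega>)\<^sup>2)"
      by (rule integral_mono'[OF integrable_power_bounded[OF measurable_V V_le]]) (auto simp: power_mult_distrib)
    then show ?thesis using second_moment_V[of i] by simp
  qed
  have indep: "expectation (\<lambda>\<omega>. ?w i \<omega> * ?w k \<omega>) = 0" if "i + 1 \<le> k" for i k
  proof -
    let ?H = "\<lambda>\<omega>. ?w i \<omega> * of_bool (fresh k \<omega>)"
    have "expectation (\<lambda>\<omega>. ?H \<omega> * V k \<omega>) = expectation ?H * expectation (V k)"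
    proof (rule step_algebra_indep)
      show "({..<k} \<times> {..<3}) \<inter> ({k} \<times> {..<3::nat}) = {}" by auto
      have [measurable]: "Measurable.pred (step_algebra ({..<k} \<times> {..<3})) (fresh i)"
        "Measurable.pred (step_algebra ({..<k} \<times> {..<3})) (fresh k)"
        using that by (auto intro!: fresh_measurable)
      have [measurable]: "V i \<in> borel_measurable (step_algebra ({..<k} \<times> {..<3}))"
        by (rule V_measurable) (use that in auto)
      show "?H \<in> borel_measurable (step_algebra ({..<k} \<times> {..<3}))" by measurable
      show "V k \<in> borel_measurable (step_algebra ({k} \<times> {..<3}))" by (rule V_measurable) auto
      show "integrable M ?H"
        by (rule integrable_const_bound[of _ "3 * K"]) (use V_le K(1) in auto)
    qed (auto intro: integrable_V)
    then show ?thesis by (simp add: mean_V mult_ac)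
  qed
  note wd = weakly_dependent_second_moment[of "{..<m}" ?w "3 * K" "\<lambda>i. 10 * K\<^sup>2 * \<pi> i" 1, OF wm _ bound second indep]
  have "integrable M (\<lambda>\<omega>. \<Sum>i<m. ?w i \<omega>)" by (rule wd(2)) auto
  then show int: "integrable M (fluct m)" unfolding fluct_def .
  have "expectation (\<lambda>\<omega>. \<bar>\<Sum>i<m. ?w i \<omega>\<bar>) \<le> sqrt (2 * real 1 * (\<Sum>i<m. 10 * K\<^sup>2 * \<pi> i))"
    by (rule expectation_abs_le_sqrt[OF wd(2) wd(3) wd(1)]) auto
  then show "expectation (\<lambda>\<omega>. \<bar>fluct m \<omega>\<bar>) \<le> sqrt (20 * K\<^sup>2 * (\<Sum>i<m. \<pi> i))"
    by (simp add: fluct_def sum_distrib_left[symmetric] mult.assoc)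
qed

text \<open>Looking back only \<open>q\<close> times makes the event depend on \<open>q\<close> steps of \<open>Y\<close>, so that distant sites are
  independent, at the price of a probability slightly above the escape probability.\<close>

definition new_site where
  "new_site q i \<omega> \<longleftrightarrow> (\<forall>j\<in>{1..q}. (\<Sum>k\<in>{i - j..<i}. \<zeta> k \<omega>) \<noteq> 0)"

definition escape_upto where
  "escape_upto q = prob {\<omega> \<in> space M. \<forall>j\<in>{1..q}. Y j \<omega> \<noteq> 0}"

lemma new_site_gen:
  assumes "\<And>k. i - q \<le> k \<Longrightarrow> k < i \<Longrightarrow> \<zeta> k \<in> borel_measurable N"
  shows "Measurable.pred N (new_site q i)"
proof -
  have "{\<omega> \<in> space N. \<forall>j\<in>{1..q}. (\<Sum>k\<in>{i - j..<i}. \<zeta> k \<omega>) \<noteq> 0} \<in> sets N"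
    by (rule sets.sets_Collect_finite_All) (intro sets_Collect_neq borel_measurable_sum assms, auto)
  moreover have "new_site q i = (\<lambda>\<omega>. \<forall>j\<in>{1..q}. (\<Sum>k\<in>{i - j..<i}. \<zeta> k \<omega>) \<noteq> 0)"
    by (auto simp: new_site_def fun_eq_iff)
  ultimately show ?thesis by (simp only: pred_def)
qed

lemma measurable_new_site [measurable]: "Measurable.pred M (new_site q i)"
  by (rule new_site_gen) simp

lemma law_\<zeta>: "distr M borel (\<zeta> i) = distr M borel (\<zeta> 0)"
  unfolding \<zeta>_def by (rule trans[OF iid_\<xi>(2) iid_\<xi>(2)[symmetric]]) auto

text \<open>Time reversal: the last \<open>q\<close> steps before time \<open>i\<close>, read backwards, have the law of the first \<open>q\<close>
  steps.\<close>

lemma prob_new_site: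
  assumes "q \<le> i"
  shows "expectation (\<lambda>\<omega>. of_bool (new_site q i \<omega>)) = escape_upto q"
proof (cases "q = 0")
  case True
  then show ?thesis by (simp add: new_site_def escape_upto_def prob_space)
next
  case False
  define L where "L = PiM {..<q} (\<lambda>_. borel :: (real^'d) measure)"
  define R where "R a \<longleftrightarrow> (\<forall>j\<in>{1..q}. (\<Sum>k<j. a k) \<noteq> 0)" for a :: "nat \<Rightarrow> real^'d"
  have Rm: "{a \<in> space L. R a} \<in> sets L"
    unfolding R_def L_def
    by (rule sets.sets_Collect_finite_All)
       (intro sets_Collect_neq borel_measurable_sum measurable_component_singleton, auto)
  have law: "distr M L (\<lambda>\<omega>. \<lambda>k\<in>{..<q}. \<zeta> (f k) \<omega>) = PiM {..<q} (\<lambda>_. distr M borel (\<zeta> 0))"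
    if "inj_on f {..<q}" for f
  proof -
    have "distr M L (\<lambda>\<omega>. \<lambda>k\<in>{..<q}. \<zeta> (f k) \<omega>) = PiM {..<q} (\<lambda>k. distr M borel (\<zeta> (f k)))"
      unfolding L_def
      by (rule indep_vars_iff_distr_eq_PiM[THEN iffD1, OF _ _ indep_vars_inj[OF indep_\<zeta> that]])
         (use False in auto)
    also have "\<dots> = PiM {..<q} (\<lambda>_. distr M borel (\<zeta> 0))"
      by (rule PiM_cong[OF refl]) (rule law_\<zeta>)
    finally show ?thesis .
  qed
  have meas: "(\<lambda>\<omega>. \<lambda>k\<in>{..<q}. \<zeta> (f k) \<omega>) \<in> measurable M L" for f
    unfolding L_def by measurable
  have pr: "prob {\<omega> \<in> space M. R (\<lambda>k\<in>{..<q}. \<zeta> (f k) \<omega>)}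
      = measure (PiM {..<q} (\<lambda>_. distr M borel (\<zeta> 0))) {a \<in> space L. R a}" if "inj_on f {..<q}" for f
  proof -
    have "measure (distr M L (\<lambda>\<omega>. \<lambda>k\<in>{..<q}. \<zeta> (f k) \<omega>)) {a \<in> space L. R a}
        = prob ((\<lambda>\<omega>. \<lambda>k\<in>{..<q}. \<zeta> (f k) \<omega>) -` {a \<in> space L. R a} \<inter> space M)"
      by (rule measure_distr[OF meas Rm])
    also have "(\<lambda>\<omega>. \<lambda>k\<in>{..<q}. \<zeta> (f k) \<omega>) -` {a \<in> space L. R a} \<inter> space M
        = {\<omega> \<in> space M. R (\<lambda>k\<in>{..<q}. \<zeta> (f k) \<omega>)}"
      by (auto simp: L_def space_PiM)
    finally show ?thesis unfolding law[OF that] by simp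
  qed
  have restr: "R (\<lambda>k\<in>{..<q}. a k) \<longleftrightarrow> R a" for a
    unfolding R_def by (intro ball_cong refl arg_cong[of _ _ Not] arg_cong2[of _ _ _ _ "(=)"] sum.cong) auto
  have rev: "new_site q i \<omega> \<longleftrightarrow> R (\<lambda>k. \<zeta> (i - Suc k) \<omega>)" for \<omega>
    unfolding new_site_def R_def
  proof (intro ball_cong refl arg_cong[of _ _ Not] arg_cong2[of _ _ _ _ "(=)"])
    fix j assume "j \<in> {1..q}"
    then show "(\<Sum>k\<in>{i - j..<i}. \<zeta> k \<omega>) = (\<Sum>k<j. \<zeta> (i - Suc k) \<omega>)"
      using assms by (intro sum.reindex_bij_witness[of _ "\<lambda>k. i - Suc k" "\<lambda>k. i - Suc k"]) auto
  qed
  have "expectation (\<lambda>\<omega>. of_bool (new_site q i \<omega>)) = prob {\<omega> \<in> space M. new_site q i \<omega>}"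
  proof -
    have "expectation (\<lambda>\<omega>. of_bool (new_site q i \<omega>) :: real) = expectation (indicator {\<omega> \<in> space M. new_site q i \<omega>})"
      by (intro Bochner_Integration.integral_cong) (auto simp: indicator_def)
    then show ?thesis by simp
  qed
  also have "\<dots> = prob {\<omega> \<in> space M. R (\<lambda>k\<in>{..<q}. \<zeta> (i - Suc k) \<omega>)}"
    unfolding rev restr ..
  also have "\<dots> = prob {\<omega> \<in> space M. R (\<lambda>k\<in>{..<q}. \<zeta> k \<omega>)}"
  proof -
    have "inj_on (\<lambda>k. i - Suc k) {..<q}" "inj_on (\<lambda>k. k) {..<q}"
      using assms by (auto simp: inj_on_def)
    from pr[OF this(1)] pr[OF this(2)] show ?thesis by (rule trans[OF _ sym])
  qed
  also have "\<dots> = escape_upto q" unfolding restr unfolding escape_upto_def R_def Y_def ..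
  finally show ?thesis .
qed

lemma escape_upto_tendsto: "escape_upto \<longlonglongrightarrow> escape_prob M \<xi>"
proof -
  have Ym: "Y n \<in> borel_measurable M" for n unfolding Y_def by measurable
  let ?A = "\<lambda>q. {\<omega> \<in> space M. \<forall>j\<in>{1..q}. Y j \<omega> \<noteq> 0}"
  have "?A q \<in> events" for q
    by (rule sets.sets_Collect_finite_All) (intro sets_Collect_neq Ym, auto)
  then have "range ?A \<subseteq> events" by auto
  moreover have "decseq ?A" by (auto simp: decseq_def)
  ultimately have "(\<lambda>q. prob (?A q)) \<longlonglongrightarrow> prob (\<Inter>q. ?A q)" by (rule finite_Lim_measure_decseq)
  moreover have "(\<Inter>q. ?A q) = {\<omega> \<in> space M. \<forall>n\<ge>1. (\<Sum>i=1..n. \<xi> i \<omega>) \<noteq> 0}"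
  proof -
    have Y: "(\<Sum>i=1..n. \<xi> i \<omega>) = Y n \<omega>" for n \<omega>
      unfolding Y_def \<zeta>_def by (rule sum.reindex_bij_witness[of _ Suc "\<lambda>i. i - 1"]) auto
    show ?thesis unfolding Y by (auto, metis atLeastAtMost_iff order_refl)
  qed
  ultimately show ?thesis by (simp add: escape_prob_def escape_upto_def[abs_def])
qed

lemma escape_upto_ge: "escape_prob M \<xi> \<le> escape_upto q"
proof (rule decseq_ge[OF _ escape_upto_tendsto])
  have Ym: "Y n \<in> borel_measurable M" for n unfolding Y_def by measurable
  have ev: "{\<omega> \<in> space M. \<forall>j\<in>{1..q}. Y j \<omega> \<noteq> 0} \<in> events" for q
    by (rule sets.sets_Collect_finite_All) (intro sets_Collect_neq Ym, auto)
  show "decseq escape_upto"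
    unfolding decseq_def escape_upto_def by (intro allI impI finite_measure_mono ev) auto
qed

text \<open>If none of the last \<open>q\<close> steps could have been excited, then over this period \<open>X\<close> moves like \<open>Y\<close>.\<close>

lemma fresh_le:
  assumes \<omega>: "\<omega> \<in> space M" and q: "q \<le> i"
  shows "of_bool (fresh i \<omega>) \<le> of_bool (new_site q i \<omega>) + (\<Sum>j<q. excited (i - Suc j) \<omega>)"
proof (cases "fresh i \<omega> \<and> \<not> new_site q i \<omega>")
  case True
  then obtain j where j: "j \<in> {1..q}" "(\<Sum>k\<in>{i - j..<i}. \<zeta> k \<omega>) = 0" by (auto simp: new_site_def)
  have "\<exists>k\<in>{i - j..<i}. excited k \<omega> = 1"
  proof (rule ccontr)
    assume "\<not> ?thesis"
    then have "\<And>k. k \<in> {i - j..<i} \<Longrightarrow> excited k \<omega> = 0" by (auto simp: excited_def)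
    then have "X i \<omega> - X (i - j) \<omega> = (\<Sum>k\<in>{i - j..<i}. \<zeta> k \<omega>)"
      unfolding X_diff[OF \<omega> diff_le_self[of i j]] by simp
    then have "X (i - j) \<omega> = X i \<omega>" using j(2) by simp
    moreover have "i - j < i" using j(1) q by auto
    ultimately show False using True by (auto simp: fresh_def)
  qed
  then obtain k where k: "k \<in> {i - j..<i}" "excited k \<omega> = 1" by blast
  then have "i - Suc k < q" "i - Suc (i - Suc k) = k" using j(1) q by auto
  then have "1 \<le> (\<Sum>j<q. excited (i - Suc j) \<omega>)"
    using member_le_sum[of "i - Suc k" "{..<q}" "\<lambda>j. excited (i - Suc j) \<omega>"] k(2) excited_01 by auto
  then show ?thesis by simp
next
  case False
  have "0 \<le> (\<Sum>j<q. excited (i - Suc j) \<omega>)" using excited_01 by (intro sum_nonneg)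
  then show ?thesis using False by auto
qed

definition new_fluct where
  "new_fluct q m \<omega> = (\<Sum>i\<in>{q..<m}. \<pi> i * (of_bool (new_site q i \<omega>) - escape_upto q))"

text \<open>Events belonging to times at least \<open>q\<close> apart depend on disjoint sets of steps.\<close>

lemma new_fluct_moment:
  "integrable M (new_fluct q m)"
  "expectation (\<lambda>\<omega>. \<bar>new_fluct q m \<omega>\<bar>) \<le> sqrt (2 * real q * (\<Sum>i<m. \<pi> i))"
proof -
  let ?w = "\<lambda>i \<omega>. \<pi> i * (of_bool (new_site q i \<omega>) - escape_upto q)"
  have e01: "0 \<le> escape_upto q" "escape_upto q \<le> 1" by (auto simp: escape_upto_def)
  have bound: "\<bar>?w i \<omega>\<bar> \<le> \<pi> i" for i \<omega>
  proof -
    have "\<bar>of_bool (new_site q i \<omega>) - escape_upto q\<bar> \<le> 1" using e01 by auto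
    then show ?thesis unfolding abs_mult using mult_left_le[of _ "\<pi> i"] by simp
  qed
  have wm: "?w i \<in> borel_measurable N" if "Measurable.pred N (new_site q i)" for i N
    using that by measurable
  have int: "integrable M (?w i)" for i
    by (rule integrable_const_bound[of _ "\<pi> i"]) (use bound in auto)
  have mean: "expectation (?w i) = 0" if "q \<le> i" for i
  proof -
    have "integrable M (\<lambda>\<omega>. of_bool (new_site q i \<omega>) :: real)"
      by (rule integrable_const_bound[of _ 1]) auto
    then show ?thesis using prob_new_site[OF that] by (simp add: prob_space)
  qed
  have bound1: "\<bar>?w i \<omega>\<bar> \<le> 1" for i \<omega> using order_trans[OF bound \<pi>_bounds(2)] .
  have second: "expectation (\<lambda>\<omega>. (?w i \<omega>)\<^sup>2) \<le> \<pi> i" for i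
  proof -
    have "expectation (\<lambda>\<omega>. (?w i \<omega>)\<^sup>2) \<le> expectation (\<lambda>\<omega>. \<pi> i)"
    proof (rule integral_mono')
      show "(?w i \<omega>)\<^sup>2 \<le> \<pi> i" for \<omega>
      proof -
        have "\<bar>?w i \<omega>\<bar> * \<bar>?w i \<omega>\<bar> \<le> \<pi> i * 1" by (intro mult_mono bound bound1) auto
        then show ?thesis by (simp add: power2_eq_square flip: abs_mult)
      qed
    qed auto
    then show ?thesis by (simp add: prob_space)
  qed
  have indep: "expectation (\<lambda>\<omega>. ?w i \<omega> * ?w k \<omega>) = 0" if "q \<le> i" "i + q \<le> k" for i k
  proof -
    let ?A = "\<lambda>i. {i - q..<i} \<times> {..<3::nat}"
    have "expectation (\<lambda>\<omega>. ?w i \<omega> * ?w k \<omega>) = expectation (?w i) * expectation (?w k)"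
    proof (rule step_algebra_indep)
      show "?A i \<inter> ?A k = {}" using that by auto
      show "?w i \<in> borel_measurable (step_algebra (?A i))" "?w k \<in> borel_measurable (step_algebra (?A k))"
        by (intro wm new_site_gen measurable_step_algebra_steps(1); simp)+
      show "integrable M (?w i)" "integrable M (?w k)" by (rule int)+
    qed auto
    then show ?thesis using mean[OF that(1)] by simp
  qed
  have wd: "expectation (\<lambda>\<omega>. (\<Sum>i\<in>{q..<m}. ?w i \<omega>)\<^sup>2) \<le> 2 * real q * (\<Sum>i\<in>{q..<m}. \<pi> i)"
    "integrable M (\<lambda>\<omega>. \<Sum>i\<in>{q..<m}. ?w i \<omega>)" "integrable M (\<lambda>\<omega>. (\<Sum>i\<in>{q..<m}. ?w i \<omega>)\<^sup>2)"
    by (rule weakly_dependent_second_moment[of "{q..<m}" ?w 1 "\<pi>" q]; use wm bound1 second indep in auto)+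
  show "integrable M (new_fluct q m)" unfolding new_fluct_def by (rule wd(2))
  have "expectation (\<lambda>\<omega>. \<bar>new_fluct q m \<omega>\<bar>) \<le> sqrt (2 * real q * (\<Sum>i\<in>{q..<m}. \<pi> i))"
    unfolding new_fluct_def by (rule expectation_abs_le_sqrt[OF wd(2,3,1)])
  also have "\<dots> \<le> sqrt (2 * real q * (\<Sum>i<m. \<pi> i))"
    by (intro real_sqrt_le_mono mult_left_mono sum_mono2) auto
  finally show "expectation (\<lambda>\<omega>. \<bar>new_fluct q m \<omega>\<bar>) \<le> sqrt (2 * real q * (\<Sum>i<m. \<pi> i))" .
qed

text \<open>The error made by treating \<open>X\<close> like \<open>Y\<close> near an excitation. It contains two factors of size
  \<open>C / sqrt i\<close>, so its mean grows only logarithmically.\<close>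

definition window where
  "window q m \<omega> = (\<Sum>i\<in>{q..<m}. \<pi> i * (\<Sum>j<q. excited (i - Suc j) \<omega>))"

lemma window_moment:
  "integrable M (window q m)" "0 \<le> window q m \<omega>"
  "expectation (window q m) \<le> real q * (\<Sum>i<m. (\<pi> i)\<^sup>2)"
proof -
  show "integrable M (window q m)" unfolding window_def by auto
  show "0 \<le> window q m \<omega>" unfolding window_def using excited_01 by (intro sum_nonneg mult_nonneg_nonneg) auto
  have "expectation (window q m) = (\<Sum>i\<in>{q..<m}. \<pi> i * (\<Sum>j<q. \<pi> (i - Suc j)))"
    unfolding window_def by (simp add: expectation_excited)
  also have "\<dots> = (\<Sum>j<q. \<Sum>i\<in>{q..<m}. \<pi> i * \<pi> (i - Suc j))"
    unfolding sum_distrib_left by (rule sum.swap)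
  also have "\<dots> \<le> (\<Sum>j<q. \<Sum>i<m. (\<pi> i)\<^sup>2)"
  proof (rule sum_mono)
    fix j assume j: "j \<in> {..<q}"
    have "(\<Sum>i\<in>{q..<m}. \<pi> i * \<pi> (i - Suc j)) \<le> (\<Sum>i\<in>{q..<m}. (\<pi> (i - Suc j))\<^sup>2)"
      unfolding power2_eq_square
      by (intro sum_mono mult_right_mono exc_prob_antimono[OF C_pos]) auto
    also have "\<dots> = (\<Sum>i\<in>(\<lambda>i. i - Suc j) ` {q..<m}. (\<pi> i)\<^sup>2)"
      by (subst sum.reindex) (use j in \<open>auto simp: inj_on_def\<close>)
    also have "\<dots> \<le> (\<Sum>i<m. (\<pi> i)\<^sup>2)" by (rule sum_mono2) auto
    finally show "(\<Sum>i\<in>{q..<m}. \<pi> i * \<pi> (i - Suc j)) \<le> (\<Sum>i<m. (\<pi> i)\<^sup>2)" .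
  qed
  finally show "expectation (window q m) \<le> real q * (\<Sum>i<m. (\<pi> i)\<^sup>2)" by simp
qed

lemma displacement_le:
  assumes \<omega>: "\<omega> \<in> space M"
  shows "(X m \<omega> - Y m \<omega>) \<bullet> l \<le> fluct m \<omega>
    + \<mu> * (real q + new_fluct q m \<omega> + escape_upto q * (\<Sum>i<m. \<pi> i) + window q m \<omega>)"
proof -
  have e0: "0 \<le> escape_upto q" by (auto simp: escape_upto_def)
  let ?f = "\<lambda>i. of_bool (fresh i \<omega>) :: real"
  have "X m \<omega> - Y m \<omega> = (\<Sum>i<m. (?f i * excited i \<omega>) *\<^sub>R (\<eta> i \<omega> - \<zeta> i \<omega>))"
    using X_diff[OF \<omega>, of 0 m] X_0[OF \<omega>] by (simp add: Y_def atLeast0LessThan)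
  then have "(X m \<omega> - Y m \<omega>) \<bullet> l = (\<Sum>i<m. ?f i * V i \<omega> + \<mu> * (?f i * \<pi> i))"
    by (simp add: inner_sum_left V_def algebra_simps)
  also have "\<dots> = fluct m \<omega> + \<mu> * (\<Sum>i<m. ?f i * \<pi> i)"
    by (simp only: fluct_def sum.distrib sum_distrib_left)
  also have "(\<Sum>i<m. ?f i * \<pi> i) \<le> real q + new_fluct q m \<omega> + escape_upto q * (\<Sum>i<m. \<pi> i) + window q m \<omega>"
  proof -
    have "(\<Sum>i<m. ?f i * \<pi> i) \<le> (\<Sum>i\<in>{..<q} \<union> {q..<m}. ?f i * \<pi> i)"
      by (rule sum_mono2) auto
    also have "\<dots> = (\<Sum>i<q. ?f i * \<pi> i) + (\<Sum>i\<in>{q..<m}. ?f i * \<pi> i)"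
      by (rule sum.union_disjoint) auto
    also have "(\<Sum>i<q. ?f i * \<pi> i) \<le> (\<Sum>i<q. 1)"
      by (intro sum_mono) (auto simp: mult_le_one)
    also have "(\<Sum>i\<in>{q..<m}. ?f i * \<pi> i) \<le> (\<Sum>i\<in>{q..<m}. \<pi> i * (of_bool (new_site q i \<omega>) - escape_upto q)
        + escape_upto q * \<pi> i + \<pi> i * (\<Sum>j<q. excited (i - Suc j) \<omega>))"
    proof (rule sum_mono)
      fix i assume "i \<in> {q..<m}"
      then have "?f i * \<pi> i \<le> (of_bool (new_site q i \<omega>) + (\<Sum>j<q. excited (i - Suc j) \<omega>)) * \<pi> i"
        by (intro mult_right_mono fresh_le[OF \<omega>]) auto
      then show "?f i * \<pi> i \<le> \<pi> i * (of_bool (new_site q i \<omega>) - escape_upto q)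
        + escape_upto q * \<pi> i + \<pi> i * (\<Sum>j<q. excited (i - Suc j) \<omega>)"
        by (simp only: algebra_simps)
    qed
    also have "\<dots> = new_fluct q m \<omega> + escape_upto q * (\<Sum>i\<in>{q..<m}. \<pi> i) + window q m \<omega>"
      by (simp add: new_fluct_def window_def sum.distrib sum_distrib_left)
    also have "(\<Sum>i\<in>{q..<m}. \<pi> i) \<le> (\<Sum>i<m. \<pi> i)" by (rule sum_mono2) auto
    finally show ?thesis using e0 by (simp add: mult_left_mono)
  qed
  finally show ?thesis using \<mu>_nonneg by (simp add: mult_left_mono)
qed

definition drift where "drift t = 2 * C * escape_prob M \<xi> * \<mu> * sqrt t"

text \<open>Only the positive part is expected to vanish: the fresh sites of \<open>X\<close> may be fewer than the new sites
  of \<open>Y\<close>.\<close>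

definition excess where
  "excess n t \<omega> = max 0 ((X (nat \<lfloor>real n * t\<rfloor>) \<omega> - Y (nat \<lfloor>real n * t\<rfloor>) \<omega>) \<bullet> l / sqrt (real n) - drift t)"

text \<open>The bracket collects errors that are negligible against \<open>sqrt n\<close> for fixed \<open>q\<close>; the last term is the
  price of looking back only \<open>q\<close> times.\<close>

lemma excess_bound:
  assumes n: "n \<ge> 1" and t: "0 \<le> t"
  shows "expectation (excess n t)
    \<le> (sqrt (40 * K\<^sup>2 * C * sqrt (real n * t))
        + \<mu> * (real q + sqrt (4 * real q * C * sqrt (real n * t))
        + real q * (C\<^sup>2 * (1 + ln (real n * t + 1))))) / sqrt (real n)
      + 2 * C * \<mu> * (escape_upto q - escape_prob M \<xi>) * sqrt t"
proof -
  define m where "m = nat \<lfloor>real n * t\<rfloor>"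
  define r where "r = sqrt (real n)"
  have r: "0 < r" using n by (simp add: r_def)
  have m: "real m \<le> real n * t" unfolding m_def using t by simp
  define s where "s = (\<Sum>i<m. \<pi> i)"
  have s: "s \<le> 2 * C * sqrt (real n * t)"
  proof -
    have "s \<le> 2 * C * sqrt (real m)"
      using sum_exc_prob_le[OF C_pos, of 0 m] by (simp add: s_def atLeast0LessThan)
    also have "\<dots> \<le> 2 * C * sqrt (real n * t)"
      using m C_pos by (intro mult_left_mono real_sqrt_le_mono) auto
    finally show ?thesis .
  qed
  have sr: "s / r \<le> 2 * C * sqrt t"
  proof -
    have "sqrt (real n * t) = r * sqrt t" by (simp add: r_def real_sqrt_mult)
    then show ?thesis using s r by (simp add: pos_divide_le_eq mult_ac)
  qed
  define e where "e = escape_upto q - escape_prob M \<xi>"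
  have e: "0 \<le> e" using escape_upto_ge[of q] by (simp add: e_def)
  have e0: "0 \<le> escape_upto q" by (auto simp: escape_upto_def)
  define B where "B \<omega> = (\<bar>fluct m \<omega>\<bar> + \<mu> * (real q + \<bar>new_fluct q m \<omega>\<bar> + window q m \<omega>)) / r
      + 2 * C * \<mu> * e * sqrt t" for \<omega>
  have B0: "0 \<le> B \<omega>" for \<omega>
    unfolding B_def using r \<mu>_nonneg e C_pos window_moment(2) t by (intro add_nonneg_nonneg divide_nonneg_pos mult_nonneg_nonneg) auto
  have le: "excess n t \<omega> \<le> B \<omega>" if \<omega>: "\<omega> \<in> space M" for \<omega>
  proof -
    have "(X m \<omega> - Y m \<omega>) \<bullet> l / r \<le> (fluct m \<omega> + \<mu> * (real q + new_fluct q m \<omega> + escape_upto q * s + window q m \<omega>)) / r"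
      unfolding s_def by (intro divide_right_mono displacement_le[OF \<omega>]) (use r in auto)
    also have "\<dots> = (fluct m \<omega> + \<mu> * (real q + new_fluct q m \<omega> + window q m \<omega>)) / r + \<mu> * escape_upto q * (s / r)"
      using r by (simp add: field_simps)
    also have "\<dots> \<le> (\<bar>fluct m \<omega>\<bar> + \<mu> * (real q + \<bar>new_fluct q m \<omega>\<bar> + window q m \<omega>)) / r + \<mu> * escape_upto q * (2 * C * sqrt t)"
      using r \<mu>_nonneg e0 sr by (intro add_mono divide_right_mono mult_left_mono) auto
    also have "\<mu> * escape_upto q * (2 * C * sqrt t) = 2 * C * \<mu> * e * sqrt t + drift t"
      by (simp add: e_def drift_def algebra_simps)
    finally have "(X m \<omega> - Y m \<omega>) \<bullet> l / r - drift t \<le> B \<omega>" unfolding B_def by simp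
    then show ?thesis using B0[of \<omega>] unfolding excess_def m_def[symmetric] r_def[symmetric] by simp
  qed
  have intB: "integrable M B"
    unfolding B_def using fluct_moment(1) new_fluct_moment(1) window_moment(1) by auto
  have "expectation (excess n t) \<le> expectation B"
    by (rule integral_mono'[OF intB le]) (simp_all add: excess_def B0)
  also have "\<dots> = (expectation (\<lambda>\<omega>. \<bar>fluct m \<omega>\<bar>) + \<mu> * (real q + expectation (\<lambda>\<omega>. \<bar>new_fluct q m \<omega>\<bar>)
      + expectation (window q m))) / r + 2 * C * \<mu> * e * sqrt t"
    unfolding B_def using fluct_moment(1) new_fluct_moment(1) window_moment(1) by (simp add: prob_space)
  also have "\<dots> \<le> (sqrt (40 * K\<^sup>2 * C * sqrt (real n * t))
        + \<mu> * (real q + sqrt (4 * real q * C * sqrt (real n * t))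
        + real q * (C\<^sup>2 * (1 + ln (real n * t + 1))))) / r + 2 * C * \<mu> * e * sqrt t"
  proof (intro add_mono divide_right_mono mult_left_mono order_refl)
    have "expectation (\<lambda>\<omega>. \<bar>fluct m \<omega>\<bar>) \<le> sqrt (20 * K\<^sup>2 * s)" unfolding s_def by (rule fluct_moment(2))
    also have "\<dots> \<le> sqrt (20 * K\<^sup>2 * (2 * C * sqrt (real n * t)))"
      using s by (intro real_sqrt_le_mono mult_left_mono) auto
    finally show "expectation (\<lambda>\<omega>. \<bar>fluct m \<omega>\<bar>) \<le> sqrt (40 * K\<^sup>2 * C * sqrt (real n * t))"
      by (simp only: mult.assoc mult.left_commute) simp
    have "expectation (\<lambda>\<omega>. \<bar>new_fluct q m \<omega>\<bar>) \<le> sqrt (2 * real q * s)" unfolding s_def by (rule new_fluct_moment(2))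
    also have "\<dots> \<le> sqrt (2 * real q * (2 * C * sqrt (real n * t)))"
      using s by (intro real_sqrt_le_mono mult_left_mono) auto
    finally show "expectation (\<lambda>\<omega>. \<bar>new_fluct q m \<omega>\<bar>) \<le> sqrt (4 * real q * C * sqrt (real n * t))"
      by (simp only: mult.assoc mult.left_commute) simp
    have "expectation (window q m) \<le> real q * (\<Sum>i<m. (\<pi> i)\<^sup>2)" by (rule window_moment(3))
    also have "\<dots> \<le> real q * (C\<^sup>2 * (1 + ln (real m + 1)))"
      by (intro mult_left_mono sum_exc_prob_sq_le[OF C_pos]) simp
    also have "\<dots> \<le> real q * (C\<^sup>2 * (1 + ln (real n * t + 1)))"
      using m by (intro mult_left_mono add_left_mono ln_mono) auto
    finally show "expectation (window q m) \<le> real q * (C\<^sup>2 * (1 + ln (real n * t + 1)))" .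
  qed (use \<mu>_nonneg r e C_pos in auto)
  finally show ?thesis unfolding e_def r_def .
qed

lemma excess_tendsto:
  assumes t: "0 \<le> t"
  shows "(\<lambda>n. expectation (excess n t)) \<longlonglongrightarrow> 0"
proof (rule LIMSEQ_I)
  fix \<epsilon> :: real assume \<epsilon>: "\<epsilon> > 0"
  have "(\<lambda>q. 2 * C * \<mu> * (escape_upto q - escape_prob M \<xi>) * sqrt t) \<longlonglongrightarrow> 2 * C * \<mu> * (escape_prob M \<xi> - escape_prob M \<xi>) * sqrt t"
    by (intro tendsto_intros escape_upto_tendsto)
  then have "(\<lambda>q. 2 * C * \<mu> * (escape_upto q - escape_prob M \<xi>) * sqrt t) \<longlonglongrightarrow> 0" by simp
  from order_tendstoD(2)[OF this, of "\<epsilon> / 2"] \<epsilon>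
  obtain q where q: "2 * C * \<mu> * (escape_upto q - escape_prob M \<xi>) * sqrt t < \<epsilon> / 2"
    by (auto simp: eventually_sequentially)
  have lim: "(\<lambda>n. (sqrt (40 * K\<^sup>2 * C * sqrt (real n * t))
        + \<mu> * (real q + sqrt (4 * real q * C * sqrt (real n * t))
        + real q * (C\<^sup>2 * (1 + ln (real n * t + 1))))) / sqrt (real n)) \<longlonglongrightarrow> 0"
  proof -
    have "(\<lambda>n. sqrt (1 / real n)) \<longlonglongrightarrow> sqrt 0" by (intro tendsto_real_sqrt lim_1_over_n)
    then have r2: "(\<lambda>n. 1 / sqrt (real n)) \<longlonglongrightarrow> 0" by (simp add: real_sqrt_divide)
    have "(\<lambda>n. sqrt (1 / sqrt (real n))) \<longlonglongrightarrow> sqrt 0" by (intro tendsto_real_sqrt r2)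
    moreover have "sqrt (1 / sqrt (real n)) = sqrt (sqrt (real n)) / sqrt (real n)" for n
    proof (cases "n = 0")
      case False
      define s where "s = sqrt (sqrt (real n))"
      have "0 < s" "sqrt (real n) = s * s" using False by (simp_all add: s_def)
      then show ?thesis by (simp only: real_sqrt_divide real_sqrt_one real_sqrt_mult_self) (simp add: s_def[symmetric] field_simps)
    qed simp
    ultimately have r4: "(\<lambda>n. sqrt (sqrt (real n)) / sqrt (real n)) \<longlonglongrightarrow> 0" by simp
    have s: "(\<lambda>n. sqrt (A * sqrt (real n * t)) / sqrt (real n)) \<longlonglongrightarrow> 0" for A
      using tendsto_mult[OF tendsto_const r4, of "sqrt (A * sqrt t)"] by (simp add: real_sqrt_mult mult_ac)
    have c: "(\<lambda>n. real q / sqrt (real n)) \<longlonglongrightarrow> 0"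
      using tendsto_mult[OF tendsto_const r2, of "real q"] by simp
    have ln: "(\<lambda>n. (1 + ln (real n * t + 1)) / sqrt (real n)) \<longlonglongrightarrow> 0"
    proof (rule tendsto_sandwich)
      have lnle: "ln y \<le> 4 * sqrt (sqrt y)" if "y > 0" for y :: real
        using ln_le_minus_one[of "sqrt (sqrt y)"] that by (simp add: ln_sqrt)
      show "\<forall>\<^sub>F n in sequentially. (1 + ln (real n * t + 1)) / sqrt (real n)
          \<le> 1 / sqrt (real n) + 4 * sqrt (sqrt (t + 1)) * (sqrt (sqrt (real n)) / sqrt (real n))"
      proof (rule eventually_sequentiallyI[of 1])
        fix n :: nat assume n: "1 \<le> n"
        have "ln (real n * t + 1) \<le> 4 * sqrt (sqrt (real n * t + 1))"
          using t by (intro lnle add_nonneg_pos) auto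
        also have "\<dots> \<le> 4 * sqrt (sqrt (real n * (t + 1)))"
          using n by (simp add: algebra_simps)
        finally have "1 + ln (real n * t + 1) \<le> 1 + 4 * sqrt (sqrt (t + 1)) * sqrt (sqrt (real n))"
          by (simp add: real_sqrt_mult mult_ac)
        from divide_right_mono[OF this, of "sqrt (real n)"]
        show "(1 + ln (real n * t + 1)) / sqrt (real n)
          \<le> 1 / sqrt (real n) + 4 * sqrt (sqrt (t + 1)) * (sqrt (sqrt (real n)) / sqrt (real n))"
          by (simp add: add_divide_distrib)
      qed
      show "\<forall>\<^sub>F n in sequentially. 0 \<le> (1 + ln (real n * t + 1)) / sqrt (real n)"
        using t by (intro always_eventually allI divide_nonneg_nonneg add_nonneg_nonneg ln_ge_zero) auto
      show "(\<lambda>n. 1 / sqrt (real n) + 4 * sqrt (sqrt (t + 1)) * (sqrt (sqrt (real n)) / sqrt (real n))) \<longlonglongrightarrow> 0"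
        using tendsto_add[OF r2 tendsto_mult[OF tendsto_const r4, of "4 * sqrt (sqrt (t + 1))"]] by simp
    qed simp
    have "(\<lambda>n. sqrt (40 * K\<^sup>2 * C * sqrt (real n * t)) / sqrt (real n)
        + \<mu> * (real q / sqrt (real n) + sqrt (4 * real q * C * sqrt (real n * t)) / sqrt (real n)
        + real q * (C\<^sup>2 * ((1 + ln (real n * t + 1)) / sqrt (real n))))) \<longlonglongrightarrow> 0 + \<mu> * (0 + 0 + real q * (C\<^sup>2 * 0))"
      by (intro tendsto_add tendsto_mult tendsto_const s c ln)
    then show ?thesis by (simp add: add_divide_distrib distrib_left)
  qed
  from order_tendstoD(2)[OF lim, of "\<epsilon> / 2"] \<epsilon>
  obtain N where N: "\<And>n. n \<ge> N \<Longrightarrow> (sqrt (40 * K\<^sup>2 * C * sqrt (real n * t))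
        + \<mu> * (real q + sqrt (4 * real q * C * sqrt (real n * t))
        + real q * (C\<^sup>2 * (1 + ln (real n * t + 1))))) / sqrt (real n) < \<epsilon> / 2"
    by (auto simp: eventually_sequentially)
  have "norm (expectation (excess n t) - 0) < \<epsilon>" if n: "n \<ge> max 1 N" for n
  proof -
    have "0 \<le> expectation (excess n t)"
      by (intro Bochner_Integration.integral_nonneg) (simp add: excess_def)
    moreover have "expectation (excess n t) < \<epsilon> / 2 + \<epsilon> / 2"
      by (rule order_le_less_trans[OF excess_bound[OF _ t] add_strict_mono[OF N q]]) (use n in auto)
    ultimately show ?thesis by simp
  qed
  then show "\<exists>N. \<forall>n\<ge>N. norm (expectation (excess n t) - 0) < \<epsilon>" by blast
qed

end

section \<open>Projected paths\<close>

lemma dist_cpath_mono: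
  assumes "\<And>t. 0 \<le> t \<Longrightarrow> norm (path_at f t - path_at g t) \<le> norm (path_at f' t - path_at g' t)"
  shows "dist f g \<le> dist f' g'"
  unfolding dist_cpath_def
proof (rule suminf_le[OF _ summable_trunc_sup summable_trunc_sup])
  fix k
  have "trunc_sup (Suc k) f g \<le> trunc_sup (Suc k) f' g'"
  proof (rule trunc_sup_least)
    fix t :: real assume t: "0 \<le> t" "t \<le> real (Suc k)"
    have "min (norm (path_at f t - path_at g t)) 1 \<le> min (norm (path_at f' t - path_at g' t)) 1"
      using assms[OF t(1)] by (intro min.mono) auto
    also have "\<dots> \<le> trunc_sup (Suc k) f' g'" by (rule trunc_sup_upper[OF t])
    finally show "min (norm (path_at f t - path_at g t)) 1 \<le> trunc_sup (Suc k) f' g'" .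
  qed
  then show "(1/2)^(Suc k) * trunc_sup (Suc k) f g \<le> (1/2)^(Suc k) * trunc_sup (Suc k) f' g'"
    by (intro mult_left_mono) auto
qed

definition proj :: "'a::real_inner \<Rightarrow> 'a cpath \<Rightarrow> real cpath" where
  "proj v f = cpath_of (\<lambda>t. path_at f t \<bullet> v)"

lemma path_at_proj: "0 \<le> t \<Longrightarrow> path_at (proj v f) t = path_at f t \<bullet> v"
  unfolding proj_def
  by (rule path_at_cpath_of) (auto intro!: continuous_intros continuous_on_path_at)

lemma norm_inner_unit_le: "norm v = 1 \<Longrightarrow> norm (x \<bullet> v) \<le> norm x"
  using Cauchy_Schwarz_ineq2[of x v] by simp

lemma dist_proj_le: "norm v = 1 \<Longrightarrow> dist (proj v f) (proj v g) \<le> dist f g"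
  by (rule dist_cpath_mono) (simp add: path_at_proj inner_diff_left[symmetric] norm_inner_unit_le del: real_norm_def)

lemma continuous_on_proj: "norm v = 1 \<Longrightarrow> continuous_on A (proj v)"
  by (rule continuous_onI) (meson dist_proj_le order_le_less_trans less_imp_le)

lemma moment4_proj:
  fixes Z :: "'b \<Rightarrow> 'a::euclidean_space cpath"
  assumes v: "norm v = 1" and Z[measurable]: "Z \<in> borel_measurable M" and mom: "moment4 M c Z"
  shows "moment4 M c (\<lambda>x. proj v (Z x))"
  unfolding moment4_def
proof (intro allI)
  fix i k
  have le: "dyadic_incr i k (proj v (Z x)) ^ 4 \<le> dyadic_incr i k (Z x) ^ 4" for x
    unfolding dyadic_incr_def
    by (intro power_mono) (simp_all add: path_at_proj inner_diff_left[symmetric] norm_inner_unit_le v del: real_norm_def)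
  have int: "integrable M (\<lambda>x. dyadic_incr i k (Z x) ^ 4)" "(\<integral>x. dyadic_incr i k (Z x) ^ 4 \<partial>M) \<le> c / 4^i"
    using mom unfolding moment4_def by blast+
  have [measurable]: "(\<lambda>x. proj v (Z x)) \<in> borel_measurable M"
    using borel_measurable_continuous_onI[OF continuous_on_proj[OF v]] by measurable
  have "integrable M (\<lambda>x. dyadic_incr i k (proj v (Z x)) ^ 4)"
    by (rule Bochner_Integration.integrable_bound[OF int(1)]) (use le in auto)
  moreover have "(\<integral>x. dyadic_incr i k (proj v (Z x)) ^ 4 \<partial>M) \<le> (\<integral>x. dyadic_incr i k (Z x) ^ 4 \<partial>M)"
    by (rule integral_mono'[OF int(1) le]) simp
  ultimately show "integrable M (\<lambda>x. dyadic_incr i k (proj v (Z x)) ^ 4)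
      \<and> (\<integral>x. dyadic_incr i k (proj v (Z x)) ^ 4 \<partial>M) \<le> c / 4^i" using int(2) by simp
qed

lemma dist_polygon_add_le:
  fixes a e :: "nat \<Rightarrow> real"
  assumes e: "\<And>k. 0 \<le> e k"
  shows "dist (polygon (2^j) (\<lambda>k. a k + e k)) (polygon (2^j) a) \<le> (\<Sum>k\<le>2^j * T + 1. e k) + (1/2)^T"
proof (rule dist_cpath_le)
  show "0 \<le> (\<Sum>k\<le>2^j * T + 1. e k)" by (intro sum_nonneg e)
  fix t :: real assume t: "0 \<le> t" "t \<le> real T"
  have "nat \<lfloor>2^j * t\<rfloor> \<le> nat \<lfloor>2^j * real T\<rfloor>" by (rule floor_index_le) (use t in auto)
  also have "2^j * real T = real (2^j * T)" by simp
  finally have m: "nat \<lfloor>2^j * t\<rfloor> \<le> 2^j * T" by (simp only: floor_of_nat nat_int)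
  show "norm (path_at (polygon (2^j) (\<lambda>k. a k + e k)) t - path_at (polygon (2^j) a) t) \<le> (\<Sum>k\<le>2^j * T + 1. e k)"
    unfolding path_at_polygon[OF zero_le_power[OF zero_le_numeral] t(1)]
  proof (rule norm_polyval_diff_le)
    fix k assume "k = nat \<lfloor>2^j * t\<rfloor> \<or> k = Suc (nat \<lfloor>2^j * t\<rfloor>)"
    then have "k \<in> {..2^j * T + 1}" using m by auto
    then have "e k \<le> (\<Sum>k\<le>2^j * T + 1. e k)" by (intro member_le_sum e) auto
    then show "norm (a k + e k - a k) \<le> (\<Sum>k\<le>2^j * T + 1. e k)" using e[of k] by simp
  qed (use t in auto)
qed

section \<open>Brownian motion along a line\<close>

lemma real_bm_noise:
  assumes "real_bm N B"
  shows "distr N (PiM UNIV (\<lambda>_. borel)) (\<lambda>\<omega> k. path_at (B \<omega>) (real (Suc k) / 2^j) - path_at (B \<omega>) (real k / 2^j)) = noise j"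
proof -
  interpret prob_space N using assms by (simp add: real_bm_def)
  have [measurable]: "B \<in> borel_measurable N" using assms by (simp add: real_bm_def)
  let ?D = "\<lambda>k \<omega>. path_at (B \<omega>) (real (Suc k) / 2^j) - path_at (B \<omega>) (real k / 2^j)"
  have [measurable]: "?D k \<in> borel_measurable N" for k by measurable
  have fin: "indep_vars (\<lambda>_. borel) ?D {..<n}" for n
  proof -
    have "strict_mono (\<lambda>k. real k / 2^j)" by (auto simp: strict_mono_def divide_strict_right_mono)
    then show ?thesis
      using assms[unfolded real_bm_def, THEN conjunct2, THEN conjunct2, THEN conjunct2, THEN conjunct1,
        rule_format, of "\<lambda>k. real k / 2^j" n] by simp
  qed
  have ind: "indep_vars (\<lambda>_. borel) ?D UNIV"
    unfolding indep_vars_def2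
  proof (intro conjI ballI)
    show "indep_sets (\<lambda>i. {?D i -` A \<inter> space N |A. A \<in> sets borel}) UNIV"
    proof (subst indep_sets_finite_index_sets, intro allI impI)
      fix J :: "nat set" assume "finite J"
      then obtain n where "J \<subseteq> {..<n}" using finite_nat_iff_bounded by blast
      from indep_vars_subset[OF fin this]
      show "indep_sets (\<lambda>i. {?D i -` A \<inter> space N |A. A \<in> sets borel}) J" by (simp add: indep_vars_def2)
    qed
  qed measurable
  have law: "distr N borel (?D k) = centered_normal (1 / 2^j)" for k
  proof -
    have "distr N borel (?D k) = centered_normal (real (Suc k) / 2^j - real k / 2^j)"
      using assms[unfolded real_bm_def, THEN conjunct2, THEN conjunct2, THEN conjunct2, THEN conjunct2,
        rule_format, of "real k / 2^j" "real (Suc k) / 2^j"] by (simp add: divide_strict_right_mono)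
    then show ?thesis by (simp add: diff_divide_distrib[symmetric])
  qed
  have "distr N (PiM UNIV (\<lambda>_. borel)) (\<lambda>\<omega>. \<lambda>k\<in>UNIV. ?D k \<omega>) = PiM UNIV (\<lambda>k. distr N borel (?D k))"
    by (rule indep_vars_iff_distr_eq_PiM[THEN iffD1, OF _ _ ind]) auto
  then show ?thesis unfolding law restrict_UNIV noise_def .
qed

text \<open>Only the projection of the Brownian motion on \<open>l\<close> enters the comparison, hence a Brownian motion along
  \<open>l\<close>, with a covariance matrix of rank one and the variance of \<open>\<xi> \<bullet> l\<close>, serves as the process \<open>W\<close>.\<close>

definition line_path :: "real \<Rightarrow> 'a::real_normed_vector \<Rightarrow> real cpath \<Rightarrow> 'a cpath" where
  "line_path \<sigma> v f = cpath_of (\<lambda>t. (\<sigma> * path_at f t) *\<^sub>R v)"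

lemma path_at_line_path: "0 \<le> t \<Longrightarrow> path_at (line_path \<sigma> v f) t = (\<sigma> * path_at f t) *\<^sub>R v"
  unfolding line_path_def
  by (rule path_at_cpath_of) (auto intro!: continuous_intros continuous_on_path_at)

lemma measurable_line_path:
  fixes v :: "'a::{banach, second_countable_topology}"
  assumes [measurable]: "B \<in> borel_measurable N"
  shows "(\<lambda>\<omega>. line_path \<sigma> v (B \<omega>)) \<in> borel_measurable N"
proof (rule measurable_cpathI)
  fix t :: real assume "0 \<le> t"
  then show "(\<lambda>\<omega>. path_at (line_path \<sigma> v (B \<omega>)) t) \<in> borel_measurable N"
    by (simp add: path_at_line_path)
qed

lemma (in prob_space) indep_vars_distr_id:
  assumes \<phi>[measurable]: "\<phi> \<in> measurable M N" and Y[measurable]: "\<And>i. i \<in> I \<Longrightarrow> Y i \<in> borel_measurable N"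
    and ind: "indep_vars (\<lambda>_. borel) (\<lambda>i x. Y i (\<phi> x)) I"
  shows "prob_space.indep_vars (distr M N \<phi>) (\<lambda>_. borel) Y I"
proof -
  interpret D: prob_space "distr M N \<phi>" by (rule prob_space_distr[OF \<phi>])
  show ?thesis
  proof (cases "I = {}")
    case True then show ?thesis by (simp add: D.indep_vars_def D.indep_sets_def)
  next
    case False
    have "distr (distr M N \<phi>) (PiM I (\<lambda>_. borel)) (\<lambda>x. \<lambda>i\<in>I. Y i x)
        = distr M (PiM I (\<lambda>_. borel)) (\<lambda>x. \<lambda>i\<in>I. Y i (\<phi> x))"
      by (subst distr_distr) (auto simp: o_def intro!: measurable_restrict)
    also have "\<dots> = PiM I (\<lambda>i. distr M borel (\<lambda>x. Y i (\<phi> x)))"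
      by (rule indep_vars_iff_distr_eq_PiM'[THEN iffD1, OF False _ ind]) measurable
    also have "\<dots> = PiM I (\<lambda>i. distr (distr M N \<phi>) borel (Y i))"
      by (intro PiM_cong refl) (subst distr_distr, auto simp: o_def)
    finally show ?thesis
      by (intro D.indep_vars_iff_distr_eq_PiM'[THEN iffD2, OF False]) auto
  qed
qed

lemma brownian_line:
  fixes v :: "real^'d"
  assumes bm: "real_bm N B"
  shows "brownian_motion (distr N borel (\<lambda>\<omega>. line_path \<sigma> v (B \<omega>))) (\<lambda>x. x)"
proof -
  interpret prob_space N using bm by (simp add: real_bm_def)
  have Bm[measurable]: "B \<in> borel_measurable N" using bm by (simp add: real_bm_def)
  let ?W = "\<lambda>\<omega>. line_path \<sigma> v (B \<omega>)"
  have Wm[measurable]: "?W \<in> borel_measurable N" by (rule measurable_line_path[OF Bm])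
  have start: "path_at (B \<omega>) 0 = 0" for \<omega> using bm by (simp add: real_bm_def)
  define S :: "real^'d^'d" where "S = (\<chi> i j. \<sigma>\<^sup>2 * (v $ i * v $ j))"
  have Su: "S *v w = (\<sigma>\<^sup>2 * (w \<bullet> v)) *\<^sub>R v" for w
    by (simp add: S_def matrix_vector_mult_def vec_eq_iff inner_vec_def sum_distrib_left sum_distrib_right mult_ac)
  have quad: "w \<bullet> (S *v w) = (\<sigma> * (w \<bullet> v))\<^sup>2" for w
    by (simp add: Su power2_eq_square mult_ac)
  show ?thesis
    unfolding brownian_motion_def
  proof (intro conjI allI impI exI[of _ S])
    show "prob_space (distr N borel ?W)" by (rule prob_space_distr[OF Wm])
    show "(\<lambda>x. x) \<in> distr N borel ?W \<rightarrow>\<^sub>M borel" by simp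
    show "AE \<omega> in distr N borel ?W. path_at \<omega> 0 = 0"
      by (subst AE_distr_iff[OF Wm]) (auto simp: path_at_line_path start intro!: measurable_path_at)
    show "transpose S = S" by (simp add: S_def transpose_def vec_eq_iff mult.commute)
    show "0 \<le> w \<bullet> (S *v w)" for w unfolding quad by simp
  next
    fix t :: "nat \<Rightarrow> real" and n :: nat assume t: "0 \<le> t 0" "strict_mono t"
    have tpos: "0 \<le> t i" for i using t strict_mono_less_eq[OF t(2), of 0 i] by simp
    have "indep_vars (\<lambda>_. borel) (\<lambda>i \<omega>. path_at (B \<omega>) (t (Suc i)) - path_at (B \<omega>) (t i)) {..<n}"
      using bm t by (simp add: real_bm_def)
    then have "indep_vars (\<lambda>_. borel) (\<lambda>i \<omega>. (\<sigma> * (path_at (B \<omega>) (t (Suc i)) - path_at (B \<omega>) (t i))) *\<^sub>R v) {..<n}"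
      by (rule indep_vars_compose2[where Y = "\<lambda>_ r. (\<sigma> * r) *\<^sub>R v"]) measurable
    then have "indep_vars (\<lambda>_. borel) (\<lambda>i \<omega>. path_at (?W \<omega>) (t (Suc i)) - path_at (?W \<omega>) (t i)) {..<n}"
      by (simp add: path_at_line_path tpos scaleR_left_diff_distrib[symmetric] right_diff_distrib)
    then show "prob_space.indep_vars (distr N borel ?W) (\<lambda>_. borel) (\<lambda>i \<omega>. path_at \<omega> (t (Suc i)) - path_at \<omega> (t i)) {..<n}"
      by (intro indep_vars_distr_id[OF Wm]) (auto intro!: borel_measurable_diff measurable_path_at simp: tpos)
  next
    fix s t :: real and w :: "real^'d" assume st: "0 \<le> s" "s < t"
    have law: "distr N borel (\<lambda>\<omega>. path_at (B \<omega>) t - path_at (B \<omega>) s) = centered_normal (t - s)"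
      using bm st by (simp add: real_bm_def)
    have [measurable]: "(\<lambda>\<omega>. path_at (B \<omega>) t - path_at (B \<omega>) s) \<in> borel_measurable N"
      by (intro borel_measurable_diff measurable_path_at Bm) (use st in auto)
    have "distr (distr N borel ?W) borel (\<lambda>\<omega>. w \<bullet> (path_at \<omega> t - path_at \<omega> s))
        = distr N borel (\<lambda>\<omega>. w \<bullet> (path_at (?W \<omega>) t - path_at (?W \<omega>) s))"
      by (subst distr_distr[OF _ Wm])
         (use st in \<open>auto simp: o_def intro!: borel_measurable_inner borel_measurable_diff measurable_path_at\<close>)
    also have "(\<lambda>\<omega>. w \<bullet> (path_at (?W \<omega>) t - path_at (?W \<omega>) s))
        = (\<lambda>\<omega>. (\<sigma> * (w \<bullet> v)) * (path_at (B \<omega>) t - path_at (B \<omega>) s))"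
      using st by (simp add: path_at_line_path inner_diff_right algebra_simps)
    also have "distr N borel \<dots> = distr (distr N borel (\<lambda>\<omega>. path_at (B \<omega>) t - path_at (B \<omega>) s)) borel (\<lambda>x. (\<sigma> * (w \<bullet> v)) * x)"
      by (subst distr_distr) (auto simp: o_def)
    also have "\<dots> = centered_normal ((\<sigma> * (w \<bullet> v))\<^sup>2 * (t - s))"
      unfolding law by (rule centered_normal_scale) (use st in simp)
    finally show "distr (distr N borel ?W) borel (\<lambda>\<omega>. w \<bullet> (path_at \<omega> t - path_at \<omega> s))
        = centered_normal ((t - s) * (w \<bullet> (S *v w)))"
      unfolding quad by (simp add: mult.commute)
  qed
qed

section \<open>Comparison with Brownian motion with drift\<close>

context sqrt_erw
begin

definition \<sigma> where "\<sigma> = sqrt (expectation (\<lambda>\<omega>. (\<zeta> 0 \<omega> \<bullet> l)\<^sup>2))"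

lemma inner_\<zeta>_le: "\<omega> \<in> space M \<Longrightarrow> \<bar>\<zeta> i \<omega> \<bullet> l\<bar> \<le> K"
  using inner_l_le[of "\<zeta> i \<omega>"] K(2)[of \<omega> i] by simp

lemma integrable_\<zeta>_sq: "integrable M (\<lambda>\<omega>. (\<zeta> i \<omega> \<bullet> l)\<^sup>2)"
  by (rule integrable_power_bounded[OF _ inner_\<zeta>_le]) auto

lemma second_moment_\<zeta>: "expectation (\<lambda>\<omega>. (\<zeta> i \<omega> \<bullet> l)\<^sup>2) = \<sigma>\<^sup>2"
proof -
  have d: "expectation (\<lambda>\<omega>. (\<zeta> i \<omega> \<bullet> l)\<^sup>2) = (\<integral>v. (v \<bullet> l)\<^sup>2 \<partial>distr M borel (\<zeta> i))" for i
    by (subst integral_distr) auto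
  have "expectation (\<lambda>\<omega>. (\<zeta> i \<omega> \<bullet> l)\<^sup>2) = expectation (\<lambda>\<omega>. (\<zeta> 0 \<omega> \<bullet> l)\<^sup>2)"
    unfolding d[of i] d[of 0] using law_\<zeta>[of i] by (rule arg_cong)
  then show ?thesis unfolding \<sigma>_def by (simp add: Bochner_Integration.integral_nonneg)
qed

lemma \<sigma>_pos: "0 < \<sigma>"
proof -
  have "expectation (\<lambda>\<omega>. (\<zeta> 0 \<omega> \<bullet> l)\<^sup>2) \<noteq> 0"
  proof
    assume "expectation (\<lambda>\<omega>. (\<zeta> 0 \<omega> \<bullet> l)\<^sup>2) = 0"
    then have "AE \<omega> in M. (\<zeta> 0 \<omega> \<bullet> l)\<^sup>2 = 0"
      by (subst (asm) integral_nonneg_eq_0_iff_AE[OF integrable_\<zeta>_sq]) auto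
    then have "AE \<omega> in M. \<xi> 1 \<omega> \<bullet> l = 0" by (simp add: \<zeta>_def)
    then have "prob {\<omega> \<in> space M. \<xi> 1 \<omega> \<bullet> l = 0} = 1"
      using measurable_steps(1)[of 0] by (subst prob_Collect_eq_1) (auto simp: \<zeta>_def)
    then show False using nondegenerate_\<xi>[of 1 l] direction by simp
  qed
  moreover have "0 \<le> expectation (\<lambda>\<omega>. (\<zeta> 0 \<omega> \<bullet> l)\<^sup>2)" by (rule Bochner_Integration.integral_nonneg) simp
  ultimately have "0 < expectation (\<lambda>\<omega>. (\<zeta> 0 \<omega> \<bullet> l)\<^sup>2)" by linarith
  then show ?thesis unfolding \<sigma>_def by simp
qed

definition drift_bm :: "real cpath \<Rightarrow> real cpath" where
  "drift_bm f = cpath_of (\<lambda>t. \<sigma> * path_at f t + drift t)"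

lemma path_at_drift_bm: "0 \<le> t \<Longrightarrow> path_at (drift_bm f) t = \<sigma> * path_at f t + drift t"
  unfolding drift_bm_def drift_def
  by (rule path_at_cpath_of) (auto intro!: continuous_intros continuous_on_path_at)

lemma measurable_drift_bm:
  assumes [measurable]: "B \<in> borel_measurable N"
  shows "(\<lambda>\<omega>. drift_bm (B \<omega>)) \<in> borel_measurable N"
proof (rule measurable_cpathI)
  fix t :: real assume "0 \<le> t"
  then show "(\<lambda>\<omega>. path_at (drift_bm (B \<omega>)) t) \<in> borel_measurable N"
    by (simp add: path_at_drift_bm)
qed

abbreviation node :: "nat \<Rightarrow> nat \<Rightarrow> 'a \<Rightarrow> nat \<Rightarrow> real" where
  "node j n \<omega> k \<equiv> Y (nat \<lfloor>real n * (real k / 2^j)\<rfloor>) \<omega> \<bullet> l / sqrt (real n)"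

lemma measurable_Y [measurable]: "Y n \<in> borel_measurable M"
  unfolding Y_def by measurable

lemma measurable_excess [measurable]: "excess n t \<in> borel_measurable M"
  unfolding excess_def by measurable

lemma integrable_excess: "integrable M (excess n t)"
proof -
  define m where "m = nat \<lfloor>real n * t\<rfloor>"
  define A where "A = \<bar>1 / sqrt (real n)\<bar> * (2 * (real m * K)) + \<bar>drift t\<bar>"
  have "norm (excess n t \<omega>) \<le> A" if \<omega>: "\<omega> \<in> space M" for \<omega>
  proof -
    have Xb: "norm (X k \<omega>) \<le> real k * K" for k
    proof (induction k)
      case (Suc k)
      have "norm (X (Suc k) \<omega>) \<le> norm (X k \<omega>) + norm (X (Suc k) \<omega> - X k \<omega>)"
        using norm_triangle_ineq[of "X k \<omega>" "X (Suc k) \<omega> - X k \<omega>"] by simp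
      then show ?case using Suc X_step_le[OF \<omega>, of k] by (simp add: algebra_simps)
    qed (simp add: X_0[OF \<omega>])
    have Yb: "norm (Y m \<omega>) \<le> real m * K"
      unfolding Y_def using sum_norm_bound[of "{..<m}" "\<lambda>i. \<zeta> i \<omega>" K] K(2)[OF \<omega>] by simp
    have "\<bar>(X m \<omega> - Y m \<omega>) \<bullet> l\<bar> \<le> 2 * (real m * K)"
      using inner_l_le[of "X m \<omega> - Y m \<omega>"] norm_triangle_ineq4[of "X m \<omega>" "Y m \<omega>"] Xb[of m] Yb by simp
    then have "\<bar>1 / sqrt (real n)\<bar> * \<bar>(X m \<omega> - Y m \<omega>) \<bullet> l\<bar> \<le> \<bar>1 / sqrt (real n)\<bar> * (2 * (real m * K))"
      by (intro mult_left_mono) auto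
    then have "\<bar>(X m \<omega> - Y m \<omega>) \<bullet> l / sqrt (real n)\<bar> \<le> \<bar>1 / sqrt (real n)\<bar> * (2 * (real m * K))"
      by (simp add: abs_mult[symmetric])
    moreover have "norm (max 0 (a - b)) \<le> \<bar>a\<bar> + \<bar>b\<bar>" for a b :: real by simp
    ultimately show ?thesis unfolding excess_def A_def m_def[symmetric]
      by (meson add_right_mono order_trans)
  qed
  then show ?thesis by (intro integrable_const_bound[of _ A] AE_I2) auto
qed

lemma rescaled_node_le:
  assumes \<omega>: "\<omega> \<in> space M" and n: "n \<ge> 1"
  shows "path_at (proj l (rescaled_path X n \<omega>)) (real k / 2^j)
    \<le> node j n \<omega> k + drift (real k / 2^j) + (excess n (real k / 2^j) \<omega> + K / sqrt (real n))"
proof -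
  let ?t = "real k / 2^j"
  define m where "m = nat \<lfloor>real n * ?t\<rfloor>"
  define r where "r = sqrt (real n)"
  have r: "0 < r" using n by (simp add: r_def)
  let ?p = "path_at (rescaled_path X n \<omega>) ?t"
  have "?p = polyval (real n) (\<lambda>k. X k \<omega> /\<^sub>R r) ?t"
    unfolding rescaled_path_polygon r_def by (rule path_at_polygon) auto
  then have "norm (?p - X m \<omega> /\<^sub>R r) \<le> norm (X (Suc m) \<omega> /\<^sub>R r - X m \<omega> /\<^sub>R r)"
    unfolding m_def by (simp only:) (rule norm_polyval_node_le, auto)
  also have "\<dots> = norm (X (Suc m) \<omega> - X m \<omega>) / r"
    using r by (simp add: scaleR_diff_right[symmetric] divide_inverse mult.commute)
  also have "\<dots> \<le> K / r" using X_step_le[OF \<omega>] r by (intro divide_right_mono) auto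
  finally have "\<bar>(?p - X m \<omega> /\<^sub>R r) \<bullet> l\<bar> \<le> K / r" using inner_l_le order_trans by blast
  then have 1: "?p \<bullet> l \<le> X m \<omega> \<bullet> l / r + K / r"
    by (simp add: inner_diff_left divide_inverse mult.commute)
  have 2: "(X m \<omega> - Y m \<omega>) \<bullet> l / r - drift ?t \<le> excess n ?t \<omega>"
    unfolding excess_def m_def r_def by simp
  show ?thesis
    using 1 2 unfolding m_def[symmetric] r_def[symmetric]
    by (simp add: path_at_proj inner_diff_left diff_divide_distrib)
qed

text \<open>The path of the walk is replaced by its discretisation, with an error that is small uniformly in \<open>n\<close>.
  On the grid the walk is at most \<open>Y\<close> plus drift plus excess; monotonicity of \<open>f\<close> allows the replacement,
  the excess vanishes in mean, and the central limit theorem for the blocks of \<open>Y\<close> yields Brownian motion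
  on the grid. Finally the mesh is refined.\<close>

lemma Lipschitz_comparison:
  fixes f :: "real cpath \<Rightarrow> real" and N :: "'z measure"
  assumes lip: "\<And>x y. \<bar>f x - f y\<bar> \<le> L * dist x y" and L: "0 \<le> L"
    and mono: "\<And>x y. path_le x y \<Longrightarrow> f x \<le> f y" and f01: "\<And>x. 0 \<le> f x" "\<And>x. f x \<le> 1"
    and bm: "real_bm N B"
    and r: "strict_mono r" "\<And>k. r k \<ge> 1"
    and lim: "(\<lambda>k. expectation (\<lambda>\<omega>. f (proj l (rescaled_path X (r k) \<omega>)))) \<longlonglongrightarrow> a"
  shows "a \<le> (\<integral>\<omega>. f (drift_bm (B \<omega>)) \<partial>N)"
proof -
  interpret N: prob_space N using bm by (simp add: real_bm_def)
  have Bm[measurable]: "B \<in> borel_measurable N" using bm by (simp add: real_bm_def)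
  have start: "path_at (B \<omega>) 0 = 0" for \<omega> using bm by (simp add: real_bm_def)
  have fcont: "continuous_on UNIV f"
  proof (rule continuous_onI)
    fix x :: "real cpath" and e :: real assume e: "e > 0"
    show "\<exists>d>0. \<forall>x'\<in>UNIV. dist x' x < d \<longrightarrow> dist (f x') (f x) \<le> e"
    proof (intro exI[of _ "e / (L + 1)"] conjI ballI impI)
      show "0 < e / (L + 1)" using e L by simp
      fix x' assume d: "dist x' x < e / (L + 1)"
      have "L * dist x' x \<le> (L + 1) * dist x' x" by (simp add: algebra_simps)
      also have "\<dots> \<le> e" using d L by (simp add: pos_less_divide_eq mult.commute less_imp_le)
      finally show "dist (f x') (f x) \<le> e" using lip[of x' x] by (simp add: dist_real_def)
    qed
  qed
  have fm[measurable]: "f \<in> borel_measurable borel" by (rule borel_measurable_continuous_onI[OF fcont])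
  have ftend: "(\<lambda>n. f (x n)) \<longlonglongrightarrow> f y" if "x \<longlonglongrightarrow> y" for x y
    using continuous_on_tendsto_compose[OF fcont that] by simp
  have projm[measurable]: "(\<lambda>\<omega>. proj l (rescaled_path X n \<omega>)) \<in> borel_measurable M" for n
    using measurable_compose[OF measurable_rescaled_path borel_measurable_continuous_onI[OF continuous_on_proj[OF direction]]] .
  have intf: "integrable M (\<lambda>\<omega>. f (Z \<omega>))" if "Z \<in> borel_measurable M" for Z
    by (rule integrable_const_bound[of _ 1]) (use f01 measurable_compose[OF that fm] in auto)
  define g where "g j a = f (polygon (2^j) (\<lambda>k. a k + drift (real k / 2^j)))" for j a
  have gm: "g j \<in> borel_measurable (PiM UNIV (\<lambda>_. borel))" for j
    unfolding g_def by (intro measurable_compose[OF _ fm] measurable_polygon) auto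
  define G where "G j = (\<integral>y. g j (\<lambda>k. \<sigma> * (\<Sum>i<k. y i)) \<partial>noise j)" for j
  have clt: "(\<lambda>n. expectation (\<lambda>\<omega>. g j (node j n \<omega>))) \<longlonglongrightarrow> G j" for j
  proof -
    have "(\<lambda>n. expectation (\<lambda>\<omega>. g j (\<lambda>k. (\<Sum>i<nat \<lfloor>real n * (real k / 2^j)\<rfloor>. \<zeta> i \<omega> \<bullet> l) / sqrt (real n)))) \<longlonglongrightarrow> G j"
      unfolding G_def
    proof (rule grid_central_limit[OF _ _ _ _ _ \<sigma>_pos gm])
      show "indep_vars (\<lambda>_. borel) (\<lambda>i \<omega>. \<zeta> i \<omega> \<bullet> l) UNIV"
        by (rule indep_vars_compose2[OF indep_\<zeta>]) measurable
      show "distr M borel (\<lambda>\<omega>. \<zeta> i \<omega> \<bullet> l) = distr M borel (\<lambda>\<omega>. \<zeta> 0 \<omega> \<bullet> l)" for i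
      proof -
        have d: "distr M borel (\<lambda>\<omega>. \<zeta> i \<omega> \<bullet> l) = distr (distr M borel (\<zeta> i)) borel (\<lambda>v. v \<bullet> l)" for i
          by (subst distr_distr) (auto simp: o_def)
        show ?thesis unfolding d[of i] d[of 0] using law_\<zeta>[of i] by (rule arg_cong)
      qed
      show "expectation (\<lambda>\<omega>. \<zeta> i \<omega> \<bullet> l) = 0" for i by (rule mean_\<zeta>)
      show "integrable M (\<lambda>\<omega>. (\<zeta> i \<omega> \<bullet> l)\<^sup>2)" for i by (rule integrable_\<zeta>_sq)
      show "variance (\<lambda>\<omega>. \<zeta> i \<omega> \<bullet> l) = \<sigma>\<^sup>2" for i by (simp add: mean_\<zeta> second_moment_\<zeta>)
      show "(\<lambda>n. g j (a n)) \<longlonglongrightarrow> g j b" if "\<And>k. (\<lambda>n. a n k) \<longlonglongrightarrow> b k" for a b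
        unfolding g_def by (intro ftend tendsto_polygon tendsto_add that tendsto_const) simp
      show "\<bar>g j a\<bar> \<le> 1" for a unfolding g_def using f01 by simp
    qed
    then show ?thesis by (simp add: Y_def inner_sum_left)
  qed
  define err where "err j T n = (\<Sum>k\<le>2^j * T + 1. expectation (excess n (real k / 2^j)) + K / sqrt (real n))"
    for j T n :: nat
  have err_lim: "err j T \<longlonglongrightarrow> 0" for j T
  proof -
    have "(\<lambda>n. sqrt (1 / real n)) \<longlonglongrightarrow> sqrt 0" by (intro tendsto_real_sqrt lim_1_over_n)
    then have "(\<lambda>n. 1 / sqrt (real n)) \<longlonglongrightarrow> 0" by (simp add: real_sqrt_divide)
    from tendsto_mult[OF tendsto_const this, of K]
    have "(\<lambda>n. K / sqrt (real n)) \<longlonglongrightarrow> 0" by simp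
    then have "err j T \<longlonglongrightarrow> (\<Sum>k\<le>2^j * T + 1. 0 + 0)"
      unfolding err_def by (intro tendsto_sum tendsto_add excess_tendsto) auto
    then show ?thesis by simp
  qed
  have step: "expectation (\<lambda>\<omega>. f (proj l (rescaled_path X n \<omega>)))
      \<le> expectation (\<lambda>\<omega>. g j (node j n \<omega>)) + L * (err j T n + (1/2)^T) + L * chain_tail c\<^sub>1 j"
    if n: "n \<ge> 1" for n j T
  proof -
    let ?Z = "\<lambda>\<omega>. proj l (rescaled_path X n \<omega>)"
    let ?e = "\<lambda>\<omega> k. excess n (real k / 2^j) \<omega> + K / sqrt (real n)"
    have e0: "0 \<le> ?e \<omega> k" for \<omega> k using K(1) by (simp add: excess_def)
    have pt: "f (?Z \<omega>) \<le> g j (node j n \<omega>) + L * ((\<Sum>k\<le>2^j * T + 1. ?e \<omega> k) + (1/2)^T)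
        + L * dist (?Z \<omega>) (dyadic_interp j (?Z \<omega>))" if \<omega>: "\<omega> \<in> space M" for \<omega>
    proof -
      let ?a = "\<lambda>k. node j n \<omega> k + drift (real k / 2^j)"
      have "f (?Z \<omega>) \<le> f (dyadic_interp j (?Z \<omega>)) + L * dist (?Z \<omega>) (dyadic_interp j (?Z \<omega>))"
        using lip[of "?Z \<omega>" "dyadic_interp j (?Z \<omega>)"] by linarith
      also have "f (dyadic_interp j (?Z \<omega>)) \<le> f (polygon (2^j) (\<lambda>k. ?a k + ?e \<omega> k))"
      proof (rule mono)
        show "path_le (dyadic_interp j (?Z \<omega>)) (polygon (2^j) (\<lambda>k. ?a k + ?e \<omega> k))"
          unfolding path_le_def dyadic_interp_def
        proof (intro allI impI)
          fix t :: real assume t: "0 \<le> t"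
          show "path_at (polygon (2^j) (\<lambda>k. path_at (?Z \<omega>) (real k / 2^j))) t
              \<le> path_at (polygon (2^j) (\<lambda>k. ?a k + ?e \<omega> k)) t"
            unfolding path_at_polygon[OF zero_le_power[OF zero_le_numeral] t]
            by (rule polyval_mono[OF _ t rescaled_node_le[OF \<omega> n]]) simp
        qed
      qed
      also have "f (polygon (2^j) (\<lambda>k. ?a k + ?e \<omega> k))
          \<le> f (polygon (2^j) ?a) + L * dist (polygon (2^j) (\<lambda>k. ?a k + ?e \<omega> k)) (polygon (2^j) ?a)"
        using lip[of "polygon (2^j) (\<lambda>k. ?a k + ?e \<omega> k)" "polygon (2^j) ?a"] by linarith
      also have "dist (polygon (2^j) (\<lambda>k. ?a k + ?e \<omega> k)) (polygon (2^j) ?a) \<le> (\<Sum>k\<le>2^j * T + 1. ?e \<omega> k) + (1/2)^T"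
        by (rule dist_polygon_add_le) (rule e0)
      finally show ?thesis using L by (simp add: g_def mult_left_mono)
    qed
    have nodem: "(\<lambda>\<omega>. g j (node j n \<omega>)) \<in> borel_measurable M"
      by (rule measurable_compose[OF _ gm]) (rule measurable_PiM_single', auto)
    have intg: "integrable M (\<lambda>\<omega>. g j (node j n \<omega>))"
      by (rule integrable_const_bound[of _ 1]) (use f01 nodem in \<open>auto simp: g_def\<close>)
    have intd: "integrable M (\<lambda>\<omega>. dist (?Z \<omega>) (dyadic_interp j (?Z \<omega>)))"
      by (rule integrable_dist_cpath) measurable
    have inte: "integrable M (\<lambda>\<omega>. ?e \<omega> k)" for k using integrable_excess by auto
    have "expectation (\<lambda>\<omega>. f (?Z \<omega>)) \<le> expectation (\<lambda>\<omega>. g j (node j n \<omega>)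
        + L * ((\<Sum>k\<le>2^j * T + 1. ?e \<omega> k) + (1/2)^T) + L * dist (?Z \<omega>) (dyadic_interp j (?Z \<omega>)))"
      by (intro integral_mono intf projm pt Bochner_Integration.integrable_add integrable_mult_right
        Bochner_Integration.integrable_sum intg intd inte integrable_const)
    also have "\<dots> = expectation (\<lambda>\<omega>. g j (node j n \<omega>)) + L * ((\<Sum>k\<le>2^j * T + 1. expectation (\<lambda>\<omega>. ?e \<omega> k)) + (1/2)^T)
        + L * expectation (\<lambda>\<omega>. dist (?Z \<omega>) (dyadic_interp j (?Z \<omega>)))"
    proof -
      have "integrable M (\<lambda>\<omega>. \<Sum>k\<le>2^j * T + 1. ?e \<omega> k)" by (intro Bochner_Integration.integrable_sum inte)
      moreover have "expectation (\<lambda>\<omega>. \<Sum>k\<le>2^j * T + 1. ?e \<omega> k) = (\<Sum>k\<le>2^j * T + 1. expectation (\<lambda>\<omega>. ?e \<omega> k))"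
        by (intro Bochner_Integration.integral_sum inte)
      ultimately show ?thesis using intg intd by (simp add: prob_space del: sum.atMost_Suc)
    qed
    also have "(\<Sum>k\<le>2^j * T + 1. expectation (\<lambda>\<omega>. ?e \<omega> k)) = err j T n"
      unfolding err_def using integrable_excess by (simp add: prob_space)
    also have "expectation (\<lambda>\<omega>. dist (?Z \<omega>) (dyadic_interp j (?Z \<omega>))) \<le> chain_tail c\<^sub>1 j"
      by (rule expectation_dist_dyadic_interp[OF projm moment4_proj[OF direction measurable_rescaled_path rescaled_path_moment4[OF n]] c\<^sub>1_nonneg])
    finally show ?thesis using L by (simp add: mult_left_mono)
  qed
  have sub: "filterlim r at_top sequentially" by (rule filterlim_subseq[OF r(1)])
  have aT: "a \<le> G j + L * (0 + (1/2)^T) + L * chain_tail c\<^sub>1 j" for j T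
  proof (rule LIMSEQ_le[OF lim])
    show "(\<lambda>k. expectation (\<lambda>\<omega>. g j (node j (r k) \<omega>)) + L * (err j T (r k) + (1/2)^T) + L * chain_tail c\<^sub>1 j)
        \<longlonglongrightarrow> G j + L * (0 + (1/2)^T) + L * chain_tail c\<^sub>1 j"
      by (intro tendsto_add tendsto_mult tendsto_const filterlim_compose[OF clt sub] filterlim_compose[OF err_lim sub])
    show "\<exists>N. \<forall>k\<ge>N. expectation (\<lambda>\<omega>. f (proj l (rescaled_path X (r k) \<omega>)))
        \<le> expectation (\<lambda>\<omega>. g j (node j (r k) \<omega>)) + L * (err j T (r k) + (1/2)^T) + L * chain_tail c\<^sub>1 j"
      using step[OF r(2)] by blast
  qed
  have aj: "a \<le> G j + L * chain_tail c\<^sub>1 j" for j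
  proof (rule LIMSEQ_le_const)
    have "(\<lambda>T. G j + L * (0 + (1/2)^T) + L * chain_tail c\<^sub>1 j) \<longlonglongrightarrow> G j + L * (0 + 0) + L * chain_tail c\<^sub>1 j"
      by (intro tendsto_intros LIMSEQ_power_zero) simp
    then show "(\<lambda>T. G j + L * (0 + (1/2)^T) + L * chain_tail c\<^sub>1 j) \<longlonglongrightarrow> G j + L * chain_tail c\<^sub>1 j" by simp
    show "\<exists>N. \<forall>T\<ge>N. a \<le> G j + L * (0 + (1/2)^T) + L * chain_tail c\<^sub>1 j" using aT by blast
  qed
  have GB: "G j = (\<integral>\<omega>. f (dyadic_interp j (drift_bm (B \<omega>))) \<partial>N)" for j
  proof -
    let ?D = "\<lambda>\<omega> k. path_at (B \<omega>) (real (Suc k) / 2^j) - path_at (B \<omega>) (real k / 2^j)"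
    have tele: "(\<Sum>i<k. ?D \<omega> i) = path_at (B \<omega>) (real k / 2^j)" for \<omega> k
      by (subst sum_lessThan_telescope) (simp add: start)
    have Dm: "?D \<in> measurable N (PiM UNIV (\<lambda>_. borel))"
      by (rule measurable_PiM_single') auto
    have gm': "(\<lambda>y. g j (\<lambda>k. \<sigma> * (\<Sum>i<k. y i))) \<in> borel_measurable (PiM UNIV (\<lambda>_. borel))"
      by (rule measurable_compose[OF _ gm]) (rule measurable_PiM_single', auto)
    have "G j = (\<integral>\<omega>. g j (\<lambda>k. \<sigma> * (\<Sum>i<k. ?D \<omega> i)) \<partial>N)"
      unfolding G_def real_bm_noise[OF bm, of j, symmetric] by (rule integral_distr[OF Dm gm'])
    then show ?thesis unfolding tele by (simp add: g_def dyadic_interp_def path_at_drift_bm)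
  qed
  have "(\<lambda>j. \<integral>\<omega>. f (dyadic_interp j (drift_bm (B \<omega>))) \<partial>N) \<longlonglongrightarrow> (\<integral>\<omega>. f (drift_bm (B \<omega>)) \<partial>N)"
  proof (rule integral_dominated_convergence[where w = "\<lambda>_. 1"])
    have dm[measurable]: "(\<lambda>\<omega>. drift_bm (B \<omega>)) \<in> borel_measurable N" by (rule measurable_drift_bm[OF Bm])
    show "(\<lambda>\<omega>. f (drift_bm (B \<omega>))) \<in> borel_measurable N" by measurable
    show "(\<lambda>\<omega>. f (dyadic_interp j (drift_bm (B \<omega>)))) \<in> borel_measurable N" for j by measurable
    show "AE \<omega> in N. (\<lambda>j. f (dyadic_interp j (drift_bm (B \<omega>)))) \<longlonglongrightarrow> f (drift_bm (B \<omega>))"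
      by (intro AE_I2 ftend dyadic_interp_tendsto)
  qed (use f01 in auto)
  then have "(\<lambda>j. G j + L * chain_tail c\<^sub>1 j) \<longlonglongrightarrow> (\<integral>\<omega>. f (drift_bm (B \<omega>)) \<partial>N) + L * 0"
    unfolding GB by (intro tendsto_add tendsto_mult tendsto_const chain_tail_tendsto)
  then show ?thesis by (intro LIMSEQ_le_const[where X = "\<lambda>j. G j + L * chain_tail c\<^sub>1 j"]) (use aj in auto)
qed

lemma tight_rescaled_paths: "tight_family {distr M borel (rescaled_path X n) | n. n \<ge> 1}"
  unfolding tight_family_def
proof (intro conjI ballI allI impI)
  fix \<nu> assume "\<nu> \<in> {distr M borel (rescaled_path X n) | n. n \<ge> 1}"
  then show "prob_space \<nu>" "sets \<nu> = sets borel" by (auto intro!: prob_space_distr)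
next
  fix e :: real assume e: "e > 0"
  obtain Kc :: "(real^'d) cpath set" where Kc: "compact Kc"
    "\<And>Z. Z \<in> borel_measurable M \<Longrightarrow> moment4 M c\<^sub>1 Z \<Longrightarrow> (\<forall>x\<in>space M. path_at (Z x) 0 = 0)
      \<Longrightarrow> 1 - e \<le> measure (distr M borel Z) Kc"
    using tight_from_moment4[OF c\<^sub>1_nonneg e, where ?'b = "real^'d"] by blast
  show "\<exists>K. compact K \<and> (\<forall>\<nu>\<in>{distr M borel (rescaled_path X n) | n. n \<ge> 1}. 1 - e \<le> measure \<nu> K)"
    using Kc(1) by (intro exI[of _ Kc]) (auto intro!: Kc(2) rescaled_path_moment4 rescaled_path_start)
qed

lemma limit_law_dominated:
  assumes bm: "real_bm N B" and lim: "limit_law (\<lambda>n. distr M borel (rescaled_path X n)) \<nu>"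
  shows "stoch_dominated \<nu> (proj l) N (\<lambda>\<omega>. drift_bm (B \<omega>))"
  unfolding stoch_dominated_def
proof (intro allI impI)
  fix H :: "real cpath \<Rightarrow> real"
  assume H: "H \<in> borel_measurable borel" "bounded (range H)" "\<forall>f g. (\<forall>t\<ge>0. path_at f t \<le> path_at g t) \<longrightarrow> H f \<le> H g"
  interpret N: prob_space N using bm by (simp add: real_bm_def)
  have Bm: "B \<in> borel_measurable N" using bm by (simp add: real_bm_def)
  have dm: "(\<lambda>\<omega>. drift_bm (B \<omega>)) \<in> borel_measurable N" by (rule measurable_drift_bm[OF Bm])
  obtain r where r: "strict_mono r" "\<And>k. r k \<ge> 1" "weak_conv_law (\<lambda>k. distr M borel (rescaled_path X (r k))) \<nu>"
    and \<nu>: "prob_space \<nu>" "sets \<nu> = sets borel"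
    using lim unfolding limit_law_def by blast
  have pm: "proj l \<in> borel_measurable borel"
    by (rule borel_measurable_continuous_onI[OF continuous_on_proj[OF direction]])
  then have pm\<nu>: "proj l \<in> borel_measurable \<nu>" using measurable_cong_sets[OF \<nu>(2) refl] by blast
  define \<alpha> where "\<alpha> = distr \<nu> borel (proj l)"
  define \<beta> where "\<beta> = distr N borel (\<lambda>\<omega>. drift_bm (B \<omega>))"
  have "integral\<^sup>L \<alpha> H \<le> integral\<^sup>L \<beta> H"
  proof (rule domination_from_Lipschitz)
    show "prob_space \<alpha>" unfolding \<alpha>_def by (rule prob_space.prob_space_distr[OF \<nu>(1) pm\<nu>])
    show "prob_space \<beta>" unfolding \<beta>_def by (rule N.prob_space_distr[OF dm])
    show "H x \<le> H y" if "path_le x y" for x y using H(3) that by (simp add: path_le_def)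
    fix f :: "real cpath \<Rightarrow> real" and L :: real
    assume f: "\<And>x y. \<bar>f x - f y\<bar> \<le> L * dist x y" "\<And>x y. path_le x y \<Longrightarrow> f x \<le> f y" "\<And>x. 0 \<le> f x" "\<And>x. f x \<le> 1"
    have lip: "\<bar>f x - f y\<bar> \<le> \<bar>L\<bar> * dist x y" for x y
      using order_trans[OF f(1) mult_right_mono[OF abs_ge_self zero_le_dist]] .
    have fcont: "continuous_on UNIV f"
    proof -
      have "\<bar>L\<bar>-lipschitz_on UNIV f" by (rule lipschitz_onI) (use lip in \<open>auto simp: dist_real_def\<close>)
      then show ?thesis by (rule lipschitz_on_continuous_on)
    qed
    have fm: "f \<in> borel_measurable borel" by (rule borel_measurable_continuous_onI[OF fcont])
    have "continuous_on UNIV (\<lambda>y. f (proj l y))"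
      by (rule continuous_on_compose2[OF fcont continuous_on_proj[OF direction]]) auto
    moreover have "bounded (range (\<lambda>y. f (proj l y)))"
      unfolding bounded_iff using f(3,4) by (intro exI[of _ 1]) auto
    ultimately have "(\<lambda>k. \<integral>y. f (proj l y) \<partial>distr M borel (rescaled_path X (r k))) \<longlonglongrightarrow> (\<integral>y. f (proj l y) \<partial>\<nu>)"
      using r(3) unfolding weak_conv_law_def by blast
    moreover have "(\<integral>y. f (proj l y) \<partial>distr M borel (rescaled_path X n)) = expectation (\<lambda>\<omega>. f (proj l (rescaled_path X n \<omega>)))" for n
      by (rule integral_distr[OF measurable_rescaled_path measurable_compose[OF pm fm]])
    ultimately have "(\<lambda>k. expectation (\<lambda>\<omega>. f (proj l (rescaled_path X (r k) \<omega>)))) \<longlonglongrightarrow> (\<integral>y. f (proj l y) \<partial>\<nu>)"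
      by simp
    from Lipschitz_comparison[OF lip abs_ge_zero f(2,3,4) bm r(1,2) this]
    have "(\<integral>y. f (proj l y) \<partial>\<nu>) \<le> (\<integral>\<omega>. f (drift_bm (B \<omega>)) \<partial>N)" .
    then show "integral\<^sup>L \<alpha> f \<le> integral\<^sup>L \<beta> f"
      unfolding \<alpha>_def \<beta>_def integral_distr[OF pm\<nu> fm] integral_distr[OF dm fm] .
  qed (use H in \<open>auto simp: \<alpha>_def \<beta>_def\<close>)
  then show "(\<integral>y. H (proj l y) \<partial>\<nu>) \<le> (\<integral>\<omega>. H (drift_bm (B \<omega>)) \<partial>N)"
    unfolding \<alpha>_def \<beta>_def integral_distr[OF pm\<nu> H(1)] integral_distr[OF dm H(1)] .
qed

end

theorem mainTheorem9:
  fixes M :: "'a measure"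
    and F :: "nat \<Rightarrow> 'a measure"
    and l :: "real^'d"
    and C :: real
    and \<xi> \<gamma> X :: "nat \<Rightarrow> 'a \<Rightarrow> real^'d"
    and U :: "nat \<Rightarrow> 'a \<Rightarrow> real"
  assumes "CARD('d) \<ge> 2"
    and "C > 0"
    and "excited_random_walk M F l (\<lambda>n. min (C * real n powr (-1/2)) 1) \<xi> \<gamma> U X"
  shows "tight_family {distr M borel (rescaled_path X n) | n. n \<ge> 1} \<and>
    (\<exists>(N :: (real^'d) cpath measure) (W :: (real^'d) cpath \<Rightarrow> (real^'d) cpath).
       brownian_motion N W \<and>
       (\<forall>\<nu>. limit_law (\<lambda>n. distr M borel (rescaled_path X n)) \<nu> \<longrightarrow>
          stoch_dominated
            \<nu> (\<lambda>y. cpath_of (\<lambda>t. path_at y t \<bullet> l))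
            N (\<lambda>\<omega>. cpath_of (\<lambda>t. path_at (W \<omega>) t \<bullet> l
                 + 2 * C * escape_prob M \<xi> * (\<integral>\<omega>'. \<gamma> 1 \<omega>' \<bullet> l \<partial>M) * sqrt t))))"
proof -
  interpret sqrt_erw M F l C \<xi> \<gamma> U X
    using assms(2,3) by (simp add: sqrt_erw_def sqrt_erw_axioms_def)
  obtain N0 :: "(real \<Rightarrow> real) measure" and B where bm: "real_bm N0 B"
    using real_bm_exists by blast
  have Bm: "B \<in> borel_measurable N0" using bm by (simp add: real_bm_def)
  define N where "N = distr N0 borel (\<lambda>\<omega>. line_path \<sigma> l (B \<omega>))"
  have Wm: "(\<lambda>\<omega>. line_path \<sigma> l (B \<omega>)) \<in> borel_measurable N0" by (rule measurable_line_path[OF Bm])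
  define \<Phi> where "\<Phi> w = cpath_of (\<lambda>t. path_at w t \<bullet> l + drift t)" for w :: "(real^'d) cpath"
  have \<Phi>_at: "path_at (\<Phi> w) t = path_at w t \<bullet> l + drift t" if "0 \<le> t" for w t
    unfolding \<Phi>_def drift_def using that
    by (intro path_at_cpath_of) (auto intro!: continuous_intros continuous_on_path_at)
  have \<Phi>m: "\<Phi> \<in> borel_measurable borel"
  proof (rule measurable_cpathI)
    fix t :: real assume t: "0 \<le> t"
    show "(\<lambda>w. path_at (\<Phi> w) t) \<in> borel_measurable borel"
      unfolding \<Phi>_at[OF t]
      by (intro borel_measurable_add borel_measurable_inner borel_measurable_const
        borel_measurable_continuous_onI[OF continuous_on_path_at_cpath[OF t]])
  qed
  have \<Phi>_line: "\<Phi> (line_path \<sigma> l f) = drift_bm f" for f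
    by (rule cpath_eqI) (use direction in \<open>simp add: \<Phi>_at path_at_line_path path_at_drift_bm dot_square_norm\<close>)
  have "stoch_dominated \<nu> (proj l) N \<Phi>"
    if lim: "limit_law (\<lambda>n. distr M borel (rescaled_path X n)) \<nu>" for \<nu>
    unfolding stoch_dominated_def
  proof (intro allI impI)
    fix H :: "real cpath \<Rightarrow> real"
    assume H: "H \<in> borel_measurable borel" "bounded (range H)" "\<forall>f g. (\<forall>t\<ge>0. path_at f t \<le> path_at g t) \<longrightarrow> H f \<le> H g"
    have "(\<integral>y. H (proj l y) \<partial>\<nu>) \<le> (\<integral>\<omega>. H (drift_bm (B \<omega>)) \<partial>N0)"
      using limit_law_dominated[OF bm lim] H unfolding stoch_dominated_def by blast
    also have "\<dots> = (\<integral>w. H (\<Phi> w) \<partial>N)"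
      unfolding N_def by (subst integral_distr[OF Wm measurable_compose[OF \<Phi>m H(1)]]) (simp add: \<Phi>_line)
    finally show "(\<integral>y. H (proj l y) \<partial>\<nu>) \<le> (\<integral>w. H (\<Phi> w) \<partial>N)" .
  qed
  then have "\<forall>\<nu>. limit_law (\<lambda>n. distr M borel (rescaled_path X n)) \<nu> \<longrightarrow>
          stoch_dominated \<nu> (\<lambda>y. cpath_of (\<lambda>t. path_at y t \<bullet> l))
            N (\<lambda>\<omega>. cpath_of (\<lambda>t. path_at ((\<lambda>x. x) \<omega>) t \<bullet> l
                 + 2 * C * escape_prob M \<xi> * (\<integral>\<omega>'. \<gamma> 1 \<omega>' \<bullet> l \<partial>M) * sqrt t))"
    unfolding \<Phi>_def[abs_def] proj_def[abs_def] drift_def \<mu>_def by simp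
  moreover have "brownian_motion N (\<lambda>x. x)" unfolding N_def by (rule brownian_line[OF bm])
  ultimately show ?thesis using tight_rescaled_paths by blast
qed

end
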